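(* For every $\delta>0$ and $\zeta\in\mathbb{R}$, the shear flow $(u_\delta,0)$ on the half-plane $\Omega=\mathbb{R}\times(0,+\infty)$ with $$u_\delta(y)=\tanh(y-\delta)+\zeta$$ is linearly unstable for the Euler equation.
   Context: A shear flow is a smooth 2D vector field of the form $(u_{sh}(y),0)$ on $\Omega=\mathbb{R}\times(0,+\infty)$; the vector field and its first component are both denoted $u_{sh}$. It is linearly unstable (for the Euler equation) if there exist $k\in\mathbb{R}$, $\lambda\in\mathbb{C}$ with $\Re(\lambda)>0$ and a nonzero function $\Psi\in H^1_0(\mathbb{R}^+)$ such that $$u(t,x,y)=\left(e^{\lambda t}e^{ikx}\Psi'(y),\,-ike^{\lambda t}e^{ikx}\Psi(y)\right)$$ is a solution, for some pressure $p$, of the Euler equation linearised around $u_{sh}$: $\partial_t u+u_{sh}\cdot\nabla u+u\cdot\nabla u_{sh}+\nabla p=0$, $\mathrm{div}\,u=0$ in $\mathbb{R}^+\times\Omega$, with $u_2|_{y=0}=0$ on the boundary. *)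

theory Defs
  imports "HOL-Analysis.Analysis"
begin

text \<open>Iterated partial derivatives along the standard basis. Only meant for open \<open>S\<close>,
  since the derivatives are two-sided.\<close>

primrec Ck_on ::
    "nat \<Rightarrow> ('a::euclidean_space \<Rightarrow> 'b::real_normed_vector) \<Rightarrow> 'a set \<Rightarrow> bool" where
  "Ck_on 0 f S \<longleftrightarrow> continuous_on S f"
| "Ck_on (Suc n) f S \<longleftrightarrow> (\<forall>x\<in>S. f differentiable (at x)) \<and>
     (\<forall>i\<in>Basis. Ck_on n (\<lambda>x. frechet_derivative f (at x) i) S)"

definition smooth_on :: "'a set \<Rightarrow> ('a::euclidean_space \<Rightarrow> 'b::real_normed_vector) \<Rightarrow> bool" where
  "smooth_on S f \<longleftrightarrow> (\<forall>n. Ck_on n f S)"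

definition test_fun :: "'a set \<Rightarrow> ('a::euclidean_space \<Rightarrow> real) \<Rightarrow> bool" where
  "test_fun U \<phi> \<longleftrightarrow> smooth_on UNIV \<phi> \<and> (\<exists>K. compact K \<and> K \<subseteq> U \<and> (\<forall>x. x \<notin> K \<longrightarrow> \<phi> x = 0))"

definition locally_integrable_on :: "('a::euclidean_space \<Rightarrow> complex) \<Rightarrow> 'a set \<Rightarrow> bool" where
  "locally_integrable_on f U \<longleftrightarrow> (\<forall>K. compact K \<and> K \<subseteq> U \<longrightarrow> set_integrable lborel K f)"

definition square_integrable_on :: "(real \<Rightarrow> complex) \<Rightarrow> real set \<Rightarrow> bool" where
  "square_integrable_on f U \<longleftrightarrow>
     set_borel_measurable lborel U f \<and> set_integrable lborel U (\<lambda>y. (cmod (f y))\<^sup>2)"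

definition weak_deriv_on :: "real set \<Rightarrow> (real \<Rightarrow> complex) \<Rightarrow> (real \<Rightarrow> complex) \<Rightarrow> bool" where
  "weak_deriv_on U f g \<longleftrightarrow> locally_integrable_on f U \<and> locally_integrable_on g U \<and>
     (\<forall>\<phi>. test_fun U \<phi> \<longrightarrow>
        (LINT y:U|lborel. deriv \<phi> y *\<^sub>R f y) = - (LINT y:U|lborel. \<phi> y *\<^sub>R g y))"

text \<open>\<open>H10_half_line \<Psi> \<Psi>'\<close> says that \<open>\<Psi> \<in> H\<^sup>1\<^sub>0(\<real>\<^sup>+)\<close> and that \<open>\<Psi>'\<close> is its weak derivative.
  An \<open>H\<^sup>1\<close> function on the half-line has a unique representative that is continuous on
  \<open>[0,\<infinity>)\<close>. It is this representative that \<open>\<Psi>\<close> denotes, and its value at \<open>0\<close> is the trace.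
  The values of \<open>\<Psi>\<close> and \<open>\<Psi>'\<close> at negative arguments are irrelevant throughout.\<close>

definition H10_half_line :: "(real \<Rightarrow> complex) \<Rightarrow> (real \<Rightarrow> complex) \<Rightarrow> bool" where
  "H10_half_line \<Psi> \<Psi>' \<longleftrightarrow>
     square_integrable_on \<Psi> {0<..} \<and> square_integrable_on \<Psi>' {0<..} \<and>
     weak_deriv_on {0<..} \<Psi> \<Psi>' \<and>
     continuous_on {0..} \<Psi> \<and> \<Psi> 0 = 0"

definition half_plane :: "(real \<times> real) set" where
  "half_plane = UNIV \<times> {0<..}"

definition shear_flow :: "(real \<Rightarrow> real) \<Rightarrow> bool" where
  "shear_flow u_sh \<longleftrightarrow> smooth_on half_plane (\<lambda>(x, y). (u_sh y, 0::real))"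

text \<open>Space-time points are triples \<open>(t, x, y)\<close>.\<close>

definition spacetime :: "(real \<times> real \<times> real) set" where
  "spacetime = {0<..} \<times> half_plane"

definition pd_t :: "(real \<times> real \<times> real \<Rightarrow> real) \<Rightarrow> real \<times> real \<times> real \<Rightarrow> real" where
  "pd_t \<phi> q = frechet_derivative \<phi> (at q) (1, 0, 0)"

definition pd_x :: "(real \<times> real \<times> real \<Rightarrow> real) \<Rightarrow> real \<times> real \<times> real \<Rightarrow> real" where
  "pd_x \<phi> q = frechet_derivative \<phi> (at q) (0, 1, 0)"

definition pd_y :: "(real \<times> real \<times> real \<Rightarrow> real) \<Rightarrow> real \<times> real \<times> real \<Rightarrow> real" where
  "pd_y \<phi> q = frechet_derivative \<phi> (at q) (0, 0, 1)"

text \<open>The Euler equation linearised around the shear flow \<open>(u_sh(y), 0)\<close>, in the sense of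
  distributions on \<open>(0,\<infinity>) \<times> \<Omega>\<close>. Since
  \<open>u_sh \<cdot> \<nabla>u = u_sh(y) \<partial>\<^sub>x u\<close> and \<open>u \<cdot> \<nabla>u_sh = (u\<^sub>2 u_sh'(y), 0)\<close>, the system reads
  \<open>\<partial>\<^sub>t u\<^sub>1 + u_sh \<partial>\<^sub>x u\<^sub>1 + u_sh' u\<^sub>2 + \<partial>\<^sub>x p = 0\<close>,
  \<open>\<partial>\<^sub>t u\<^sub>2 + u_sh \<partial>\<^sub>x u\<^sub>2 + \<partial>\<^sub>y p = 0\<close>,
  \<open>\<partial>\<^sub>x u\<^sub>1 + \<partial>\<^sub>y u\<^sub>2 = 0\<close>.
  Distributional derivatives are moved to the test function, and \<open>u_sh\<close> does not depend
  on \<open>x\<close>. The boundary condition \<open>u\<^sub>2 = 0\<close> at \<open>y = 0\<close> is a limit from inside the domain.\<close>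

definition linearised_Euler_solution ::
    "(real \<Rightarrow> real) \<Rightarrow> (real \<times> real \<times> real \<Rightarrow> complex) \<Rightarrow> (real \<times> real \<times> real \<Rightarrow> complex)
      \<Rightarrow> (real \<times> real \<times> real \<Rightarrow> complex) \<Rightarrow> bool" where
  "linearised_Euler_solution u_sh u\<^sub>1 u\<^sub>2 p \<longleftrightarrow>
     locally_integrable_on u\<^sub>1 spacetime \<and> locally_integrable_on u\<^sub>2 spacetime \<and>
     locally_integrable_on p spacetime \<and>
     (\<forall>\<phi>. test_fun spacetime \<phi> \<longrightarrow>
        (LINT (t, x, y):spacetime|lborel.
            - (pd_t \<phi> (t, x, y) *\<^sub>R u\<^sub>1 (t, x, y))
            - (u_sh y * pd_x \<phi> (t, x, y)) *\<^sub>R u\<^sub>1 (t, x, y)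
            + (deriv u_sh y * \<phi> (t, x, y)) *\<^sub>R u\<^sub>2 (t, x, y)
            - pd_x \<phi> (t, x, y) *\<^sub>R p (t, x, y)) = 0) \<and>
     (\<forall>\<phi>. test_fun spacetime \<phi> \<longrightarrow>
        (LINT (t, x, y):spacetime|lborel.
            - (pd_t \<phi> (t, x, y) *\<^sub>R u\<^sub>2 (t, x, y))
            - (u_sh y * pd_x \<phi> (t, x, y)) *\<^sub>R u\<^sub>2 (t, x, y)
            - pd_y \<phi> (t, x, y) *\<^sub>R p (t, x, y)) = 0) \<and>
     (\<forall>\<phi>. test_fun spacetime \<phi> \<longrightarrow>
        (LINT q:spacetime|lborel. - (pd_x \<phi> q *\<^sub>R u\<^sub>1 q) - pd_y \<phi> q *\<^sub>R u\<^sub>2 q) = 0) \<and>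
     (\<forall>t>0. \<forall>x. (u\<^sub>2 \<longlongrightarrow> 0) (at (t, x, 0) within spacetime))"

text \<open>\<open>\<mu>\<close> is the growth rate usually written \<open>\<lambda>\<close>. Since \<open>\<Psi>\<close> is continuous,
  \<open>\<exists>y>0. \<Psi> y \<noteq> 0\<close> says that \<open>\<Psi>\<close> is nonzero as an element of \<open>H\<^sup>1\<^sub>0(\<real>\<^sup>+)\<close>.\<close>

definition linearly_unstable :: "(real \<Rightarrow> real) \<Rightarrow> bool" where
  "linearly_unstable u_sh \<longleftrightarrow>
     (\<exists>(k::real) (\<mu>::complex) \<Psi> \<Psi>' p.
        Re \<mu> > 0 \<and> H10_half_line \<Psi> \<Psi>' \<and> (\<exists>y>0. \<Psi> y \<noteq> 0) \<and>
        linearised_Euler_solution u_sh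
          (\<lambda>(t, x, y). exp (\<mu> * of_real t) * exp (\<i> * of_real k * of_real x) * \<Psi>' y)
          (\<lambda>(t, x, y). - \<i> * of_real k * exp (\<mu> * of_real t) * exp (\<i> * of_real k * of_real x) * \<Psi> y)
          p)"

end

(*
For c = 0 and k = tanh delta the Rayleigh equation has the explicit neutral mode
e^(-ky) (k + tanh (y - delta)), which vanishes at y = 0. An unstable mode is found near it. For k close to
tanh delta and c = eps (r + i), the solution decaying at infinity solves a Volterra equation
whose kernel has norm O(eps log (1/eps)). Its value at y = 0, suitably normalised, is
F(k, r) = k - tanh delta + c w, where w stays bounded and Im w stays below a negative constant as eps
tends to 0, because w is to leading order a negative multiple of the integral of ds / (s - c) over
(- tanh delta, 1), whose imaginary part tends to pi. Since Re F determines k and Im F determines r to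
leading order, Brouwer's theorem applied to (k, r) -> (k - Re F, r + const Im F / eps) produces a zero of F.
*)
theory Submission
  imports Defs "HOL-Real_Asymp.Real_Asymp"
begin

section \<open>Integration by parts against test functions\<close>

text \<open>At c = 0 the Rayleigh equation is regular: the inflection point of the profile lies
  exactly where U - c vanishes, and the two zeros cancel. For c near 0 the cancellation is imperfect
  and leaves a potential that does not become small pointwise: at the critical layer it stays of
  order 1 however small c is. It is small only in L1. The perturbation argument therefore rests on
  exact integrals of 1/(s - c) in the variable s = tanh (y - \<delta>), and the Volterra equation is
  solved among bounded continuous functions after the factor e^(-ky) has been removed. No derivative
  of F in k or r is ever estimated; the topological fixed point asks only for continuity and bounds.
  This is also why Im c = eps is prescribed and the wave number k is an unknown: nothing has to be
  known beforehand about which k are unstable. The assumption \<delta> > 0 places tanh \<delta>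
  strictly between 0 and 1, so that modes decay and the Wronskian 2k(k^2 - 1) of the two solutions
  at c = 0 does not vanish. The constant \<zeta> translates the phase velocity.\<close>

lemma integral_directional_derivative_eq_0:
  fixes G g :: "'a::euclidean_space \<Rightarrow> complex"
  assumes K: "compact K" and outside: "\<And>x. x \<notin> K \<Longrightarrow> G x = 0"
    and contG: "continuous_on UNIV G" and contg: "continuous_on UNIV g"
    and der: "\<And>x. ((\<lambda>h. G (x + h *\<^sub>R v)) has_vector_derivative g x) (at 0)"
  shows "integrable lborel g" and "integral\<^sup>L lborel g = 0"
proof -
  have der': "((\<lambda>h. G (x + h *\<^sub>R v)) has_vector_derivative g (x + t *\<^sub>R v)) (at t)" for x t
  proof -
    have "((\<lambda>h. G ((x + t *\<^sub>R v) + h *\<^sub>R v)) has_vector_derivative g (x + t *\<^sub>R v)) (at (t - t))"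
      using der by simp
    then have "(((\<lambda>h. G ((x + t *\<^sub>R v) + h *\<^sub>R v)) \<circ> (\<lambda>h. h - t)) has_vector_derivative
        1 *\<^sub>R g (x + t *\<^sub>R v)) (at t)"
      by (intro vector_diff_chain_at) (auto intro!: derivative_eq_intros)
    then show ?thesis
      by (simp add: o_def algebra_simps)
  qed
  have g0: "g x = 0" if "x \<notin> K" for x
  proof -
    have "open ((\<lambda>h. x + h *\<^sub>R v) -` (- K))"
      by (intro open_vimage continuous_intros) (use K in \<open>auto simp: compact_imp_closed\<close>)
    moreover have "0 \<in> (\<lambda>h. x + h *\<^sub>R v) -` (- K)" using that by simp
    ultimately have "((\<lambda>h. G (x + h *\<^sub>R v)) has_vector_derivative 0) (at 0)"
      by (rule has_vector_derivative_transform_within_open[where f="\<lambda>_. 0", rotated])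
         (auto simp: outside)
    with der show ?thesis by (metis vector_derivative_unique_at)
  qed
  have bnd: "\<exists>C\<ge>0. \<forall>x. norm (F x) \<le> C"
    if "continuous_on UNIV F" "\<And>x. x \<notin> K \<Longrightarrow> F x = 0" for F :: "'a \<Rightarrow> complex"
  proof -
    have "bounded (F ` K)"
      by (intro compact_imp_bounded compact_continuous_image K) (use that continuous_on_subset in blast)
    then obtain B where "\<And>x. x \<in> K \<Longrightarrow> norm (F x) \<le> B"
      by (auto simp: bounded_iff)
    then have "norm (F x) \<le> max B 0" for x
      by (cases "x \<in> K") (force simp: that)+
    then show ?thesis by (intro exI[of _ "max B 0"]) auto
  qed
  from bnd[OF contg g0] obtain C where C: "C \<ge> 0" "\<And>x. norm (g x) \<le> C" by auto
  have comp_int: "integrable lborel F" if "continuous_on UNIV F" "\<And>x. x \<notin> K' \<Longrightarrow> F x = 0" "compact K'"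
    for F :: "'a \<Rightarrow> complex" and K'
  proof -
    have "integrable lborel (\<lambda>x. indicator K' x *\<^sub>R F x)"
      by (rule borel_integrable_compact) (use that continuous_on_subset in blast)+
    also have "(\<lambda>x. indicator K' x *\<^sub>R F x) = F"
      using that by (auto simp: indicator_def)
    finally show ?thesis .
  qed
  show intg: "integrable lborel g" using comp_int[OF contg g0 K] .
  have intG: "integrable lborel G" using comp_int[OF contG outside K] .
  \<comment> \<open>\<open>K\<close> swept backwards along \<open>v\<close> for times in [0, 1]. It
    contains the support of every difference quotient \<open>D n\<close>, and being compact it
    carries an integrable constant majorant.\<close>
  define K' where "K' = (\<lambda>(x, t). x - t *\<^sub>R v) ` (K \<times> {0..1::real})"
  have K': "compact K'"
    unfolding K'_def
    by (intro compact_continuous_image compact_Times K) (auto intro!: continuous_intros simp: case_prod_unfold)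
  \<comment> \<open>Difference quotients along \<open>v\<close> with step 1/(n+1). Translation
    invariance of Lebesgue measure gives each of them integral 0, and dominated convergence hands
    the value 0 on to \<open>g\<close>. Fubini is avoided, so the same argument serves the half-line
    and spacetime.\<close>
  define D where "D = (\<lambda>n x. (real (Suc n)) *\<^sub>R (G (x + (1 / real (Suc n)) *\<^sub>R v) - G x))"
  have "(\<lambda>n. integral\<^sup>L lborel (D n)) \<longlonglongrightarrow> integral\<^sup>L lborel g"
  proof (rule integral_dominated_convergence[where w="\<lambda>x. indicator K' x *\<^sub>R C"])
    show "integrable lborel (\<lambda>x. indicator K' x *\<^sub>R C)"
      by (rule borel_integrable_compact[OF K']) auto
    show "AE x in lborel. (\<lambda>n. D n x) \<longlonglongrightarrow> g x"
    proof (rule AE_I2)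
      fix x
      have *: "((\<lambda>h. (G (x + h *\<^sub>R v) - G x) /\<^sub>R h) \<longlongrightarrow> g x) (at 0)"
      proof (rule LIM_zero_cancel, rule tendsto_norm_zero_cancel)
        have "((\<lambda>h. norm (G (x + h *\<^sub>R v) - G x - h *\<^sub>R g x) / norm h) \<longlongrightarrow> 0) (at 0)"
          using der[of x] by (simp add: has_vector_derivative_def has_derivative_at)
        then show "((\<lambda>h. norm ((G (x + h *\<^sub>R v) - G x) /\<^sub>R h - g x)) \<longlongrightarrow> 0) (at 0)"
        proof (rule Lim_transform_eventually)
          show "\<forall>\<^sub>F h in at 0. norm (G (x + h *\<^sub>R v) - G x - h *\<^sub>R g x) / norm h =
              norm ((G (x + h *\<^sub>R v) - G x) /\<^sub>R h - g x)"
          proof (rule eventually_at_filter[THEN iffD2], rule always_eventually, intro allI impI)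
            fix h :: real assume "h \<noteq> 0"
            then have "(G (x + h *\<^sub>R v) - G x) /\<^sub>R h - g x = (G (x + h *\<^sub>R v) - G x - h *\<^sub>R g x) /\<^sub>R h"
              by (simp add: scaleR_diff_right)
            then show "norm (G (x + h *\<^sub>R v) - G x - h *\<^sub>R g x) / norm h =
              norm ((G (x + h *\<^sub>R v) - G x) /\<^sub>R h - g x)"
              by (simp add: divide_inverse mult.commute)
          qed
        qed
      qed
      show "(\<lambda>n. D n x) \<longlonglongrightarrow> g x"
      proof -
        have "(\<lambda>n. (G (x + (1 / real (Suc n)) *\<^sub>R v) - G x) /\<^sub>R (1 / real (Suc n))) \<longlonglongrightarrow> g x"
          by (rule filterlim_compose[OF *]) (use LIMSEQ_Suc[OF lim_1_over_n[where ?'a=real]] in \<open>auto simp: filterlim_at simp del: of_nat_Suc\<close>)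
        then show ?thesis by (simp add: D_def)
      qed
    qed
    show "AE x in lborel. norm (D n x) \<le> indicator K' x *\<^sub>R C" for n
    proof (rule AE_I2)
      fix x
      let ?e = "1 / real (Suc n)"
      show "norm (D n x) \<le> indicator K' x *\<^sub>R C"
      proof (cases "x \<in> K'")
        case True
        have "norm (G (x + ?e *\<^sub>R v) - G (x + 0 *\<^sub>R v)) \<le> C * norm (?e - 0)"
          by (rule differentiable_bound[where S=UNIV and f'="\<lambda>t h. h *\<^sub>R g (x + t *\<^sub>R v)"])
             (use C der' in \<open>auto simp: has_vector_derivative_def onorm_scaleR_left onorm_id\<close>)
        then have "norm (D n x) \<le> real (Suc n) * (C * ?e)"
          unfolding D_def by (simp add: divide_simps mult.commute)
        also have "\<dots> = C" by simp
        finally show ?thesis using True by simp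
      next
        case False
        have "x + t *\<^sub>R v \<notin> K" if "0 \<le> t" "t \<le> 1" for t
          using False that unfolding K'_def by (force simp: image_iff)
        from this[of 0] this[of ?e] have "D n x = 0" by (simp add: D_def outside)
        then show ?thesis using False by simp
      qed
    qed
    have "continuous_on UNIV (\<lambda>x. G (x + w))" for w
      by (rule continuous_on_compose2[OF contG]) (auto intro: continuous_intros)
    then have "continuous_on UNIV (D n)" for n
      unfolding D_def by (intro continuous_on_scaleR continuous_on_diff continuous_on_const contG)
    then show "D n \<in> borel_measurable lborel" for n
      by (simp add: borel_measurable_continuous_onI)
    show "g \<in> borel_measurable lborel" using intg by auto
  qed
  moreover have "integral\<^sup>L lborel (D n) = 0" for n
  proof -
    let ?c = "(1 / real (Suc n)) *\<^sub>R v"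
    have "integral\<^sup>L lborel (\<lambda>x. G (x + ?c)) = integral\<^sup>L (distr lborel borel ((+) ?c)) G"
      by (subst integral_distr) (use intG in \<open>auto simp: add.commute\<close>)
    also have "\<dots> = integral\<^sup>L lborel G" by (simp only: lborel_distr_plus)
    finally have 1: "integral\<^sup>L lborel (\<lambda>x. G (x + ?c)) = integral\<^sup>L lborel G" .
    have "integrable (distr lborel borel ((+) ?c)) G" using intG by (simp only: lborel_distr_plus)
    then have "integrable lborel (\<lambda>x. G (x + ?c))"
      by (subst (asm) integrable_distr_eq) (use intG in \<open>auto simp: add.commute\<close>)
    with 1 intG show ?thesis by (simp add: D_def)
  qed
  ultimately show "integral\<^sup>L lborel g = 0"
    by (simp add: LIMSEQ_const_iff)
qed

lemma test_fun_directional: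
  fixes \<phi> :: "'a::euclidean_space \<Rightarrow> real"
  assumes "test_fun U \<phi>"
  shows "\<phi> differentiable (at x)"
    and "((\<lambda>h. \<phi> (x + h *\<^sub>R v)) has_vector_derivative frechet_derivative \<phi> (at x) v) (at 0)"
    and "v \<in> Basis \<Longrightarrow> continuous_on UNIV (\<lambda>x. frechet_derivative \<phi> (at x) v)"
    and "continuous_on UNIV \<phi>"
proof -
  have C: "Ck_on (Suc 0) \<phi> UNIV"
    using assms unfolding test_fun_def smooth_on_def by blast
  then show d: "\<phi> differentiable (at x)" for x by simp
  show "v \<in> Basis \<Longrightarrow> continuous_on UNIV (\<lambda>x. frechet_derivative \<phi> (at x) v)"
    using C by simp
  show "continuous_on UNIV \<phi>"
    using d by (simp add: continuous_on_eq_continuous_at differentiable_imp_continuous_within)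
  have 1: "(\<phi> has_derivative frechet_derivative \<phi> (at x)) (at (x + 0 *\<^sub>R v))"
    using frechet_derivative_works[THEN iffD1, OF d] by simp
  have 2: "((\<lambda>h. x + h *\<^sub>R v) has_derivative (\<lambda>h. h *\<^sub>R v)) (at 0)"
    by (auto intro!: derivative_eq_intros)
  have "(\<phi> \<circ> (\<lambda>h. x + h *\<^sub>R v) has_derivative (frechet_derivative \<phi> (at x) \<circ> (\<lambda>h. h *\<^sub>R v))) (at 0)"
    by (rule diff_chain_at[OF 2 1])
  moreover have "linear (frechet_derivative \<phi> (at x))"
    using 1 has_derivative_linear by blast
  ultimately show "((\<lambda>h. \<phi> (x + h *\<^sub>R v)) has_vector_derivative frechet_derivative \<phi> (at x) v) (at 0)"
    by (simp add: has_vector_derivative_def o_def linear_scale)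
qed

lemma continuous_on_zero_extension:
  fixes f :: "'a::t2_space \<Rightarrow> 'b::real_normed_vector"
  assumes "open U" "compact K" "K \<subseteq> U" "continuous_on U f" "\<And>x. x \<notin> K \<Longrightarrow> f x = 0"
  shows "continuous_on UNIV f"
proof -
  have "continuous_on (U \<union> - K) f"
  proof (rule continuous_on_open_Un)
    show "open (- K)" using assms by (simp add: compact_imp_closed open_Compl)
    have "continuous_on (- K) (\<lambda>_. 0 :: 'b)" by simp
    then show "continuous_on (- K) f" by (rule continuous_on_eq) (use assms in auto)
  qed (use assms in auto)
  moreover have "U \<union> - K = UNIV" using assms by auto
  ultimately show ?thesis by simp
qed

text \<open>Since \<open>\<phi>\<close> vanishes off a compact subset of \<open>U\<close>, the
  product of \<open>\<phi>\<close> and \<open>F\<close>, extended by zero, is continuous on the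
  whole space together with its derivative along \<open>v\<close>; hence there is no boundary term.
  Differentiability of \<open>F\<close> is asked along \<open>v\<close> only, because different
  amplitudes of a normal mode are smooth in different directions.\<close>

lemma test_fun_integration_by_parts:
  fixes F F' :: "'a::euclidean_space \<Rightarrow> complex"
  assumes U: "open U" and \<phi>: "test_fun U \<phi>" and v: "v \<in> Basis"
    and F: "continuous_on U F" and F': "continuous_on U F'"
    and der: "\<And>x. x \<in> U \<Longrightarrow> ((\<lambda>h. F (x + h *\<^sub>R v)) has_vector_derivative F' x) (at 0)"
  shows "set_integrable lborel U (\<lambda>x. frechet_derivative \<phi> (at x) v *\<^sub>R F x + \<phi> x *\<^sub>R F' x)"
    and "(LINT x:U|lborel. frechet_derivative \<phi> (at x) v *\<^sub>R F x + \<phi> x *\<^sub>R F' x) = 0"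
proof -
  obtain K where K: "compact K" "K \<subseteq> U" "\<And>x. x \<notin> K \<Longrightarrow> \<phi> x = 0"
    using \<phi> unfolding test_fun_def by auto
  define G where "G = (\<lambda>x. indicator U x *\<^sub>R (\<phi> x *\<^sub>R F x))"
  define g where "g = (\<lambda>x. indicator U x *\<^sub>R (frechet_derivative \<phi> (at x) v *\<^sub>R F x + \<phi> x *\<^sub>R F' x))"
  note \<phi>' = test_fun_directional[OF \<phi>]
  have opn: "open ((\<lambda>h. x + h *\<^sub>R v) -` S)" if "open S" for x S
    by (intro open_vimage continuous_intros that)
  have d0: "frechet_derivative \<phi> (at x) v = 0" if "x \<notin> K" for x
  proof -
    have "((\<lambda>h. \<phi> (x + h *\<^sub>R v)) has_vector_derivative 0) (at 0)"
      by (rule has_vector_derivative_transform_within_open[where f="\<lambda>_. 0", OF _ opn[of "- K" x]])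
         (use K that in \<open>auto simp: compact_imp_closed\<close>)
    with \<phi>'(2) show ?thesis by (metis vector_derivative_unique_at)
  qed
  have der1: "((\<lambda>h. G (x + h *\<^sub>R v)) has_vector_derivative g x) (at 0)" for x
  proof (cases "x \<in> U")
    case True
    have "((\<lambda>h. \<phi> (x + h *\<^sub>R v) *\<^sub>R F (x + h *\<^sub>R v)) has_vector_derivative
        \<phi> (x + 0 *\<^sub>R v) *\<^sub>R F' x + frechet_derivative \<phi> (at x) v *\<^sub>R F (x + 0 *\<^sub>R v)) (at 0)"
      using \<phi>'(2)[of x v] der[OF True]
      by (intro has_vector_derivative_scaleR) (auto simp: has_real_derivative_iff_has_vector_derivative)
    moreover have "\<phi> (x + 0 *\<^sub>R v) *\<^sub>R F' x + frechet_derivative \<phi> (at x) v *\<^sub>R F (x + 0 *\<^sub>R v) = g x"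
      using True by (simp add: g_def)
    ultimately have "((\<lambda>h. \<phi> (x + h *\<^sub>R v) *\<^sub>R F (x + h *\<^sub>R v)) has_vector_derivative g x) (at 0)"
      by simp
    then show ?thesis
      by (rule has_vector_derivative_transform_within_open[OF _ opn[OF U, of x]])
         (use True in \<open>auto simp: G_def\<close>)
  next
    case False
    then have "x \<in> - K" using K by auto
    have "((\<lambda>h. G (x + h *\<^sub>R v)) has_vector_derivative 0) (at 0)"
      by (rule has_vector_derivative_transform_within_open[where f="\<lambda>_. 0", OF _ opn[of "- K" x]])
         (use K \<open>x \<in> - K\<close> in \<open>auto simp: compact_imp_closed G_def\<close>)
    moreover have "g x = 0" using False by (simp add: g_def)
    ultimately show ?thesis by simp
  qed
  have contG: "continuous_on UNIV G"
  proof (rule continuous_on_zero_extension[OF U K(1,2)])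
    have "continuous_on U (\<lambda>x. \<phi> x *\<^sub>R F x)"
      by (intro continuous_intros F continuous_on_subset[OF \<phi>'(4)]) auto
    then show "continuous_on U G" by (rule continuous_on_eq) (auto simp: G_def)
  qed (auto simp: G_def K)
  have contg: "continuous_on UNIV g"
  proof (rule continuous_on_zero_extension[OF U K(1,2)])
    have "continuous_on U (\<lambda>x. frechet_derivative \<phi> (at x) v *\<^sub>R F x + \<phi> x *\<^sub>R F' x)"
      by (intro continuous_intros F F' continuous_on_subset[OF \<phi>'(4)] continuous_on_subset[OF \<phi>'(3)[OF v]]) auto
    then show "continuous_on U g" by (rule continuous_on_eq) (auto simp: g_def)
  qed (auto simp: g_def K d0)
  have G0: "x \<notin> K \<Longrightarrow> G x = 0" for x by (simp add: G_def K)
  note * = integral_directional_derivative_eq_0[OF K(1) G0 contG contg der1]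
  show "set_integrable lborel U (\<lambda>x. frechet_derivative \<phi> (at x) v *\<^sub>R F x + \<phi> x *\<^sub>R F' x)"
    using *(1) by (simp add: set_integrable_def g_def)
  show "(LINT x:U|lborel. frechet_derivative \<phi> (at x) v *\<^sub>R F x + \<phi> x *\<^sub>R F' x) = 0"
    using *(2) by (simp add: set_lebesgue_integral_def g_def)
qed

lemma locally_integrable_on_continuous:
  "continuous_on U f \<Longrightarrow> locally_integrable_on f U"
  unfolding locally_integrable_on_def set_integrable_def
  by (auto intro!: borel_integrable_compact intro: continuous_on_subset)

section \<open>A family of Volterra equations\<close>

lemma set_integrable_continuous_bound:
  fixes f :: "real \<Rightarrow> 'b::{banach, second_countable_topology}" and B :: "real \<Rightarrow> real"
  assumes "set_integrable lborel S B" "S \<in> sets borel" "continuous_on S f"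
    and "\<And>x. x \<in> S \<Longrightarrow> norm (f x) \<le> B x"
  shows "set_integrable lborel S f"
proof (rule set_integrable_bound[OF assms(1)])
  show "set_borel_measurable lborel S f"
    unfolding set_borel_measurable_def
    using borel_measurable_continuous_on_indicator[OF assms(2,3)] by simp
  show "AE x in lborel. x \<in> S \<longrightarrow> norm (f x) \<le> norm (B x)"
    using assms(4) by (auto intro!: AE_I2 order_trans[OF assms(4)])
qed

lemma set_integral_norm_le:
  fixes f :: "real \<Rightarrow> 'b::{banach, second_countable_topology}"
  assumes "set_integrable lborel {0..} B" "continuous_on {0..} f" "\<And>x. 0 \<le> x \<Longrightarrow> norm (f x) \<le> B x"
    "(LINT x:{0..}|lborel. B x) \<le> b"
  shows "set_integrable lborel {0..} f" "norm (LINT x:{0..}|lborel. f x) \<le> b"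
proof -
  show *: "set_integrable lborel {0..} f"
    by (rule set_integrable_continuous_bound[OF assms(1)]) (use assms in auto)
  have "norm (LINT x:{0..}|lborel. f x) \<le> (LINT x:{0..}|lborel. norm (f x))"
    by (rule set_integral_norm_bound[OF *])
  also have "\<dots> \<le> (LINT x:{0..}|lborel. B x)"
    by (rule set_integral_mono[OF set_integrable_norm[OF *] assms(1)]) (use assms(3) in auto)
  finally show "norm (LINT x:{0..}|lborel. f x) \<le> b" using assms(4) by simp
qed

text \<open>The index set \<open>'x\<close> carries both the spatial variable and all parameters of the kernel, so
  that the fixed point comes out jointly continuous in them.\<close>

lemma volterra_fixed_point:
  fixes \<kappa> :: "'x::metric_space \<Rightarrow> real \<Rightarrow> complex" and \<sigma> :: "'x \<Rightarrow> real \<Rightarrow> 'x"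
    and m0 :: "'x \<Rightarrow> complex" and B :: "real \<Rightarrow> real"
  assumes \<kappa>_fst: "\<And>d. d \<ge> 0 \<Longrightarrow> continuous_on UNIV (\<lambda>x. \<kappa> x d)"
    and \<sigma>_fst: "\<And>d. d \<ge> 0 \<Longrightarrow> continuous_on UNIV (\<lambda>x. \<sigma> x d)"
    and \<kappa>_snd: "\<And>x. continuous_on {0..} (\<kappa> x)"
    and \<sigma>_snd: "\<And>x. continuous_on {0..} (\<sigma> x)"
    and B: "set_integrable lborel {0..} B"
    and \<kappa>_le: "\<And>x d. d \<ge> 0 \<Longrightarrow> norm (\<kappa> x d) \<le> B d"
    and \<theta>: "\<And>x. (LINT d:{0..}|lborel. norm (\<kappa> x d)) \<le> \<theta>" "\<theta> < 1"
    and m0: "continuous_on UNIV m0" "\<And>x. norm (m0 x) \<le> M"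
  obtains m where "continuous_on UNIV m" "\<And>x. norm (m x) \<le> M / (1 - \<theta>)"
    "\<And>x. m x = m0 x + (LINT d:{0..}|lborel. \<kappa> x d * m (\<sigma> x d))"
proof -
  define J where "J = (\<lambda>f x. LINT d:{0..}|lborel. \<kappa> x d * f (\<sigma> x d))"
  have \<theta>0: "0 \<le> \<theta>"
  proof -
    have "0 \<le> (LINT d:{0..}|lborel. norm (\<kappa> undefined d))"
      unfolding set_lebesgue_integral_def by (rule integral_nonneg_AE) auto
    then show ?thesis using \<theta>(1) order_trans by blast
  qed
  have int\<kappa>: "set_integrable lborel {0..} (\<lambda>d. norm (\<kappa> x d))" for x
    by (rule set_integrable_continuous_bound[OF B]) (auto intro!: continuous_intros \<kappa>_snd \<kappa>_le)
  have cf: "continuous_on {0..} (\<lambda>d. f (\<sigma> x d))" if "continuous_on UNIV f" for f :: "'x \<Rightarrow> complex" and x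
    by (rule continuous_on_compose2[OF that \<sigma>_snd]) auto
  have intJ: "set_integrable lborel {0..} (\<lambda>d. \<kappa> x d * f (\<sigma> x d))"
    if f: "continuous_on UNIV f" "\<And>x. norm (f x) \<le> C" for f C x
  proof (rule set_integrable_continuous_bound)
    show "set_integrable lborel {0..} (\<lambda>d. norm (\<kappa> x d) * C)"
      using int\<kappa> by auto
    show "continuous_on {0..} (\<lambda>d. \<kappa> x d * f (\<sigma> x d))"
      by (intro continuous_intros \<kappa>_snd cf f)
    show "norm (\<kappa> x d * f (\<sigma> x d)) \<le> norm (\<kappa> x d) * C" for d
      unfolding norm_mult by (intro mult_left_mono f) auto
  qed auto
  have normJ: "norm (J f x) \<le> \<theta> * C" if f: "continuous_on UNIV f" "\<And>x. norm (f x) \<le> C" for f C x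
  proof -
    have C: "C \<ge> 0" using f(2)[of undefined] norm_ge_zero order_trans by blast
    have "norm (J f x) \<le> (LINT d:{0..}|lborel. norm (\<kappa> x d * f (\<sigma> x d)))"
      unfolding J_def by (rule set_integral_norm_bound[OF intJ[OF f]])
    also have "\<dots> \<le> (LINT d:{0..}|lborel. norm (\<kappa> x d) * C)"
    proof (rule set_integral_mono)
      show "set_integrable lborel {0..} (\<lambda>d. norm (\<kappa> x d * f (\<sigma> x d)))"
        using set_integrable_norm[OF intJ[OF f]] by simp
      show "set_integrable lborel {0..} (\<lambda>d. norm (\<kappa> x d) * C)"
        using int\<kappa> by auto
    qed (auto simp: norm_mult intro!: mult_left_mono f)
    also have "\<dots> = (LINT d:{0..}|lborel. norm (\<kappa> x d)) * C" by simp
    also have "\<dots> \<le> \<theta> * C" using \<theta> C by (intro mult_right_mono) auto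
    finally show ?thesis .
  qed
  \<comment> \<open>\<open>B\<close> and \<open>\<theta>\<close> have separate tasks.
    \<open>B\<close> dominates the kernel uniformly in the index, as dominated convergence requires
    here, and its integral may be large. \<open>\<theta>\<close> bounds only the integral of the
    modulus and makes the map a contraction.\<close>
  have contJ: "continuous_on UNIV (J f)" if f: "continuous_on UNIV f" "\<And>x. norm (f x) \<le> C" for f C
    unfolding continuous_on_sequentially
  proof (intro allI ballI impI, elim conjE)
    fix X :: "nat \<Rightarrow> 'x" and a assume X: "X \<longlonglongrightarrow> a"
    have C: "C \<ge> 0" using f(2)[of undefined] norm_ge_zero order_trans by blast
    have lim: "(\<lambda>n. F (X n)) \<longlonglongrightarrow> F a" if "continuous_on UNIV F" for F :: "'x \<Rightarrow> 'y::topological_space"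
      using that X by (simp add: continuous_on_tendsto_compose)
    have "(\<lambda>n. integral\<^sup>L lborel (\<lambda>d. indicator {0..} d *\<^sub>R (\<kappa> (X n) d * f (\<sigma> (X n) d))))
       \<longlonglongrightarrow> integral\<^sup>L lborel (\<lambda>d. indicator {0..} d *\<^sub>R (\<kappa> a d * f (\<sigma> a d)))"
    proof (rule integral_dominated_convergence[where w="\<lambda>d. indicator {0..} d *\<^sub>R (B d * C)"])
      show "integrable lborel (\<lambda>d. indicat_real {0..} d *\<^sub>R (B d * C))"
        using set_integrable_mult_left[of C, OF B] by (simp add: set_integrable_def)
      show "AE d in lborel. (\<lambda>n. indicat_real {0..} d *\<^sub>R (\<kappa> (X n) d * f (\<sigma> (X n) d)))
         \<longlonglongrightarrow> indicat_real {0..} d *\<^sub>R (\<kappa> a d * f (\<sigma> a d))"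
      proof (rule AE_I2)
        fix d :: real
        show "(\<lambda>n. indicat_real {0..} d *\<^sub>R (\<kappa> (X n) d * f (\<sigma> (X n) d)))
         \<longlonglongrightarrow> indicat_real {0..} d *\<^sub>R (\<kappa> a d * f (\<sigma> a d))"
        proof (cases "d \<ge> 0")
          case True
          have "continuous_on UNIV (\<lambda>x. f (\<sigma> x d))"
            by (rule continuous_on_compose2[OF f(1) \<sigma>_fst[OF True]]) auto
          from lim[OF this] lim[OF \<kappa>_fst[OF True]] show ?thesis
            by (auto intro!: tendsto_intros)
        qed simp
      qed
      show "AE d in lborel. norm (indicat_real {0..} d *\<^sub>R (\<kappa> (X n) d * f (\<sigma> (X n) d)))
          \<le> indicat_real {0..} d *\<^sub>R (B d * C)" for n
        by (rule AE_I2) (auto simp: indicator_def norm_mult intro!: mult_mono \<kappa>_le f order_trans[OF norm_ge_zero \<kappa>_le])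
    qed (use intJ[OF f] in \<open>auto simp: set_integrable_def\<close>)
    then show "(J f \<circ> X) \<longlonglongrightarrow> J f a"
      by (simp add: J_def set_lebesgue_integral_def o_def)
  qed
  define TT where "TT = (\<lambda>f. Bcontfun (\<lambda>x. m0 x + J (apply_bcontfun f) x))"
  have app: "apply_bcontfun (TT f) x = m0 x + J (apply_bcontfun f) x" for f x
  proof -
    have "(\<lambda>x. m0 x + J (apply_bcontfun f) x) \<in> bcontfun"
    proof (rule bcontfun_normI)
      show "continuous_on UNIV (\<lambda>x. m0 x + J (apply_bcontfun f) x)"
        by (intro continuous_intros m0 contJ[where C="norm f"]) (auto intro: norm_bounded)
      show "norm (m0 x + J (apply_bcontfun f) x) \<le> M + \<theta> * norm f" for x
        by (intro norm_triangle_mono m0 normJ) (auto intro: norm_bounded)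
    qed
    then show ?thesis unfolding TT_def by (simp add: Bcontfun_inverse)
  qed
  have int_app: "set_integrable lborel {0..} (\<lambda>d. \<kappa> x d * apply_bcontfun h (\<sigma> x d))" for h x
    by (rule intJ[where C="norm h"]) (auto intro: norm_bounded)
  have "dist (TT f) (TT g) \<le> \<theta> * dist f g" for f g
  proof (rule dist_bound)
    fix x
    have "apply_bcontfun (TT f) x - apply_bcontfun (TT g) x = J (apply_bcontfun (f - g)) x"
      unfolding app J_def
      using set_integral_diff(2)[OF int_app[of x f] int_app[of x g]]
      by (simp add: algebra_simps minus_bcontfun.rep_eq)
    then have "dist (apply_bcontfun (TT f) x) (apply_bcontfun (TT g) x)
        = norm (J (apply_bcontfun (f - g)) x)" by (simp add: dist_norm)
    also have "\<dots> \<le> \<theta> * norm (f - g)"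
      by (intro normJ norm_bounded continuous_on_apply_bcontfun)
    finally show "dist (apply_bcontfun (TT f) x) (apply_bcontfun (TT g) x) \<le> \<theta> * dist f g"
      by (simp add: dist_norm)
  qed
  from banach_fix_type[OF \<theta>0 \<theta>(2)] this obtain f where f: "TT f = f" by blast
  have fx: "apply_bcontfun f x = m0 x + J (apply_bcontfun f) x" for x
    using app[of f x] by (simp add: f)
  have "norm f \<le> M + \<theta> * norm f"
    by (rule norm_bound, subst fx, intro norm_triangle_mono m0 normJ) (auto intro: norm_bounded)
  then have M: "norm f \<le> M / (1 - \<theta>)" using \<theta>(2) by (simp add: field_simps)
  show thesis
  proof (rule that)
    show "continuous_on UNIV (apply_bcontfun f)" by (rule continuous_on_apply_bcontfun)
    show "norm (apply_bcontfun f x) \<le> M / (1 - \<theta>)" for x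
      using norm_bounded M by (rule order_trans)
    show "apply_bcontfun f x = m0 x + (LINT d:{0..}|lborel. \<kappa> x d * apply_bcontfun f (\<sigma> x d))" for x
      by (rule fx[unfolded J_def])
  qed
qed

section \<open>Integrals along the tanh profile\<close>

lemma has_real_derivative_tanh_add:
  "((\<lambda>d. tanh (z + d)) has_real_derivative 1 - (tanh (z + d))\<^sup>2) (at (d :: real))"
  by (auto intro!: derivative_eq_intros)

lemma tendsto_tanh_add_at_top: "((\<lambda>d. tanh (z + d)) \<longlongrightarrow> 1) (at_top :: real filter)"
  by (rule filterlim_compose[OF tanh_real_at_top filterlim_tendsto_add_at_top[OF tendsto_const filterlim_ident]])

lemma one_minus_tanh_square_pos: "0 < 1 - (tanh (x :: real))\<^sup>2"
  using abs_square_less_1[of "tanh x"] tanh_real_bounds[of x] by auto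

lemma abs_tanh_le_1: "\<bar>tanh (x :: real)\<bar> \<le> 1"
  using tanh_real_bounds[of x] by auto

text \<open>Supplies the integrable majorant e^(-2d) that is independent of the spatial variable and
  of all parameters in the Volterra equation.\<close>

lemma one_minus_tanh_square_le: "1 - (tanh (x :: real))\<^sup>2 \<le> 4 * exp (- 2 * x)"
proof -
  define e where "e = exp (- 2 * x)"
  have e: "e > 0" by (simp add: e_def)
  have t: "tanh x = (1 - e) / (1 + e)"
    by (simp add: tanh_real_altdef e_def)
  have "1 - (tanh x)\<^sup>2 = 4 * e / (1 + e)\<^sup>2"
  proof -
    have "1 - (tanh x)\<^sup>2 = ((1 + e)\<^sup>2 - (1 - e)\<^sup>2) / (1 + e)\<^sup>2"
      using e unfolding t power_divide diff_divide_distrib[of "(1 + e)\<^sup>2"] by simp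
    also have "(1 + e)\<^sup>2 - (1 - e)\<^sup>2 = 4 * e" by algebra
    finally show ?thesis .
  qed
  also have "\<dots> \<le> 4 * e / 1"
    using e one_le_power[of "1 + e" 2] by (intro divide_left_mono) auto
  finally show ?thesis by (simp add: e_def)
qed

lemma half_line_FTC_nonneg:
  fixes f F :: "real \<Rightarrow> real"
  assumes "continuous_on UNIV f" "\<And>x. (F has_real_derivative f x) (at x)"
    "\<And>x. 0 \<le> f x" "(F \<longlongrightarrow> T) at_top"
  shows "set_integrable lborel {0..} f" and "(LINT d:{0..}|lborel. f d) = T - F 0"
proof -
  have [measurable]: "f \<in> borel_measurable borel"
    using assms(1) by (rule borel_measurable_continuous_onI)
  have nn: "(\<integral>\<^sup>+ x. ennreal (f x) * indicator {0..} x \<partial>lborel) = T - F 0"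
    by (rule nn_integral_FTC_atLeast) (use assms in auto)
  have eq: "(\<integral>\<^sup>+ x. ennreal (indicator {0..} x *\<^sub>R f x) \<partial>lborel) = T - F 0"
    unfolding nn[symmetric] by (intro nn_integral_cong) (auto simp: indicator_def)
  have "F 0 \<le> T"
  proof (rule tendsto_lowerbound[OF assms(4)])
    show "\<forall>\<^sub>F x in at_top. F 0 \<le> F x"
      using eventually_ge_at_top[of 0]
    proof eventually_elim
      case (elim x)
      show ?case
        by (rule DERIV_nonneg_imp_nondecreasing[OF elim]) (use assms in auto)
    qed
  qed simp
  show "set_integrable lborel {0..} f"
    unfolding set_integrable_def by (rule integrableI_nonneg) (use eq assms(3) in \<open>auto simp: indicator_def\<close>)
  show "(LINT d:{0..}|lborel. f d) = T - F 0"
    unfolding set_lebesgue_integral_def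
    by (subst integral_eq_nn_integral) (use eq assms(3) \<open>F 0 \<le> T\<close> in \<open>auto simp: indicator_def\<close>)
qed

text \<open>The substitution s = tanh (z + d) maps the half-line to the interval from tanh z to 1
  and absorbs the weight 1 - s^2. The fundamental theorem on the half-line is available for
  nonnegative integrands, so the constant \<open>C\<close> is added to \<open>f\<close> and
  subtracted again; its size does not enter the result.\<close>

lemma tanh_substitution:
  fixes f F :: "real \<Rightarrow> real"
  assumes f: "continuous_on UNIV f" and F: "\<And>x. (F has_real_derivative f x) (at x)" and C: "\<And>x. - C \<le> f x"
  shows "set_integrable lborel {0..} (\<lambda>d. f (tanh (z + d)) * (1 - (tanh (z + d))\<^sup>2))"
    and "(LINT d:{0..}|lborel. f (tanh (z + d)) * (1 - (tanh (z + d))\<^sup>2)) = F 1 - F (tanh z)"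
proof -
  have *: "set_integrable lborel {0..} (\<lambda>d. g (tanh (z + d)) * (1 - (tanh (z + d))\<^sup>2)) \<and>
    (LINT d:{0..}|lborel. g (tanh (z + d)) * (1 - (tanh (z + d))\<^sup>2)) = G 1 - G (tanh z)"
    if g: "continuous_on UNIV g" "\<And>x. (G has_real_derivative g x) (at x)" "\<And>x. 0 \<le> g x" for g G
  proof -
    have c: "continuous_on UNIV (\<lambda>d. g (tanh (z + d)) * (1 - (tanh (z + d))\<^sup>2))"
      by (intro continuous_intros continuous_on_compose2[OF g(1)]) auto
    have d: "((\<lambda>d. G (tanh (z + d))) has_real_derivative g (tanh (z + d)) * (1 - (tanh (z + d))\<^sup>2)) (at d)" for d
      by (rule DERIV_chain2[OF g(2) has_real_derivative_tanh_add])
    have p: "0 \<le> g (tanh (z + d)) * (1 - (tanh (z + d))\<^sup>2)" for d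
      using g(3) one_minus_tanh_square_pos less_imp_le by (intro mult_nonneg_nonneg) blast+
    have "isCont G 1" using g(2) by (rule DERIV_isCont)
    then have l: "((\<lambda>d. G (tanh (z + d))) \<longlongrightarrow> G 1) at_top"
      using isCont_tendsto_compose tendsto_tanh_add_at_top by blast
    show ?thesis using half_line_FTC_nonneg[OF c d p l] by simp
  qed
  have 1: "set_integrable lborel {0..} (\<lambda>d. (f (tanh (z + d)) + C) * (1 - (tanh (z + d))\<^sup>2))"
    "(LINT d:{0..}|lborel. (f (tanh (z + d)) + C) * (1 - (tanh (z + d))\<^sup>2)) = (F 1 + C * 1) - (F (tanh z) + C * tanh z)"
  proof -
    have "continuous_on UNIV (\<lambda>x. f x + C)" by (intro continuous_intros f)
    moreover have "((\<lambda>x. F x + C * x) has_real_derivative f x + C) (at x)" for x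
      by (auto intro!: derivative_eq_intros F)
    moreover have "0 \<le> f x + C" for x using C[of x] by simp
    ultimately show
      "set_integrable lborel {0..} (\<lambda>d. (f (tanh (z + d)) + C) * (1 - (tanh (z + d))\<^sup>2))"
      "(LINT d:{0..}|lborel. (f (tanh (z + d)) + C) * (1 - (tanh (z + d))\<^sup>2)) = (F 1 + C * 1) - (F (tanh z) + C * tanh z)"
      using *[of "\<lambda>x. f x + C" "\<lambda>x. F x + C * x"] by blast+
  qed
  have 2: "set_integrable lborel {0..} (\<lambda>d. 1 * (1 - (tanh (z + d))\<^sup>2))"
    "(LINT d:{0..}|lborel. 1 * (1 - (tanh (z + d))\<^sup>2)) = 1 - tanh z"
    using *[of "\<lambda>x. 1" "\<lambda>x. x"] by (auto intro!: derivative_eq_intros)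
  have 3: "f (tanh (z + d)) * (1 - (tanh (z + d))\<^sup>2) =
      (f (tanh (z + d)) + C) * (1 - (tanh (z + d))\<^sup>2) - C * (1 * (1 - (tanh (z + d))\<^sup>2))" for d
    by (simp add: algebra_simps)
  have 4: "set_integrable lborel {0..} (\<lambda>d. C * (1 * (1 - (tanh (z + d))\<^sup>2)))"
    by (rule set_integrable_mult_right) (use 2 in auto)
  have 5: "(LINT d:{0..}|lborel. C * (1 * (1 - (tanh (z + d))\<^sup>2))) = C * (1 - tanh z)"
    using 2(2) by simp
  show "set_integrable lborel {0..} (\<lambda>d. f (tanh (z + d)) * (1 - (tanh (z + d))\<^sup>2))"
    unfolding 3 by (rule set_integral_diff(1)[OF 1(1) 4])
  show "(LINT d:{0..}|lborel. f (tanh (z + d)) * (1 - (tanh (z + d))\<^sup>2)) = F 1 - F (tanh z)"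
    unfolding 3 set_integral_diff(2)[OF 1(1) 4] 1(2) 5 by (simp add: algebra_simps)
qed

lemma set_integrable_one_minus_tanh_square:
  "set_integrable lborel {0..} (\<lambda>d. 1 - (tanh (z + d :: real))\<^sup>2)"
  "(LINT d:{0..}|lborel. 1 - (tanh (z + d :: real))\<^sup>2) = 1 - tanh z"
  using tanh_substitution[of "\<lambda>_. 1" "\<lambda>x. x" 0 z] by (auto intro!: derivative_eq_intros)

lemma set_integrable_exp_neg:
  assumes "a > 0"
  shows "set_integrable lborel {0..} (\<lambda>y :: real. exp (- (a * y)))"
proof (rule half_line_FTC_nonneg(1)[where F="\<lambda>y. - exp (- (a * y)) / a" and T=0])
  show "((\<lambda>y. - exp (- (a * y)) / a) has_real_derivative exp (- (a * x))) (at x)" for x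
    using assms by (auto intro!: derivative_eq_intros)
  have "((\<lambda>y. exp (- (a * y))) \<longlongrightarrow> 0) at_top"
    using assms by real_asymp
  then show "((\<lambda>y. - exp (- (a * y)) / a) \<longlongrightarrow> 0) at_top"
    using tendsto_divide[OF tendsto_minus tendsto_const] assms by fastforce
qed (auto intro!: continuous_intros)

lemma cmod_of_real_diff: "cmod (of_real x - c) = sqrt ((x - Re c)\<^sup>2 + (Im c)\<^sup>2)"
  by (simp add: cmod_def)

lemma of_real_diff_ne_0: "Im c > 0 \<Longrightarrow> complex_of_real x - c \<noteq> 0"
  by (auto simp: complex_eq_iff)

lemma inverse_of_real_diff:
  shows "Re (1 / (of_real x - c)) = (x - Re c) / ((x - Re c)\<^sup>2 + (Im c)\<^sup>2)"
    and "Im (1 / (of_real x - c)) = Im c / ((x - Re c)\<^sup>2 + (Im c)\<^sup>2)"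
  by (simp_all add: Re_divide Im_divide)

text \<open>The antiderivative of 1/|x - c| along the real line is arsinh ((x - Re c) / Im c). The
  L1 norm thus grows only like the logarithm of 1 / Im c, whereas the supremum may grow like 1 / Im
  c. The bound is uniform in \<open>z\<close>, that is, in the left end of the half-line.\<close>

lemma integral_inverse_distance:
  assumes e: "Im c > 0" and a: "\<bar>Re c\<bar> \<le> 1"
  shows "set_integrable lborel {0..} (\<lambda>d. 1 / cmod (of_real (tanh (z + d)) - c) * (1 - (tanh (z + d))\<^sup>2))"
    and "(LINT d:{0..}|lborel. 1 / cmod (of_real (tanh (z + d)) - c) * (1 - (tanh (z + d))\<^sup>2))
      \<le> 2 * arsinh (2 / Im c)"
proof -
  let ?F = "\<lambda>x. arsinh ((x - Re c) / Im c)"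
  have F: "(?F has_real_derivative 1 / cmod (of_real x - c)) (at x)" for x
  proof -
    have "(?F has_real_derivative 1 / sqrt (((x - Re c) / Im c)\<^sup>2 + 1) * (1 / Im c)) (at x)"
      by (rule DERIV_chain2[OF arsinh_real_has_field_derivative])
        (use e in \<open>auto intro!: derivative_eq_intros\<close>)
    also have "1 / sqrt (((x - Re c) / Im c)\<^sup>2 + 1) * (1 / Im c) = 1 / (sqrt (((x - Re c) / Im c)\<^sup>2 + 1) * sqrt ((Im c)\<^sup>2))"
      using e by simp
    also have "sqrt (((x - Re c) / Im c)\<^sup>2 + 1) * sqrt ((Im c)\<^sup>2) = cmod (of_real x - c)"
      using e unfolding real_sqrt_mult[symmetric] cmod_of_real_diff by (simp add: field_simps)
    finally show ?thesis .
  qed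
  have f: "continuous_on UNIV (\<lambda>x. 1 / cmod (of_real x - c))"
    using of_real_diff_ne_0[OF e] by (intro continuous_intros) auto
  note * = tanh_substitution[OF f F, of 0 z, simplified minus_zero, OF divide_nonneg_nonneg]
  show "set_integrable lborel {0..} (\<lambda>d. 1 / cmod (of_real (tanh (z + d)) - c) * (1 - (tanh (z + d))\<^sup>2))"
    by (rule *) auto
  have mono: "arsinh x \<le> arsinh y" if "x \<le> y" for x y :: real
    using arsinh_real_strict_mono[of x y] that by (cases "x = y") (auto simp: less_le)
  have "(LINT d:{0..}|lborel. 1 / cmod (of_real (tanh (z + d)) - c) * (1 - (tanh (z + d))\<^sup>2))
      = arsinh ((1 - Re c) / Im c) - arsinh ((tanh z - Re c) / Im c)"
    by (rule *) auto
  also have "\<dots> = arsinh ((1 - Re c) / Im c) + arsinh ((Re c - tanh z) / Im c)"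
    using arsinh_minus_real[of "(tanh z - Re c) / Im c"] by (simp add: minus_divide_left)
  also have "\<dots> \<le> arsinh (2 / Im c) + arsinh (2 / Im c)"
    using e a abs_tanh_le_1[of z]
    by (intro add_mono mono) (simp_all add: divide_right_mono)
  finally show "(LINT d:{0..}|lborel. 1 / cmod (of_real (tanh (z + d)) - c) * (1 - (tanh (z + d))\<^sup>2))
      \<le> 2 * arsinh (2 / Im c)" by simp
qed

text \<open>Together with the corresponding lemma for the real part this evaluates the integral of
  1/(x - c) without choosing a branch of the complex logarithm: arctan gives the imaginary part,
  half the logarithm of the squared modulus the real part.\<close>

lemma integral_Im_inverse:
  assumes e: "Im c > 0"
  shows "set_integrable lborel {0..} (\<lambda>d. Im (1 / (of_real (tanh (z + d)) - c)) * (1 - (tanh (z + d))\<^sup>2))"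
    and "(LINT d:{0..}|lborel. Im (1 / (of_real (tanh (z + d)) - c)) * (1 - (tanh (z + d))\<^sup>2))
      = arctan ((1 - Re c) / Im c) - arctan ((tanh z - Re c) / Im c)"
proof -
  have pos: "0 < (x - Re c)\<^sup>2 + (Im c)\<^sup>2" for x
    using e by (simp add: add_nonneg_pos)
  have F: "((\<lambda>x. arctan ((x - Re c) / Im c)) has_real_derivative Im (1 / (of_real x - c))) (at x)" for x
    unfolding inverse_of_real_diff using e pos[of x]
    by (auto intro!: derivative_eq_intros simp: field_simps power2_eq_square)
  have f: "continuous_on UNIV (\<lambda>x. Im (1 / (of_real x - c)))"
    using of_real_diff_ne_0[OF e] by (intro continuous_intros) auto
  have n: "- 0 \<le> Im (1 / (of_real x - c))" for x
    unfolding inverse_of_real_diff using e by simp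
  show "set_integrable lborel {0..} (\<lambda>d. Im (1 / (of_real (tanh (z + d)) - c)) * (1 - (tanh (z + d))\<^sup>2))"
    "(LINT d:{0..}|lborel. Im (1 / (of_real (tanh (z + d)) - c)) * (1 - (tanh (z + d))\<^sup>2))
      = arctan ((1 - Re c) / Im c) - arctan ((tanh z - Re c) / Im c)"
    by (rule tanh_substitution[OF f F n])+
qed

lemma integral_Re_inverse:
  assumes e: "Im c > 0"
  shows "set_integrable lborel {0..} (\<lambda>d. Re (1 / (of_real (tanh (z + d)) - c)) * (1 - (tanh (z + d))\<^sup>2))"
    and "(LINT d:{0..}|lborel. Re (1 / (of_real (tanh (z + d)) - c)) * (1 - (tanh (z + d))\<^sup>2))
      = (ln ((1 - Re c)\<^sup>2 + (Im c)\<^sup>2) - ln ((tanh z - Re c)\<^sup>2 + (Im c)\<^sup>2)) / 2"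
proof -
  have pos: "0 < (x - Re c)\<^sup>2 + (Im c)\<^sup>2" for x
    using e by (simp add: add_nonneg_pos)
  have F: "((\<lambda>x. ln ((x - Re c)\<^sup>2 + (Im c)\<^sup>2) / 2) has_real_derivative Re (1 / (of_real x - c))) (at x)" for x
  proof -
    have "((\<lambda>x. ln ((x - Re c)\<^sup>2 + (Im c)\<^sup>2)) has_real_derivative
        1 / ((x - Re c)\<^sup>2 + (Im c)\<^sup>2) * (2 * (x - Re c))) (at x)"
      by (rule DERIV_chain2[where f=ln and g="\<lambda>x. (x - Re c)\<^sup>2 + (Im c)\<^sup>2", OF DERIV_ln_divide[OF pos]]) (auto intro!: derivative_eq_intros)
    moreover have "1 / A * (2 * X) / 2 = X / A" for A X :: real by simp
    ultimately show ?thesis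
      using DERIV_cdivide[of _ _ _ _ 2] by (metis inverse_of_real_diff(1))
  qed
  have f: "continuous_on UNIV (\<lambda>x. Re (1 / (of_real x - c)))"
    using of_real_diff_ne_0[OF e] by (intro continuous_intros) auto
  \<comment> \<open>The real part changes sign at Re c; this is the lower bound that the
    substitution rule asks for.\<close>
  have n: "- (1 / Im c) \<le> Re (1 / (of_real x - c))" for x
  proof -
    have "Im c \<le> cmod (of_real x - c)" using abs_Im_le_cmod[of "of_real x - c"] e by simp
    then have "cmod (1 / (of_real x - c)) \<le> 1 / Im c"
      using e by (simp add: norm_divide frac_le)
    then show ?thesis using abs_Re_le_cmod[of "1 / (of_real x - c)"] by linarith
  qed
  show "set_integrable lborel {0..} (\<lambda>d. Re (1 / (of_real (tanh (z + d)) - c)) * (1 - (tanh (z + d))\<^sup>2))"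
    "(LINT d:{0..}|lborel. Re (1 / (of_real (tanh (z + d)) - c)) * (1 - (tanh (z + d))\<^sup>2))
      = (ln ((1 - Re c)\<^sup>2 + (Im c)\<^sup>2) - ln ((tanh z - Re c)\<^sup>2 + (Im c)\<^sup>2)) / 2"
    using tanh_substitution[OF f F n] by (auto simp: diff_divide_distrib)
qed

section \<open>From the Rayleigh equation to linear instability\<close>

lemma test_fun_scaleR_integrable:
  fixes F :: "'a::euclidean_space \<Rightarrow> complex"
  assumes \<phi>: "test_fun U \<phi>" and F: "continuous_on U F"
  shows "set_integrable lborel U (\<lambda>x. \<phi> x *\<^sub>R F x)"
proof -
  obtain K where K: "compact K" "K \<subseteq> U" "\<And>x. x \<notin> K \<Longrightarrow> \<phi> x = 0"
    using \<phi> unfolding test_fun_def by auto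
  have "integrable lborel (\<lambda>x. indicator K x *\<^sub>R (\<phi> x *\<^sub>R F x))"
    by (intro borel_integrable_compact K continuous_on_scaleR
        continuous_on_subset[OF test_fun_directional(4)[OF \<phi>]] continuous_on_subset[OF F]) auto
  also have "(\<lambda>x. indicator K x *\<^sub>R (\<phi> x *\<^sub>R F x)) = (\<lambda>x. indicator U x *\<^sub>R (\<phi> x *\<^sub>R F x))"
  proof
    fix x show "indicator K x *\<^sub>R (\<phi> x *\<^sub>R F x) = indicator U x *\<^sub>R (\<phi> x *\<^sub>R F x)"
      using K(2,3) by (cases "x \<in> K") auto
  qed
  finally show ?thesis by (simp add: set_integrable_def)
qed

lemma weak_deriv_on_classical:
  assumes U: "open U" and F: "continuous_on U F" "continuous_on U F'"
    and der: "\<And>x. x \<in> U \<Longrightarrow> (F has_vector_derivative F' x) (at x)"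
  shows "weak_deriv_on U F F'"
  unfolding weak_deriv_on_def
proof (intro conjI allI impI locally_integrable_on_continuous F)
  fix \<phi> assume \<phi>: "test_fun U \<phi>"
  have d: "deriv \<phi> x = frechet_derivative \<phi> (at x) 1" for x
    using test_fun_directional(2)[OF \<phi>, of x 1]
    by (simp add: has_real_derivative_iff_has_vector_derivative[symmetric] DERIV_imp_deriv
        DERIV_shift[where x=0 and z=x, simplified add_0, symmetric] add.commute)
  have der': "((\<lambda>h. F (x + h *\<^sub>R 1)) has_vector_derivative F' x) (at 0)" if "x \<in> U" for x
  proof -
    have "(F \<circ> (\<lambda>h. x + h) has_vector_derivative 1 *\<^sub>R F' x) (at 0)"
      by (rule vector_diff_chain_at) (auto intro!: derivative_eq_intros der that)
    then show ?thesis by (simp add: o_def)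
  qed
  note * = test_fun_integration_by_parts[OF U \<phi> _ F der', simplified]
  have 1: "set_integrable lborel U (\<lambda>x. \<phi> x *\<^sub>R F' x)"
    by (rule test_fun_scaleR_integrable[OF \<phi> F(2)])
  have 2: "set_integrable lborel U (\<lambda>x. deriv \<phi> x *\<^sub>R F x)"
    using set_integral_diff(1)[OF *(1) 1] by (simp add: d)
  show "(LINT y:U|lborel. deriv \<phi> y *\<^sub>R F y) = - (LINT y:U|lborel. \<phi> y *\<^sub>R F' y)"
    using *(2) set_integral_add(2)[OF 2 1] by (simp add: d eq_neg_iff_add_eq_0)
qed

lemma open_spacetime: "open spacetime"
  unfolding spacetime_def half_plane_def by (intro open_Times) auto

text \<open>Common shape of both velocity components and the pressure. Factors such as -ik are
  absorbed into the amplitude \<open>G\<close>, so that one set of integration by parts rules covers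
  all three.\<close>

definition normal_mode :: "complex \<Rightarrow> real \<Rightarrow> (real \<Rightarrow> complex) \<Rightarrow> real \<times> real \<times> real \<Rightarrow> complex" where
  "normal_mode \<mu> k G = (\<lambda>(t, x, y). exp (\<mu> * of_real t) * exp (\<i> * of_real k * of_real x) * G y)"

lemma continuous_on_normal_mode:
  assumes "continuous_on {0<..} G"
  shows "continuous_on spacetime (normal_mode \<mu> k G)"
proof -
  have "continuous_on spacetime (\<lambda>q. G (snd (snd q)))"
    by (rule continuous_on_compose2[OF assms]) (auto intro!: continuous_intros simp: spacetime_def half_plane_def)
  then show ?thesis
    unfolding normal_mode_def case_prod_unfold by (intro continuous_intros)
qed

text \<open>Differentiation in t or x multiplies the amplitude by \<mu> or by ik, so continuity of
  \<open>G\<close> suffices here; only the y-direction calls for a differentiable amplitude.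
  Integrability is recorded along with the value 0 because the identities are going to be added
  up.\<close>

lemma normal_mode_by_parts:
  assumes \<phi>: "test_fun spacetime \<phi>" and G: "continuous_on {0<..} G"
  shows "set_integrable lborel spacetime
      (\<lambda>q. pd_t \<phi> q *\<^sub>R normal_mode \<mu> k G q + \<phi> q *\<^sub>R normal_mode \<mu> k (\<lambda>y. \<mu> * G y) q)" (is ?t1)
    and "(LINT q:spacetime|lborel.
      pd_t \<phi> q *\<^sub>R normal_mode \<mu> k G q + \<phi> q *\<^sub>R normal_mode \<mu> k (\<lambda>y. \<mu> * G y) q) = 0" (is ?t2)
    and "set_integrable lborel spacetime
      (\<lambda>q. pd_x \<phi> q *\<^sub>R normal_mode \<mu> k G q + \<phi> q *\<^sub>R normal_mode \<mu> k (\<lambda>y. \<i> * of_real k * G y) q)" (is ?x1)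
    and "(LINT q:spacetime|lborel.
      pd_x \<phi> q *\<^sub>R normal_mode \<mu> k G q + \<phi> q *\<^sub>R normal_mode \<mu> k (\<lambda>y. \<i> * of_real k * G y) q) = 0" (is ?x2)
proof -
  have dt: "((\<lambda>h. normal_mode \<mu> k G (q + h *\<^sub>R (1, 0, 0)))
      has_vector_derivative normal_mode \<mu> k (\<lambda>y. \<mu> * G y) q) (at 0)" for q
  proof -
    obtain t x y where q: "q = (t, x, y)" by (cases q)
    have "((\<lambda>h. exp (\<mu> * (of_real t + of_real h))) has_vector_derivative \<mu> * exp (\<mu> * of_real t)) (at 0)"
      by (rule has_vector_derivative_real_field[where f="\<lambda>z. exp (\<mu> * (of_real t + z))"])
         (auto intro!: derivative_eq_intros)
    then have "((\<lambda>h. exp (\<mu> * (of_real t + of_real h)) * (exp (\<i> * of_real k * of_real x) * G y))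
        has_vector_derivative \<mu> * exp (\<mu> * of_real t) * (exp (\<i> * of_real k * of_real x) * G y)) (at 0)"
      by (rule has_vector_derivative_mult_left)
    then show ?thesis by (simp add: q normal_mode_def mult_ac)
  qed
  have dx: "((\<lambda>h. normal_mode \<mu> k G (q + h *\<^sub>R (0, 1, 0)))
      has_vector_derivative normal_mode \<mu> k (\<lambda>y. \<i> * of_real k * G y) q) (at 0)" for q
  proof -
    obtain t x y where q: "q = (t, x, y)" by (cases q)
    have "((\<lambda>h. exp (\<i> * of_real k * (of_real x + of_real h))) has_vector_derivative
        \<i> * of_real k * exp (\<i> * of_real k * of_real x)) (at 0)"
      by (rule has_vector_derivative_real_field[where f="\<lambda>z. exp (\<i> * of_real k * (of_real x + z))"])
         (auto intro!: derivative_eq_intros)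
    then have "((\<lambda>h. exp (\<i> * of_real k * (of_real x + of_real h)) * (exp (\<mu> * of_real t) * G y))
        has_vector_derivative \<i> * of_real k * exp (\<i> * of_real k * of_real x) * (exp (\<mu> * of_real t) * G y)) (at 0)"
      by (rule has_vector_derivative_mult_left)
    then show ?thesis by (simp add: q normal_mode_def mult_ac)
  qed
  note c = continuous_on_normal_mode[OF G]
  have cont: "continuous_on spacetime (normal_mode \<mu> k (\<lambda>y. a * G y))" for a
    by (intro continuous_on_normal_mode continuous_intros G)
  have B: "(1, 0, 0) \<in> (Basis :: (real \<times> real \<times> real) set)" "(0, 1, 0) \<in> (Basis :: (real \<times> real \<times> real) set)"
    by (simp_all add: Basis_prod_def zero_prod_def)
  show ?t1 ?t2
    unfolding pd_t_def by (fact test_fun_integration_by_parts[OF open_spacetime \<phi> B(1) c cont dt])+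
  show ?x1 ?x2
    unfolding pd_x_def by (fact test_fun_integration_by_parts[OF open_spacetime \<phi> B(2) c cont dx])+
qed

lemma normal_mode_by_parts_y:
  assumes \<phi>: "test_fun spacetime \<phi>" and G: "continuous_on {0<..} G" and G': "continuous_on {0<..} G'"
    and der: "\<And>y. y > 0 \<Longrightarrow> (G has_vector_derivative G' y) (at y)"
  shows "set_integrable lborel spacetime
        (\<lambda>q. pd_y \<phi> q *\<^sub>R normal_mode \<mu> k G q + \<phi> q *\<^sub>R normal_mode \<mu> k G' q)" (is ?y1)
    and "(LINT q:spacetime|lborel.
        pd_y \<phi> q *\<^sub>R normal_mode \<mu> k G q + \<phi> q *\<^sub>R normal_mode \<mu> k G' q) = 0" (is ?y2)
proof -
  have dy: "((\<lambda>h. normal_mode \<mu> k G (q + h *\<^sub>R (0, 0, 1)))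
      has_vector_derivative normal_mode \<mu> k G' q) (at 0)" if "q \<in> spacetime" for q
  proof -
    obtain t x y where q: "q = (t, x, y)" by (cases q)
    have y: "y > 0" using that by (simp add: q spacetime_def half_plane_def)
    have "(G \<circ> (\<lambda>h. y + h) has_vector_derivative 1 *\<^sub>R G' y) (at 0)"
      by (rule vector_diff_chain_at) (auto intro!: derivative_eq_intros der y)
    then show ?thesis
      by (auto simp: q normal_mode_def o_def intro!: has_vector_derivative_mult_right)
  qed
  have B: "(0, 0, 1) \<in> (Basis :: (real \<times> real \<times> real) set)"
    by (simp add: Basis_prod_def zero_prod_def)
  note * = test_fun_integration_by_parts[OF open_spacetime \<phi> B
      continuous_on_normal_mode[OF G] continuous_on_normal_mode[OF G'] dy]
  show ?y1 unfolding pd_y_def by (rule *(1))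
  show ?y2 unfolding pd_y_def by (rule *(2))
qed

text \<open>With phase velocity \<open>c\<close> the growth rate is \<open>- \<i> k c\<close>, and the first momentum equation
  determines the pressure amplitude \<open>U' \<Psi> - (U - c) \<Psi>'\<close>.\<close>

lemma rayleigh_imp_linearly_unstable:
  fixes U U' U'' :: "real \<Rightarrow> real" and \<Psi> \<Psi>' \<Psi>'' :: "real \<Rightarrow> complex"
  assumes k: "k > 0" and c: "Im c > 0" and a: "a > 0"
    and U: "\<And>y. y > 0 \<Longrightarrow> (U has_real_derivative U' y) (at y)"
    and U': "\<And>y. y > 0 \<Longrightarrow> (U' has_real_derivative U'' y) (at y)"
    and \<Psi>: "\<And>y. y > 0 \<Longrightarrow> (\<Psi> has_vector_derivative \<Psi>' y) (at y)"
    and \<Psi>': "\<And>y. y > 0 \<Longrightarrow> (\<Psi>' has_vector_derivative \<Psi>'' y) (at y)"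
    and rayleigh: "\<And>y. y > 0 \<Longrightarrow>
      (of_real (U y) - c) * (\<Psi>'' y - (of_real k)\<^sup>2 * \<Psi> y) = of_real (U'' y) * \<Psi> y"
    and bound: "\<And>y. y > 0 \<Longrightarrow> norm (\<Psi> y) \<le> C * exp (- a * y)"
    and bound': "\<And>y. y > 0 \<Longrightarrow> norm (\<Psi>' y) \<le> C * exp (- a * y)"
    and cont: "continuous_on {0..} \<Psi>" and "\<Psi> 0 = 0" and nz: "\<exists>y>0. \<Psi> y \<noteq> 0"
  shows "linearly_unstable U"
proof -
  define \<mu> where "\<mu> = - \<i> * of_real k * c"
  define P where "P = (\<lambda>y. of_real (U' y) * \<Psi> y - (of_real (U y) - c) * \<Psi>' y)"
  let ?m = "normal_mode \<mu> k"
  have has_cont: "continuous_on {0<..} F"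
    if "\<And>y. y > 0 \<Longrightarrow> (F has_vector_derivative F' y) (at y)" for F F' :: "real \<Rightarrow> 'b::real_normed_vector"
    using that by (intro continuous_at_imp_continuous_on) (auto intro: has_vector_derivative_continuous)
  have c\<Psi>: "continuous_on {0<..} \<Psi>" and c\<Psi>': "continuous_on {0<..} \<Psi>'"
    using has_cont[OF \<Psi>] has_cont[OF \<Psi>'] by auto
  have cU: "continuous_on {0<..} U" and cU': "continuous_on {0<..} U'"
    using has_cont U U' by (auto simp: has_real_derivative_iff_has_vector_derivative)
  have cP: "continuous_on {0<..} P"
    unfolding P_def by (intro continuous_intros c\<Psi> c\<Psi>' cU cU')
  \<comment> \<open>This is the second momentum equation. The terms with U' times the derivative of
    \<Psi> cancel, and the Rayleigh equation eliminates the second derivative of \<Psi>.\<close>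
  have P': "(P has_vector_derivative - (of_real k)\<^sup>2 * (of_real (U y) - c) * \<Psi> y) (at y)" if "y > 0" for y
  proof -
    have "(P has_vector_derivative (of_real (U' y) * \<Psi>' y + of_real (U'' y) * \<Psi> y) -
        ((of_real (U y) - c) * \<Psi>'' y + (of_real (U' y) - 0) * \<Psi>' y)) (at y)"
      unfolding P_def
      by (intro has_vector_derivative_diff has_vector_derivative_mult has_vector_derivative_of_real
          has_vector_derivative_const \<Psi> \<Psi>' that) (use U U' that in \<open>auto simp: has_real_derivative_iff_has_vector_derivative\<close>)
    moreover have "(of_real (U' y) * \<Psi>' y + of_real (U'' y) * \<Psi> y) -
        ((of_real (U y) - c) * \<Psi>'' y + (of_real (U' y) - 0) * \<Psi>' y)
        = - (of_real k)\<^sup>2 * (of_real (U y) - c) * \<Psi> y"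
      using rayleigh[OF that] by algebra
    ultimately show ?thesis by simp
  qed
  have exp_int: "set_integrable lborel {0<..} (\<lambda>y. C\<^sup>2 * exp (- (2 * a) * y))"
  proof -
    have "set_integrable lborel {0..} (\<lambda>y. exp (- (2 * a) * y))"
      using set_integrable_exp_neg[of "2 * a"] a by simp
    then show ?thesis
      by (intro set_integrable_mult_right) (auto intro: set_integrable_subset)
  qed
  have sq: "square_integrable_on F {0<..}"
    if F: "continuous_on {0<..} F" "\<And>y. y > 0 \<Longrightarrow> norm (F y) \<le> C * exp (- a * y)" for F
    unfolding square_integrable_on_def
  proof
    show "set_borel_measurable lborel {0<..} F"
      unfolding set_borel_measurable_def using borel_measurable_continuous_on_indicator[OF _ F(1)] by simp
    show "set_integrable lborel {0<..} (\<lambda>y. (norm (F y))\<^sup>2)"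
    proof (rule set_integrable_continuous_bound[OF exp_int])
      fix y :: real assume "y \<in> {0<..}"
      then have "(norm (F y))\<^sup>2 \<le> (C * exp (- a * y))\<^sup>2"
        by (intro power_mono F) auto
      also have "\<dots> = C\<^sup>2 * exp (- (2 * a) * y)"
        by (simp add: power_mult_distrib exp_double[symmetric])
      finally show "norm ((norm (F y))\<^sup>2) \<le> C\<^sup>2 * exp (- (2 * a) * y)" by simp
    qed (auto intro!: continuous_intros F)
  qed
  have H10: "H10_half_line \<Psi> \<Psi>'"
    unfolding H10_half_line_def
    by (intro conjI sq c\<Psi> c\<Psi>' bound bound' weak_deriv_on_classical \<Psi> cont \<open>\<Psi> 0 = 0\<close>) auto
  have cUF: "continuous_on {0<..} (\<lambda>y. of_real (U y) * F y)" if "continuous_on {0<..} F" for F :: "real \<Rightarrow> complex"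
    by (intro continuous_intros that cU)
  have c2: "continuous_on {0<..} (\<lambda>y. - \<i> * of_real k * \<Psi> y)"
    by (intro continuous_intros c\<Psi>)
  \<comment> \<open>Each weak equation is minus a sum of integration by parts identities. Their
    zeroth-order terms cancel pointwise in the second and third equation and add up to the term with
    the derivative of \<open>U\<close> in the first. The third equation has only two such summands
    and is padded with 0.\<close>
  have zero: "(LINT q:spacetime|lborel. h q) = 0"
    if "\<And>q. q \<in> spacetime \<Longrightarrow> h q = - (ha q + hb q + hc q)"
      "set_integrable lborel spacetime ha" "(LINT q:spacetime|lborel. ha q) = 0"
      "set_integrable lborel spacetime hb" "(LINT q:spacetime|lborel. hb q) = 0"
      "set_integrable lborel spacetime hc" "(LINT q:spacetime|lborel. hc q) = 0"
    for h ha hb hc :: "real \<times> real \<times> real \<Rightarrow> complex"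
  proof -
    have "(LINT q:spacetime|lborel. h q) = (LINT q:spacetime|lborel. - (ha q + hb q + hc q))"
      using open_spacetime that(1) by (intro set_lebesgue_integral_cong) auto
    also have "\<dots> = - (LINT q:spacetime|lborel. ha q + hb q + hc q)"
      unfolding set_lebesgue_integral_def scaleR_minus_right by (rule Bochner_Integration.integral_minus)
    also have "\<dots> = 0"
      using set_integral_add[OF set_integral_add(1)[OF that(2,4)] that(6)] set_integral_add[OF that(2,4)] that(3,5,7)
      by simp
    finally show ?thesis .
  qed
  have c2': "continuous_on {0<..} (\<lambda>y. - \<i> * of_real k * \<Psi>' y)"
    by (intro continuous_intros c\<Psi>')
  have d2: "((\<lambda>y. - \<i> * of_real k * \<Psi> y) has_vector_derivative - \<i> * of_real k * \<Psi>' y) (at y)"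
    if "y > 0" for y
    by (intro has_vector_derivative_mult_right \<Psi> that)
  have zero_int: "set_integrable lborel spacetime (\<lambda>_. 0 :: complex)" "(LINT q:spacetime|lborel. 0 :: complex) = 0"
    by (auto simp: set_integrable_def set_lebesgue_integral_def)
  have "linearised_Euler_solution U (?m \<Psi>') (?m (\<lambda>y. - \<i> * of_real k * \<Psi> y)) (?m P)"
    unfolding linearised_Euler_solution_def
  proof (intro conjI allI impI locally_integrable_on_continuous continuous_on_normal_mode c\<Psi>' c2 cP)
    fix \<phi> assume \<phi>: "test_fun spacetime \<phi>"
    note ibp = normal_mode_by_parts[OF \<phi>, where \<mu>=\<mu> and k=k]
      normal_mode_by_parts_y[OF \<phi>, where \<mu>=\<mu> and k=k]
    show "(LINT (t, x, y):spacetime|lborel.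
            - (pd_t \<phi> (t, x, y) *\<^sub>R ?m \<Psi>' (t, x, y))
            - (U y * pd_x \<phi> (t, x, y)) *\<^sub>R ?m \<Psi>' (t, x, y)
            + (deriv U y * \<phi> (t, x, y)) *\<^sub>R ?m (\<lambda>y. - \<i> * of_real k * \<Psi> y) (t, x, y)
            - pd_x \<phi> (t, x, y) *\<^sub>R ?m P (t, x, y)) = 0"
    proof (rule zero[OF _ ibp(1,2)[OF c\<Psi>'] ibp(3,4)[OF cUF[OF c\<Psi>']] ibp(3,4)[OF cP]], goal_cases)
      case (1 q)
      obtain t x y where q: "q = (t, x, y)" by (cases q)
      have "y > 0" using 1 by (simp add: q spacetime_def half_plane_def)
      then have "deriv U y = U' y" using U by (blast intro: DERIV_imp_deriv)
      then show ?case
        by (simp add: q normal_mode_def P_def \<mu>_def scaleR_conv_of_real algebra_simps)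
    qed
    show "(LINT (t, x, y):spacetime|lborel.
            - (pd_t \<phi> (t, x, y) *\<^sub>R ?m (\<lambda>y. - \<i> * of_real k * \<Psi> y) (t, x, y))
            - (U y * pd_x \<phi> (t, x, y)) *\<^sub>R ?m (\<lambda>y. - \<i> * of_real k * \<Psi> y) (t, x, y)
            - pd_y \<phi> (t, x, y) *\<^sub>R ?m P (t, x, y)) = 0"
    proof (rule zero[OF _ ibp(1,2)[OF c2] ibp(3,4)[OF cUF[OF c2]] ibp(5,6)[OF cP _ P']], goal_cases)
      case (1 q)
      obtain t x y where q: "q = (t, x, y)" by (cases q)
      show ?case
        by (simp add: q normal_mode_def P_def \<mu>_def scaleR_conv_of_real algebra_simps power2_eq_square)
    qed (auto intro!: continuous_intros c\<Psi> cU)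
    show "(LINT q:spacetime|lborel. - (pd_x \<phi> q *\<^sub>R ?m \<Psi>' q)
         - pd_y \<phi> q *\<^sub>R ?m (\<lambda>y. - \<i> * of_real k * \<Psi> y) q) = 0"
    proof (rule zero[OF _ ibp(3,4)[OF c\<Psi>'] ibp(5,6)[OF c2 c2' d2] zero_int], goal_cases)
      case (1 q)
      obtain t x y where q: "q = (t, x, y)" by (cases q)
      show ?case
        by (simp add: q normal_mode_def scaleR_conv_of_real algebra_simps)
    qed
  next
    fix t x :: real assume "t > 0"
    have "(\<Psi> \<longlongrightarrow> 0) (at 0 within {0..})"
      using cont[unfolded continuous_on_def, rule_format, of 0] by (simp add: \<open>\<Psi> 0 = 0\<close>)
    moreover have "filterlim (\<lambda>q. snd (snd q)) (at 0 within {0..}) (at (t, x, 0::real) within spacetime)"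
      unfolding filterlim_at
      by (auto intro!: tendsto_eq_intros simp: eventually_at_filter spacetime_def half_plane_def
          intro!: always_eventually)
    ultimately have *: "((\<lambda>q. \<Psi> (snd (snd q))) \<longlongrightarrow> 0) (at (t, x, 0) within spacetime)"
      by (rule filterlim_compose)
    show "(?m (\<lambda>y. - \<i> * of_real k * \<Psi> y) \<longlongrightarrow> 0) (at (t, x, 0) within spacetime)"
      unfolding normal_mode_def case_prod_unfold
      by (auto intro!: tendsto_eq_intros *)
  qed
  moreover have "?m (\<lambda>y. - \<i> * of_real k * \<Psi> y) = (\<lambda>(t, x, y).
      - \<i> * of_real k * exp (\<mu> * of_real t) * exp (\<i> * of_real k * of_real x) * \<Psi> y)"
    by (auto simp: normal_mode_def)
  moreover have "Re \<mu> > 0" using k c by (simp add: \<mu>_def)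
  ultimately show ?thesis
    unfolding linearly_unstable_def using H10 nz
    by (intro exI[of _ k] exI[of _ \<mu>] exI[of _ \<Psi>] exI[of _ \<Psi>'] exI[of _ "?m P"])
       (simp add: normal_mode_def)
qed

text \<open>Polynomials in tanh are closed under differentiation because the derivative of tanh is 1
  - tanh^2, which is the factor \<open>[:1, 0, - 1:]\<close>. Generalising from tanh to all
  polynomials in it lets the induction over the order go through.\<close>

lemma Ck_on_poly_tanh:
  fixes P :: "real poly"
  shows "Ck_on n (\<lambda>(x, y). (poly P (tanh (y - \<delta>)), 0 :: real)) (half_plane :: (real \<times> real) set)"
proof (induction n arbitrary: P)
  case 0
  show ?case
    unfolding Ck_on.simps case_prod_unfold by (intro continuous_intros) auto
next
  case (Suc n)
  let ?F = "\<lambda>P (x :: real, y). (poly P (tanh (y - \<delta>)), 0 :: real)"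
  let ?D = "pderiv P * [:1, 0, - 1:]"
  have der: "(?F P has_derivative (\<lambda>h. (poly ?D (tanh (snd q - \<delta>)) * snd h, 0))) (at q)" for q
    unfolding case_prod_unfold
  proof (rule has_derivative_Pair)
    have "((\<lambda>y. poly P (tanh (y - \<delta>))) has_real_derivative poly ?D (tanh (snd q - \<delta>))) (at (snd q))"
      by (rule DERIV_cong, rule DERIV_chain2[OF poly_DERIV])
         (auto intro!: derivative_eq_intros simp: power2_eq_square algebra_simps)
    then have "((\<lambda>y. poly P (tanh (y - \<delta>))) has_derivative (*) (poly ?D (tanh (snd q - \<delta>)))) (at (snd q))"
      by (simp add: has_field_derivative_def)
    from has_derivative_compose[OF has_derivative_snd[OF has_derivative_ident] this]
    show "((\<lambda>x. poly P (tanh (snd x - \<delta>))) has_derivative (\<lambda>h. poly ?D (tanh (snd q - \<delta>)) * snd h)) (at q)" .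
  qed simp
  then have fd: "frechet_derivative (?F P) (at q) = (\<lambda>h. (poly ?D (tanh (snd q - \<delta>)) * snd h, 0))" for q
    by (rule frechet_derivative_at[symmetric])
  have eq: "(\<lambda>q. frechet_derivative (?F P) (at q) i) = ?F (smult (snd i) ?D)" for i
    unfolding fd by (auto simp: fun_eq_iff algebra_simps)
  show ?case
    unfolding Ck_on.simps eq using der by (intro conjI ballI Suc.IH) (rule differentiableI)
qed

lemma shear_flow_tanh: "shear_flow (\<lambda>y. tanh (y - \<delta>) + \<zeta>)"
  using Ck_on_poly_tanh[of _ "[:\<zeta>, 1:]" \<delta>]
  by (simp add: shear_flow_def smooth_on_def add.commute)

section \<open>Decaying solutions of the Rayleigh equation\<close>

text \<open>The Volterra equation integrates over the distance \<open>d\<close>, which keeps its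
  domain fixed. For differentiation in y the tail is rewritten as the full integral minus the
  integral over [0, y].\<close>

lemma tail_integral_has_vector_derivative:
  fixes F :: "real \<Rightarrow> complex"
  assumes cont: "continuous_on {0..} F" and int: "set_integrable lborel {0..} F" and y: "y > 0"
  shows "((\<lambda>y. LINT d:{0..}|lborel. F (y + d)) has_vector_derivative - F y) (at y)"
proof -
  have sub: "set_integrable lborel S F" if "S \<subseteq> {0..}" "S \<in> sets borel" for S
    using set_integrable_subset[OF int] that by simp
  have eq: "(LINT d:{0..}|lborel. F (x + d)) = (LINT d:{0..}|lborel. F d) - integral {0..x} F" if "x > 0" for x
  proof -
    have "(LINT d:{x..}|lborel. F d) = integral\<^sup>L lborel (\<lambda>d. indicator {x..} (x + 1 * d) *\<^sub>R F (x + 1 * d))"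
      unfolding set_lebesgue_integral_def
      using lborel_integral_real_affine[of 1 "\<lambda>d. indicator {x..} d *\<^sub>R F d" x] by simp
    also have "\<dots> = (LINT d:{0..}|lborel. F (x + d))"
      unfolding set_lebesgue_integral_def by (rule Bochner_Integration.integral_cong) (auto simp: indicator_def)
    finally have 1: "(LINT d:{0..}|lborel. F (x + d)) = (LINT d:{x..}|lborel. F d)" ..
    have "{0..} = {0..x} \<union> {x..}" using that by auto
    moreover have "(LINT d:{0..x} \<union> {x..}|lborel. F d) = (LINT d:{0..x}|lborel. F d) + (LINT d:{x..}|lborel. F d)"
    proof (rule set_integral_Un_AE)
      show "AE d in lborel. \<not> (d \<in> {0..x} \<and> d \<in> {x..})"
        using AE_lborel_singleton[of x] by eventually_elim auto
    qed (use that sub in auto)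
    moreover have "(LINT d:{0..x}|lborel. F d) = integral {0..x} F"
      using sub[of "{0..x}"] by (intro set_borel_integral_eq_integral) auto
    ultimately show ?thesis using 1 by simp
  qed
  have "((\<lambda>x. integral {0..x} F) has_vector_derivative F y) (at y within {0..y + 1})"
    by (rule integral_has_vector_derivative) (use y cont in \<open>auto intro: continuous_on_subset\<close>)
  then have "((\<lambda>x. integral {0..x} F) has_vector_derivative F y) (at y)"
    using y by (subst (asm) at_within_interior) auto
  then have "((\<lambda>x. (LINT d:{0..}|lborel. F d) - integral {0..x} F) has_vector_derivative 0 - F y) (at y)"
    by (intro has_vector_derivative_diff has_vector_derivative_const)
  then have "((\<lambda>x. (LINT d:{0..}|lborel. F d) - integral {0..x} F) has_vector_derivative - F y) (at y)"
    by simp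
  then show ?thesis
    by (rule has_vector_derivative_transform_within_open[where S="{0<..}"]) (use y eq in auto)
qed

text \<open>For \<open>c = 0\<close> the Rayleigh equation has the solutions \<open>e\<^sup>-\<^sup>k\<^sup>y (k + tanh (y - \<delta>))\<close> and
  \<open>e\<^sup>k\<^sup>y (k - tanh (y - \<delta>))\<close> with Wronskian \<open>2k(k\<^sup>2 - 1)\<close>. Variation of constants, written for
  \<open>m = e\<^sup>k\<^sup>y \<Psi>\<close> and with the distance \<open>d\<close> to \<open>y\<close> as integration variable, yields this kernel.\<close>

definition jost_kernel :: "real \<Rightarrow> real \<Rightarrow> real \<Rightarrow> real \<Rightarrow> real" where
  "jost_kernel \<delta> k y d =
     ((k + tanh (y - \<delta>)) * (k - tanh (y + d - \<delta>))
       - (k - tanh (y - \<delta>)) * (k + tanh (y + d - \<delta>)) * exp (- 2 * k * d)) / (2 * k * (1 - k\<^sup>2))"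

text \<open>With \<open>s = tanh (y - \<delta>)\<close>, dividing the Rayleigh equation by \<open>s - c\<close> gives
  \<open>\<Psi>'' - k\<^sup>2 \<Psi> + 2 (1 - s\<^sup>2) \<Psi> = - 2c (1 - s\<^sup>2)/(s - c) \<Psi>\<close>, since \<open>s/(s - c) = 1 + c/(s - c)\<close>.\<close>

definition rayleigh_potential :: "real \<Rightarrow> complex \<Rightarrow> real \<Rightarrow> complex" where
  "rayleigh_potential \<delta> c y =
     2 * c * of_real (1 - (tanh (y - \<delta>))\<^sup>2) / (of_real (tanh (y - \<delta>)) - c)"

lemma continuous_on_rayleigh_potential:
  "Im c > 0 \<Longrightarrow> continuous_on A (rayleigh_potential \<delta> c)"
  unfolding rayleigh_potential_def using of_real_diff_ne_0[of c] by (intro continuous_intros) auto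

text \<open>Crude estimate from |s - c| \<ge> Im c. It gives integrability and decay for fixed c,
  but no smallness as c tends to 0.\<close>

lemma norm_rayleigh_potential_le:
  assumes "Im c > 0"
  shows "norm (rayleigh_potential \<delta> c y) \<le> 2 * cmod c / Im c * (1 - (tanh (y - \<delta>))\<^sup>2)"
proof -
  have "Im c \<le> cmod (of_real (tanh (y - \<delta>)) - c)"
    using abs_Im_le_cmod[of "of_real (tanh (y - \<delta>)) - c"] assms by simp
  then have "2 * cmod c * (1 - (tanh (y - \<delta>))\<^sup>2) / cmod (of_real (tanh (y - \<delta>)) - c)
      \<le> 2 * cmod c * (1 - (tanh (y - \<delta>))\<^sup>2) / Im c"
    using assms one_minus_tanh_square_pos[of "y - \<delta>"]
    by (intro divide_left_mono mult_pos_pos mult_nonneg_nonneg) auto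
  moreover have "norm (of_real (1 - (tanh (y - \<delta>))\<^sup>2) :: complex) = 1 - (tanh (y - \<delta>))\<^sup>2"
    using one_minus_tanh_square_pos[of "y - \<delta>"] by (simp only: norm_of_real abs_of_pos)
  ultimately show ?thesis
    by (simp only: rayleigh_potential_def norm_divide norm_mult norm_numeral times_divide_eq_left)
qed

text \<open>Variation of constants read backwards. The two terms of the kernel are products of a
  function of y and a function of y + d, so \<Psi> equals f (1 + A u) - g A v with \<open>f\<close>,
  \<open>g\<close> the decaying and the growing solution at c = 0 and \<open>u\<close>,
  \<open>v\<close> tail integrals. The tails are differentiable for continuous integrands, so two
  derivatives of \<Psi> come out although m is only assumed continuous.\<close>

lemma jost_solution_regular:
  fixes m :: "real \<Rightarrow> complex" and k :: real
  defines "\<Psi> \<equiv> \<lambda>y. of_real (exp (- k * y)) * m y"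
  assumes k: "0 < k" "k < 1" and c: "Im c > 0"
    and m_cont: "continuous_on {0..} m" and m_le: "\<And>y. y \<ge> 0 \<Longrightarrow> norm (m y) \<le> C"
    and m_eq: "\<And>y. y \<ge> 0 \<Longrightarrow> m y = of_real (k + tanh (y - \<delta>)) +
      (LINT d:{0..}|lborel. of_real (jost_kernel \<delta> k y d) * rayleigh_potential \<delta> c (y + d) * m (y + d))"
  obtains \<Psi>' C' where
    "\<And>y. y > 0 \<Longrightarrow> (\<Psi> has_vector_derivative \<Psi>' y) (at y)"
    "\<And>y. y > 0 \<Longrightarrow> (\<Psi>' has_vector_derivative
        (of_real (k\<^sup>2 - 2 * (1 - (tanh (y - \<delta>))\<^sup>2)) - rayleigh_potential \<delta> c y) * \<Psi> y) (at y)"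
    "\<And>y. y > 0 \<Longrightarrow> norm (\<Psi>' y) \<le> C' * exp (- k * y)"
proof -
  define s where "s = (\<lambda>y. tanh (y - \<delta>))"
  define Q where "Q = rayleigh_potential \<delta> c"
  define A where "A = 1 / (2 * k * (1 - k\<^sup>2))"
  have k2: "1 - k\<^sup>2 > 0" using k by (simp add: abs_square_less_1)
  have A: "A > 0" "A * (2 * k * (k\<^sup>2 - 1)) = - 1"
    using k k2 by (auto simp: A_def divide_simps)
  define G where "G = (\<lambda>x. of_real (k - s x) * (Q x * m x))"
  define H where "H = (\<lambda>x. of_real (exp (- 2 * k * x) * (k + s x)) * (Q x * m x))"
  define u where "u = (\<lambda>y. LINT d:{0..}|lborel. G (y + d))"
  define v where "v = (\<lambda>y. LINT d:{0..}|lborel. H (y + d))"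
  define f where "f = (\<lambda>y. exp (- k * y) * (k + s y))"
  define g where "g = (\<lambda>y. exp (k * y) * (k - s y))"
  define f' where "f' = (\<lambda>y. exp (- k * y) * (1 - (s y)\<^sup>2 - k * (k + s y)))"
  define g' where "g' = (\<lambda>y. exp (k * y) * (k * (k - s y) - (1 - (s y)\<^sup>2)))"
  define S where "S = (\<lambda>y. 1 - (s y)\<^sup>2)"
  have C: "C \<ge> 0" using m_le[of 0] norm_ge_zero order_trans by blast
  have s1: "\<bar>s y\<bar> \<le> 1" for y by (simp add: s_def abs_tanh_le_1)
  have S0: "0 < S y" "S y \<le> 1" for y
    using one_minus_tanh_square_pos by (auto simp: S_def s_def)
  have ds: "(s has_real_derivative S y) (at y)" for y
    unfolding s_def S_def by (auto intro!: derivative_eq_intros)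
  have df: "(f has_real_derivative f' y) (at y)" for y
    unfolding f_def f'_def by (auto intro!: derivative_eq_intros ds simp: S_def algebra_simps)
  have dg: "(g has_real_derivative g' y) (at y)" for y
    unfolding g_def g'_def by (auto intro!: derivative_eq_intros ds simp: S_def algebra_simps)
  have df': "(f' has_real_derivative (k\<^sup>2 - 2 * S y) * f y) (at y)" for y
    unfolding f_def f'_def by (auto intro!: derivative_eq_intros ds simp: S_def algebra_simps power2_eq_square power3_eq_cube)
  have dg': "(g' has_real_derivative (k\<^sup>2 - 2 * S y) * g y) (at y)" for y
    unfolding g_def g'_def by (auto intro!: derivative_eq_intros ds simp: S_def algebra_simps power2_eq_square power3_eq_cube)
  \<comment> \<open>The factor 2 bounds |k - s| and |k + s|; the bracket comes from the crude bound
    on the potential, and \<open>C\<close> bounds \<open>m\<close>.\<close>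
  define D where "D = 2 * (2 * cmod c / Im c) * C"
  have D: "D \<ge> 0" using C c by (simp add: D_def)
  have cont_s: "continuous_on T s" for T unfolding s_def by (intro continuous_intros) auto
  have cont_Q: "continuous_on T Q" for T unfolding Q_def by (rule continuous_on_rayleigh_potential[OF c])
  have cont_G: "continuous_on {0..} G" and cont_H: "continuous_on {0..} H"
    unfolding G_def H_def by (intro continuous_intros cont_s cont_Q m_cont)+
  have Qm: "norm (Q x * m x) \<le> 2 * cmod c / Im c * S x * C" if "x \<ge> 0" for x
    unfolding norm_mult Q_def S_def s_def
    using c C norm_rayleigh_potential_le[OF c, of \<delta> x] one_minus_tanh_square_pos[of "x - \<delta>"]
    by (intro mult_mono m_le that) auto
  have prefactor: "\<bar>k - s x\<bar> \<le> 2" "\<bar>k + s x\<bar> \<le> 2" for x using s1[of x] k by auto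
  have G_le: "norm (G x) \<le> D * S x" if "x \<ge> 0" for x
  proof -
    have "norm (G x) \<le> 2 * (2 * cmod c / Im c * S x * C)"
      unfolding G_def norm_mult[of "of_real _"] norm_of_real by (intro mult_mono prefactor Qm that) auto
    then show ?thesis by (simp add: D_def mult_ac)
  qed
  have H_le: "norm (H x) \<le> exp (- 2 * k * x) * (D * S x)" if "x \<ge> 0" for x
  proof -
    have "norm (H x) \<le> (exp (- 2 * k * x) * 2) * (2 * cmod c / Im c * S x * C)"
      unfolding H_def norm_mult[of "of_real _"] norm_of_real abs_mult
      by (intro mult_mono prefactor Qm that) auto
    then show ?thesis by (simp add: D_def mult_ac)
  qed
  have int_S: "set_integrable lborel {0..} (\<lambda>d. S (y + d))" "(LINT d:{0..}|lborel. S (y + d)) \<le> 2" for y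
    using set_integrable_one_minus_tanh_square[of "y - \<delta>"] tanh_real_bounds[of "y - \<delta>"]
    by (auto simp: S_def s_def algebra_simps)
  have shift: "set_integrable lborel {0..} (\<lambda>d. F (y + d)) \<and> norm (LINT d:{0..}|lborel. F (y + d)) \<le> 2 * B"
    if F: "continuous_on {0..} F" "\<And>x. x \<ge> y \<Longrightarrow> norm (F x) \<le> B * S x" "y \<ge> 0" "B \<ge> 0" for F :: "real \<Rightarrow> complex" and y B
  proof -
    have BS: "set_integrable lborel {0..} (\<lambda>d. B * S (y + d))"
      by (intro set_integrable_mult_right int_S)
    have Fc: "continuous_on {0..} (\<lambda>d. F (y + d))"
      by (rule continuous_on_compose2[OF F(1)]) (use F(3) in \<open>auto intro!: continuous_intros\<close>)
    have Fb: "norm (F (y + d)) \<le> B * S (y + d)" if "0 \<le> d" for d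
      using F(2) that by simp
    have "(LINT d:{0..}|lborel. B * S (y + d)) \<le> 2 * B"
      unfolding set_integral_mult_right using mult_left_mono[OF int_S(2) F(4)] by (simp add: mult.commute)
    from set_integral_norm_le[OF BS Fc Fb this] show ?thesis by simp
  qed
  have u: "set_integrable lborel {0..} (\<lambda>d. G (y + d))" "norm (u y) \<le> 2 * D" if "y \<ge> 0" for y
    using shift[OF cont_G _ that D] G_le that by (auto simp: u_def)
  \<comment> \<open>The weight in \<open>H\<close> makes \<open>v\<close> decay like e^(-2ky), which
    turns the growing factor \<open>g\<close> in front of it into a term of size e^(-ky).\<close>
  have v: "set_integrable lborel {0..} (\<lambda>d. H (y + d))" "norm (v y) \<le> 2 * (exp (- 2 * k * y) * D)" if "y \<ge> 0" for y
  proof -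
    have "norm (H x) \<le> (exp (- 2 * k * y) * D) * S x" if "x \<ge> y" for x
    proof -
      have "norm (H x) \<le> exp (- 2 * k * x) * (D * S x)" using that \<open>y \<ge> 0\<close> by (intro H_le) auto
      also have "\<dots> \<le> exp (- 2 * k * y) * (D * S x)"
        using that k D S0[of x] by (intro mult_right_mono) auto
      finally show ?thesis by simp
    qed
    from shift[OF cont_H this that] D
    show "set_integrable lborel {0..} (\<lambda>d. H (y + d))" "norm (v y) \<le> 2 * (exp (- 2 * k * y) * D)"
      by (auto simp: v_def)
  qed
  have du: "(u has_vector_derivative - G y) (at y)" if "y > 0" for y
    unfolding u_def using tail_integral_has_vector_derivative[OF cont_G _ that] u(1)[of 0] by simp
  have dv: "(v has_vector_derivative - H y) (at y)" if "y > 0" for y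
    unfolding v_def using tail_integral_has_vector_derivative[OF cont_H _ that] v(1)[of 0] by simp
  have \<Psi>_eq: "\<Psi> y = f y *\<^sub>R (1 + A *\<^sub>R u y) - g y *\<^sub>R (A *\<^sub>R v y)" if "y \<ge> 0" for y
  proof -
    have pt: "of_real (jost_kernel \<delta> k y d) * rayleigh_potential \<delta> c (y + d) * m (y + d)
      = (A * (k + s y)) *\<^sub>R G (y + d) - (A * (k - s y) * exp (2 * k * y)) *\<^sub>R H (y + d)" for d
    proof -
      have "jost_kernel \<delta> k y d = A * ((k + s y) * (k - s (y + d)) - (k - s y) * (k + s (y + d)) * exp (- 2 * k * d))"
        by (simp add: jost_kernel_def A_def s_def)
      \<comment> \<open>This splitting separates y from y + d in the second term of the
        kernel.\<close>
      also have "exp (- 2 * k * d) = exp (2 * k * y) * exp (- 2 * k * (y + d))"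
        by (simp add: exp_add[symmetric] algebra_simps)
      finally have kernel: "jost_kernel \<delta> k y d = A * ((k + s y) * (k - s (y + d)) -
          (k - s y) * (k + s (y + d)) * (exp (2 * k * y) * exp (- 2 * k * (y + d))))" .
      show ?thesis
        unfolding kernel G_def H_def Q_def[symmetric] scaleR_conv_of_real of_real_mult of_real_diff of_real_add
        by algebra
    qed
    have "m y = of_real (k + s y) + ((A * (k + s y)) *\<^sub>R u y - (A * (k - s y) * exp (2 * k * y)) *\<^sub>R v y)"
      unfolding m_eq[OF that] pt u_def v_def
      by (subst set_integral_diff(2)) (use u(1)[OF that] v(1)[OF that] in \<open>auto simp: s_def\<close>)
    moreover have "complex_of_real (exp (2 * k * y)) = of_real (exp (k * y)) * of_real (exp (k * y))"
      "complex_of_real (exp (- k * y)) * of_real (exp (k * y)) = 1"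
      by (simp_all add: exp_add[symmetric] flip: of_real_mult)
    ultimately show ?thesis
      unfolding \<Psi>_def f_def g_def scaleR_conv_of_real of_real_mult of_real_diff of_real_add
      by algebra
  qed
  \<comment> \<open>The usual cancellation in variation of constants: the derivatives of
    \<open>u\<close> and \<open>v\<close> contribute nothing to the first derivative of
    \<Psi>.\<close>
  have fg: "f y *\<^sub>R G y = g y *\<^sub>R H y" for y
  proof -
    have *: "exp (- k * y) = exp (k * y) * exp (- 2 * k * y)"
      by (simp add: exp_add[symmetric])
    show ?thesis
      unfolding f_def g_def G_def H_def scaleR_conv_of_real * of_real_mult by (simp only: mult_ac)
  qed
  define \<Psi>' where "\<Psi>' = (\<lambda>y. f' y *\<^sub>R (1 + A *\<^sub>R u y) - g' y *\<^sub>R (A *\<^sub>R v y))"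
  have duu: "((\<lambda>y. 1 + A *\<^sub>R u y) has_vector_derivative - (A *\<^sub>R G y)) (at y)"
    and dvv: "((\<lambda>y. A *\<^sub>R v y) has_vector_derivative - (A *\<^sub>R H y)) (at y)" if "y > 0" for y
    using du[OF that] dv[OF that] by (auto intro!: derivative_eq_intros)
  show thesis
  proof (rule that)
    fix y :: real assume y: "y > 0"
    have "((\<lambda>y. f y *\<^sub>R (1 + A *\<^sub>R u y) - g y *\<^sub>R (A *\<^sub>R v y)) has_vector_derivative
      (f y *\<^sub>R (- (A *\<^sub>R G y)) + f' y *\<^sub>R (1 + A *\<^sub>R u y)) - (g y *\<^sub>R (- (A *\<^sub>R H y)) + g' y *\<^sub>R (A *\<^sub>R v y))) (at y)"
      by (intro has_vector_derivative_diff has_vector_derivative_scaleR df dg duu dvv y)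
    also have "(f y *\<^sub>R (- (A *\<^sub>R G y)) + f' y *\<^sub>R (1 + A *\<^sub>R u y)) - (g y *\<^sub>R (- (A *\<^sub>R H y)) + g' y *\<^sub>R (A *\<^sub>R v y))
      = \<Psi>' y"
      using fg[of y] unfolding \<Psi>'_def scaleR_conv_of_real by algebra
    finally show "(\<Psi> has_vector_derivative \<Psi>' y) (at y)"
      by (rule has_vector_derivative_transform_within_open[where S="{0<..}"]) (use y \<Psi>_eq in auto)
    have "(\<Psi>' has_vector_derivative
      (f' y *\<^sub>R (- (A *\<^sub>R G y)) + ((k\<^sup>2 - 2 * S y) * f y) *\<^sub>R (1 + A *\<^sub>R u y))
      - (g' y *\<^sub>R (- (A *\<^sub>R H y)) + ((k\<^sup>2 - 2 * S y) * g y) *\<^sub>R (A *\<^sub>R v y))) (at y)"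
      unfolding \<Psi>'_def
      by (intro has_vector_derivative_diff has_vector_derivative_scaleR df' dg' duu dvv y)
    also have "(f' y *\<^sub>R (- (A *\<^sub>R G y)) + ((k\<^sup>2 - 2 * S y) * f y) *\<^sub>R (1 + A *\<^sub>R u y))
      - (g' y *\<^sub>R (- (A *\<^sub>R H y)) + ((k\<^sup>2 - 2 * S y) * g y) *\<^sub>R (A *\<^sub>R v y))
      = (k\<^sup>2 - 2 * S y) *\<^sub>R \<Psi> y + A *\<^sub>R (g' y *\<^sub>R H y - f' y *\<^sub>R G y)"
      unfolding \<Psi>_eq[OF less_imp_le[OF y]] scaleR_conv_of_real of_real_mult by algebra
    \<comment> \<open>In the second derivative the corresponding terms do not cancel but produce the
      Wronskian 2k(k^2 - 1) times e^(-ky) Q m; \<open>A\<close> is its negative reciprocal.\<close>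
    also have "A *\<^sub>R (g' y *\<^sub>R H y - f' y *\<^sub>R G y) = - Q y * \<Psi> y"
    proof -
      have "g' y * (exp (- 2 * k * y) * (k + s y)) - f' y * (k - s y) = exp (- k * y) * (2 * k * (k\<^sup>2 - 1))"
      proof -
        have "p * (k * (k - t) - (1 - t\<^sup>2)) * (q * (k + t)) - r * (1 - t\<^sup>2 - k * (k + t)) * (k - t)
            = r * (2 * k * (k\<^sup>2 - 1))" if "p * q = r" for p q r t :: real
          unfolding that[symmetric] by (simp add: algebra_simps power2_eq_square power3_eq_cube)
        moreover have "exp (k * y) * exp (- 2 * k * y) = exp (- k * y)" by (simp add: exp_add[symmetric])
        ultimately show ?thesis unfolding g'_def f'_def by blast
      qed
      moreover have "g' y *\<^sub>R H y - f' y *\<^sub>R G y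
        = of_real (g' y * (exp (- 2 * k * y) * (k + s y)) - f' y * (k - s y)) * (Q y * m y)"
        unfolding G_def H_def scaleR_conv_of_real of_real_mult of_real_diff by algebra
      ultimately have "A *\<^sub>R (g' y *\<^sub>R H y - f' y *\<^sub>R G y)
        = of_real (A * (2 * k * (k\<^sup>2 - 1))) * (of_real (exp (- k * y)) * (Q y * m y))"
        by (simp add: scaleR_conv_of_real)
      then show ?thesis unfolding A(2) by (simp add: \<Psi>_def)
    qed
    also have "(k\<^sup>2 - 2 * S y) *\<^sub>R \<Psi> y + - Q y * \<Psi> y
      = (of_real (k\<^sup>2 - 2 * (1 - (tanh (y - \<delta>))\<^sup>2)) - rayleigh_potential \<delta> c y) * \<Psi> y"
      by (simp add: S_def s_def Q_def scaleR_conv_of_real algebra_simps)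
    finally show "(\<Psi>' has_vector_derivative
        (of_real (k\<^sup>2 - 2 * (1 - (tanh (y - \<delta>))\<^sup>2)) - rayleigh_potential \<delta> c y) * \<Psi> y) (at y)" .
    have ks: "\<bar>k * (k + s y)\<bar> \<le> 2" "\<bar>k * (k - s y)\<bar> \<le> 2"
      using prefactor[of y] k by (auto simp: abs_mult intro!: mult_le_one order_trans[OF mult_right_mono[of k 1]])
    have "\<bar>1 - (s y)\<^sup>2 - k * (k + s y)\<bar> \<le> 3" "\<bar>k * (k - s y) - (1 - (s y)\<^sup>2)\<bar> \<le> 3"
      using ks S0[of y] zero_le_power2[of "s y"] unfolding S_def by linarith+
    then have f'_le: "\<bar>f' y\<bar> \<le> exp (- k * y) * 3" and g'_le: "\<bar>g' y\<bar> \<le> exp (k * y) * 3"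
      unfolding f'_def g'_def abs_mult
      by auto
    have "norm (\<Psi>' y) \<le> norm (f' y *\<^sub>R (1 + A *\<^sub>R u y)) + norm (g' y *\<^sub>R (A *\<^sub>R v y))"
      unfolding \<Psi>'_def by (rule norm_triangle_ineq4)
    also have "\<dots> \<le> (exp (- k * y) * 3) * (1 + A * (2 * D)) + (exp (k * y) * 3) * (A * (2 * (exp (- 2 * k * y) * D)))"
    proof (intro add_mono)
      have "norm (1 + A *\<^sub>R u y) \<le> 1 + A * (2 * D)"
      proof -
        have "norm (1 + A *\<^sub>R u y) \<le> norm (1 :: complex) + norm (A *\<^sub>R u y)" by (rule norm_triangle_ineq)
        also have "norm (A *\<^sub>R u y) \<le> A * (2 * D)"
          using A u(2)[OF less_imp_le[OF y]] by (simp add: mult_left_mono)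
        finally show ?thesis by simp
      qed
      then show "norm (f' y *\<^sub>R (1 + A *\<^sub>R u y)) \<le> (exp (- k * y) * 3) * (1 + A * (2 * D))"
        unfolding norm_scaleR by (intro mult_mono f'_le) auto
      have "norm (A *\<^sub>R v y) \<le> A * (2 * (exp (- 2 * k * y) * D))"
        using v(2)[of y] A y by simp
      then show "norm (g' y *\<^sub>R (A *\<^sub>R v y)) \<le> (exp (k * y) * 3) * (A * (2 * (exp (- 2 * k * y) * D)))"
        unfolding norm_scaleR[of "g' y"] by (intro mult_mono g'_le) auto
    qed
    also have "\<dots> = (3 * (1 + A * (2 * D)) + 3 * A * 2 * D) * exp (- k * y)"
    proof -
      have "r * 3 * (1 + A * (2 * D)) + p * 3 * (A * (2 * (q * D))) = (3 * (1 + A * (2 * D)) + 3 * A * 2 * D) * r"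
        if "p * q = r" for p q r :: real
        unfolding that[symmetric] by (simp add: algebra_simps)
      moreover have "exp (k * y) * exp (- 2 * k * y) = exp (- k * y)" by (simp add: exp_add[symmetric])
      ultimately show ?thesis by blast
    qed
    finally show "norm (\<Psi>' y) \<le> (3 * (1 + A * (2 * D)) + 3 * A * 2 * D) * exp (- k * y)" .
  qed
qed

text \<open>Every factor k \<plusminus> tanh has modulus at most 2 and the exponential is at most 1,
  so the numerator is at most 8. The denominator is estimated by the ends of the window of wave
  numbers, which makes the bound uniform in k.\<close>

lemma jost_kernel_bound:
  assumes k: "0 < k1" "k1 \<le> k" "k \<le> k2" "k2 < 1" and d: "d \<ge> 0"
  shows "\<bar>jost_kernel \<delta> k y d\<bar> \<le> 8 * (1 / (2 * k1 * (1 - k2\<^sup>2)))"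
proof -
  define s t where "s = tanh (y - \<delta>)" and "t = tanh (y + d - \<delta>)"
  have st: "\<bar>s\<bar> \<le> 1" "\<bar>t\<bar> \<le> 1" by (auto simp: s_def t_def abs_tanh_le_1)
  have k2: "k\<^sup>2 \<le> k2\<^sup>2" "k2\<^sup>2 < 1"
    using k by (auto simp: power_mono abs_square_less_1)
  have den: "0 < 2 * k1 * (1 - k2\<^sup>2)" "2 * k1 * (1 - k2\<^sup>2) \<le> 2 * k * (1 - k\<^sup>2)"
    using k k2 by (auto intro!: mult_mono)
  have "\<bar>(k + s) * (k - t) - (k - s) * (k + t) * exp (- 2 * k * d)\<bar> \<le>
      \<bar>(k + s) * (k - t)\<bar> + \<bar>(k - s) * (k + t) * exp (- 2 * k * d)\<bar>"
    by (rule abs_triangle_ineq4)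
  also have "\<dots> \<le> 2 * 2 + 2 * 2 * 1"
    unfolding abs_mult using st k d by (intro add_mono mult_mono) auto
  finally have num: "\<bar>(k + s) * (k - t) - (k - s) * (k + t) * exp (- 2 * k * d)\<bar> \<le> 8" by simp
  have "\<bar>jost_kernel \<delta> k y d\<bar> = \<bar>(k + s) * (k - t) - (k - s) * (k + t) * exp (- 2 * k * d)\<bar> / \<bar>2 * k * (1 - k\<^sup>2)\<bar>"
    unfolding jost_kernel_def s_def t_def by (rule abs_divide)
  also have "\<dots> \<le> 8 / (2 * k1 * (1 - k2\<^sup>2))"
    using den num by (intro frac_le) auto
  finally show ?thesis by simp
qed

lemma norm_rayleigh_potential_eq:
  "norm (rayleigh_potential \<delta> c (y + d)) =
    2 * cmod c * (1 / cmod (of_real (tanh (y - \<delta> + d)) - c) * (1 - (tanh (y - \<delta> + d))\<^sup>2))"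
proof -
  have "norm (of_real (1 - (tanh x)\<^sup>2) :: complex) = 1 - (tanh x)\<^sup>2" for x :: real
    using one_minus_tanh_square_pos[of x] by (simp only: norm_of_real abs_of_pos)
  then show ?thesis
    by (simp only: rayleigh_potential_def norm_divide norm_mult norm_numeral add_diff_eq diff_add_eq)
      (simp add: algebra_simps)
qed

lemma continuous_on_jost_kernel:
  assumes "continuous_on A f" "continuous_on A g" "continuous_on A h" "\<And>x. x \<in> A \<Longrightarrow> 0 < f x \<and> f x < 1"
  shows "continuous_on A (\<lambda>x. jost_kernel \<delta> (f x) (g x) (h x))"
proof -
  have "f x \<noteq> 0 \<and> 1 - (f x)\<^sup>2 \<noteq> 0" if "x \<in> A" for x
    using assms(4)[OF that] abs_square_less_1[of "f x"] by auto
  then show ?thesis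
    unfolding jost_kernel_def by (intro continuous_intros assms(1-3)) auto
qed

text \<open>All parameters enter one fixed point problem, so that continuity in (k, r) is obtained
  together with existence. The hypothesis \<open>small\<close> is the contraction condition: it
  bounds the L1 norm of the kernel by 1/2.\<close>

lemma jost_family:
  fixes k1 k2 R \<epsilon> \<delta> :: real
  defines "c \<equiv> \<lambda>r. Complex (\<epsilon> * r) \<epsilon>"
  assumes k: "0 < k1" "k1 \<le> k2" "k2 < 1" and R: "0 < R" and \<epsilon>: "0 < \<epsilon>" "\<epsilon> * R \<le> 1"
    and small: "16 * (1 / (2 * k1 * (1 - k2\<^sup>2))) * (\<epsilon> * (R + 1)) * (2 * arsinh (2 / \<epsilon>)) \<le> 1 / 2"
  obtains m :: "real \<Rightarrow> real \<Rightarrow> real \<Rightarrow> complex" where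
    "continuous_on ({k1..k2} \<times> {-R..R} \<times> {0..}) (\<lambda>(k, r, y). m k r y)"
    "\<And>k r y. k1 \<le> k \<Longrightarrow> k \<le> k2 \<Longrightarrow> \<bar>r\<bar> \<le> R \<Longrightarrow> y \<ge> 0 \<Longrightarrow> norm (m k r y) \<le> 4"
    "\<And>k r y. k1 \<le> k \<Longrightarrow> k \<le> k2 \<Longrightarrow> \<bar>r\<bar> \<le> R \<Longrightarrow> y \<ge> 0 \<Longrightarrow> m k r y = of_real (k + tanh (y - \<delta>)) +
      (LINT d:{0..}|lborel. of_real (jost_kernel \<delta> k y d) * rayleigh_potential \<delta> (c r) (y + d) * m k r (y + d))"
proof -
  define \<alpha> where "\<alpha> = 1 / (2 * k1 * (1 - k2\<^sup>2))"
  have "k2\<^sup>2 < 1" using k by (simp add: abs_square_less_1)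
  then have \<alpha>: "\<alpha> > 0" using k by (auto simp: \<alpha>_def)
  \<comment> \<open>The fixed point lemma works on a whole metric space. Clamping k and r to their
    intervals, and y to the half-line, extends the kernel continuously with the same bounds; on the
    original range nothing changes.\<close>
  define ck where "ck = (\<lambda>k. max k1 (min k2 k))"
  define cr where "cr = (\<lambda>r. max (- R) (min R r))"
  define \<kappa> where "\<kappa> = (\<lambda>(k, r, y) d. complex_of_real (jost_kernel \<delta> (ck k) (max 0 y) d) *
      rayleigh_potential \<delta> (c (cr r)) (max 0 y + d))"
  define \<sigma> where "\<sigma> = (\<lambda>(k :: real, r :: real, y) (d :: real). (k, r, max 0 y + d))"
  define m0 where "m0 = (\<lambda>(k, r :: real, y). complex_of_real (ck k + tanh (max 0 y - \<delta>)))"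
  have ck: "k1 \<le> ck k" "ck k \<le> k2" for k using k by (auto simp: ck_def)
  have cr: "\<bar>cr r\<bar> \<le> R" for r using R by (auto simp: cr_def)
  have Imc: "Im (c r) = \<epsilon>" for r by (simp add: c_def)
  have \<epsilon>r: "\<epsilon> * \<bar>r\<bar> \<le> \<epsilon> * R" if "\<bar>r\<bar> \<le> R" for r
    using that \<epsilon> by (intro mult_left_mono) auto
  have Rec: "\<bar>Re (c r)\<bar> \<le> 1" if "\<bar>r\<bar> \<le> R" for r
    using order_trans[OF \<epsilon>r[OF that] \<epsilon>(2)] \<epsilon>(1) by (simp add: c_def abs_mult)
  have c_le: "cmod (c r) \<le> \<epsilon> * (R + 1)" if "\<bar>r\<bar> \<le> R" for r
  proof -
    have "cmod (c r) \<le> \<bar>\<epsilon> * r\<bar> + \<bar>\<epsilon>\<bar>" using cmod_le[of "c r"] by (simp add: c_def)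
    also have "\<bar>\<epsilon> * r\<bar> = \<epsilon> * \<bar>r\<bar>" using \<epsilon> by (simp add: abs_mult)
    finally show ?thesis using \<epsilon>r[OF that] \<epsilon> unfolding distrib_left by linarith
  qed
  have cont_fst: "continuous_on UNIV (\<lambda>x. \<kappa> x d)" if "d \<ge> 0" for d
  proof -
    have 1: "continuous_on UNIV (\<lambda>x :: real \<times> real \<times> real. jost_kernel \<delta> (ck (fst x)) (max 0 (snd (snd x))) d)"
      using k ck by (intro continuous_on_jost_kernel)
        (auto simp: ck_def intro!: continuous_intros intro: less_le_trans le_less_trans)
    have cc: "continuous_on UNIV (\<lambda>x :: real \<times> real \<times> real. c (cr (fst (snd x))))"
      unfolding c_def Complex_eq cr_def by (intro continuous_intros)
    have ne: "complex_of_real t - c r \<noteq> 0" for t r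
      by (rule of_real_diff_ne_0) (simp add: Imc \<epsilon>)
    have 2: "continuous_on UNIV (\<lambda>x :: real \<times> real \<times> real. rayleigh_potential \<delta> (c (cr (fst (snd x)))) (max 0 (snd (snd x)) + d))"
      unfolding rayleigh_potential_def by (intro continuous_intros cc) (use ne in auto)
    show ?thesis
      unfolding \<kappa>_def case_prod_unfold by (intro continuous_intros 1 2)
  qed
  have cont_snd: "continuous_on {0..} (\<kappa> x)" for x
  proof -
    obtain kk r y where x: "x = (kk, r, y)" by (cases x)
    have "continuous_on {0..} (\<lambda>d. rayleigh_potential \<delta> (c (cr r)) (max 0 y + d))"
      by (rule continuous_on_compose2[OF continuous_on_rayleigh_potential[of _ UNIV]])
        (auto simp: Imc \<epsilon> intro!: continuous_intros)
    moreover have "continuous_on {0..} (\<lambda>d. jost_kernel \<delta> (ck kk) (max 0 y) d)"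
      using k ck[of kk] by (intro continuous_on_jost_kernel continuous_intros) auto
    ultimately show ?thesis by (auto simp: x \<kappa>_def intro!: continuous_intros)
  qed
  \<comment> \<open>Product of the kernel bound 8 \<alpha>, the crude potential bound and the
    exponential majorant of 1 - tanh^2. It is not small; smallness comes from the sharper arsinh
    estimate used for \<open>\<theta>\<close> below.\<close>
  define B where "B = (\<lambda>d. (8 * \<alpha> * (2 * (\<epsilon> * (R + 1)) / \<epsilon> * (4 * exp (2 * \<delta>)))) * exp (- (2 * d)))"
  have B: "set_integrable lborel {0..} B"
    unfolding B_def by (intro set_integrable_mult_right set_integrable_exp_neg) auto
  have \<kappa>_le: "norm (\<kappa> x d) \<le> B d" if "d \<ge> 0" for x d
  proof -
    obtain kk r y where x: "x = (kk, r, y)" by (cases x)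
    have "1 - (tanh (max 0 y + d - \<delta>))\<^sup>2 \<le> 4 * exp (- 2 * (max 0 y + d - \<delta>))"
      by (rule one_minus_tanh_square_le)
    also have "\<dots> \<le> 4 * exp (2 * \<delta> + - (2 * d))"
      by simp
    also have "\<dots> = 4 * exp (2 * \<delta>) * exp (- (2 * d))"
      by (simp only: exp_add mult.assoc)
    finally have sech: "1 - (tanh (max 0 y + d - \<delta>))\<^sup>2 \<le> 4 * exp (2 * \<delta>) * exp (- (2 * d))" .
    have "norm (rayleigh_potential \<delta> (c (cr r)) (max 0 y + d))
        \<le> 2 * cmod (c (cr r)) / \<epsilon> * (1 - (tanh (max 0 y + d - \<delta>))\<^sup>2)"
      using norm_rayleigh_potential_le[of "c (cr r)" \<delta> "max 0 y + d"] \<epsilon> by (simp only: Imc)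
    also have "\<dots> \<le> 2 * (\<epsilon> * (R + 1)) / \<epsilon> * (4 * exp (2 * \<delta>) * exp (- (2 * d)))"
      using sech c_le[OF cr] \<epsilon> R one_minus_tanh_square_pos[of "max 0 y + d - \<delta>"]
      by (intro mult_mono divide_right_mono) auto
    finally have "norm (\<kappa> x d) \<le> 8 * \<alpha> * (2 * (\<epsilon> * (R + 1)) / \<epsilon> * (4 * exp (2 * \<delta>) * exp (- (2 * d))))"
      using jost_kernel_bound[OF k(1) ck k(3) that] \<alpha>
      unfolding x \<kappa>_def case_prod_conv norm_mult norm_of_real \<alpha>_def by (intro mult_mono) auto
    then show ?thesis by (simp add: B_def mult_ac)
  qed
  have \<theta>: "(LINT d:{0..}|lborel. norm (\<kappa> x d)) \<le> 1 / 2" for x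
  proof -
    obtain kk r y where x: "x = (kk, r, y)" by (cases x)
    let ?q = "\<lambda>d. 1 / cmod (of_real (tanh (max 0 y - \<delta> + d)) - c (cr r)) * (1 - (tanh (max 0 y - \<delta> + d))\<^sup>2)"
    note q = integral_inverse_distance[of "c (cr r)" "max 0 y - \<delta>", unfolded Imc, OF \<epsilon>(1) Rec[OF cr]]
    have "(LINT d:{0..}|lborel. norm (\<kappa> x d)) \<le> (LINT d:{0..}|lborel. (8 * \<alpha> * (2 * cmod (c (cr r)))) * ?q d)"
    proof (rule set_integral_mono)
      show "set_integrable lborel {0..} (\<lambda>d. norm (\<kappa> x d))"
        by (rule set_integrable_continuous_bound[OF B]) (auto intro!: continuous_intros cont_snd \<kappa>_le)
      show "set_integrable lborel {0..} (\<lambda>d. (8 * \<alpha> * (2 * cmod (c (cr r)))) * ?q d)"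
        by (intro set_integrable_mult_right q)
      fix d :: real assume d: "d \<in> {0..}"
      have "norm (\<kappa> x d) = \<bar>jost_kernel \<delta> (ck kk) (max 0 y) d\<bar> * (2 * cmod (c (cr r)) * ?q d)"
        unfolding x \<kappa>_def case_prod_conv norm_mult norm_of_real norm_rayleigh_potential_eq by simp
      also have "\<dots> \<le> (8 * \<alpha>) * (2 * cmod (c (cr r)) * ?q d)"
        unfolding \<alpha>_def using jost_kernel_bound[OF k(1) ck k(3)] d
          one_minus_tanh_square_pos[of "max 0 y - \<delta> + d"] by (intro mult_right_mono) auto
      finally show "norm (\<kappa> x d) \<le> (8 * \<alpha> * (2 * cmod (c (cr r)))) * ?q d" by simp
    qed
    also have "\<dots> \<le> (8 * \<alpha> * (2 * cmod (c (cr r)))) * (2 * arsinh (2 / \<epsilon>))"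
      unfolding set_integral_mult_right using \<alpha> q(2) by (intro mult_left_mono) auto
    also have "\<dots> \<le> (8 * \<alpha> * (2 * (\<epsilon> * (R + 1)))) * (2 * arsinh (2 / \<epsilon>))"
      using \<alpha> c_le[OF cr] \<epsilon> by (intro mult_right_mono mult_left_mono) (auto simp: less_imp_le)
    also have "\<dots> \<le> 1 / 2" using small by (simp add: \<alpha>_def mult_ac)
    finally show ?thesis .
  qed
  have m0: "continuous_on UNIV m0" "norm (m0 x) \<le> 2" for x
  proof -
    show "continuous_on UNIV m0"
      unfolding m0_def case_prod_unfold ck_def by (intro continuous_intros) auto
    obtain kk r y where x: "x = (kk, r, y)" by (cases x)
    show "norm (m0 x) \<le> 2"
      using ck[of kk] k abs_tanh_le_1[of "max 0 y - \<delta>"] by (simp add: x m0_def del: of_real_add)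
  qed
  \<comment> \<open>With |m0| \<le> 2 and contraction constant 1/2 the fixed point is bounded by 2 /
    (1 - 1/2) = 4.\<close>
  obtain m where m: "continuous_on UNIV m" "\<And>x. norm (m x) \<le> 2 / (1 - 1 / 2)"
    "\<And>x. m x = m0 x + (LINT d:{0..}|lborel. \<kappa> x d * m (\<sigma> x d))"
  proof -
    have \<sigma>: "continuous_on UNIV (\<lambda>x. \<sigma> x d)" "continuous_on {0..} (\<sigma> x)" for x d
      unfolding \<sigma>_def case_prod_unfold by (auto intro!: continuous_intros)
    have half: "1 / 2 < (1 :: real)" by simp
    show thesis
      by (rule volterra_fixed_point[where \<theta>="1 / 2",
            OF cont_fst \<sigma>(1) cont_snd \<sigma>(2) B \<kappa>_le \<theta> half m0]; (assumption | rule that; assumption))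
  qed
  show thesis
  proof (rule that[of "\<lambda>k r y. m (k, r, y)"])
    show "continuous_on ({k1..k2} \<times> {-R..R} \<times> {0..}) (\<lambda>(k, r, y). m (k, r, y))"
      using continuous_on_subset[OF m(1)] by (simp add: case_prod_unfold)
    show "norm (m (k, r, y)) \<le> 4" for k r y using m(2) by simp
    show "m (k, r, y) = of_real (k + tanh (y - \<delta>)) +
      (LINT d:{0..}|lborel. of_real (jost_kernel \<delta> k y d) * rayleigh_potential \<delta> (c r) (y + d) * m (k, r, (y + d)))"
      if "k1 \<le> k" "k \<le> k2" "\<bar>r\<bar> \<le> R" "y \<ge> 0" for k r y
    proof -
      have "ck k = k" "cr r = r" "max 0 y = y" using that by (auto simp: ck_def cr_def)
      then show ?thesis
        using m(3)[of "(k, r, y)"] by (simp add: m0_def \<kappa>_def \<sigma>_def)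
    qed
  qed
qed

section \<open>The dispersion relation\<close>

lemma abs_exp_minus_diff_le:
  fixes a b :: real
  assumes "a \<ge> 0" "b \<ge> 0"
  shows "\<bar>exp (- a) - exp (- b)\<bar> \<le> min 1 \<bar>a - b\<bar>"
proof -
  have *: "\<bar>exp (- a) - exp (- b)\<bar> \<le> min 1 \<bar>a - b\<bar>" if "0 \<le> a" "a \<le> b" for a b :: real
  proof -
    have "exp (- a) - exp (- b) = exp (- a) * (1 - exp (- (b - a)))"
      by (simp add: right_diff_distrib exp_add[symmetric])
    also have "1 - exp (- (b - a)) \<le> b - a"
      using exp_ge_add_one_self[of "- (b - a)"] by linarith
    then have "exp (- a) * (1 - exp (- (b - a))) \<le> 1 * (b - a)"
      using that by (intro mult_mono) auto
    finally have "exp (- a) - exp (- b) \<le> b - a" by simp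
    moreover have "exp (- b) \<le> exp (- a)" "exp (- a) \<le> 1" "0 < exp (- b)" using that by auto
    ultimately show ?thesis using that by linarith
  qed
  show ?thesis
    using *[of a b] *[of b a] assms by (cases "a \<le> b") (auto simp: abs_minus_commute)
qed

text \<open>For x \<ge> 0 this is the inequality e^(2x) \<ge> 1 + 2x rearranged; oddness does the
  rest.\<close>

lemma abs_tanh_ge: "\<bar>x\<bar> / (1 + \<bar>x\<bar>) \<le> \<bar>tanh (x :: real)\<bar>"
proof -
  have *: "x / (1 + x) \<le> tanh x" if "x \<ge> 0" for x :: real
  proof -
    define e where "e = exp (- 2 * x)"
    have e: "e > 0" by (simp add: e_def)
    have "e * (1 + 2 * x) \<le> e * exp (2 * x)"
      using exp_ge_add_one_self[of "2 * x"] e by (intro mult_left_mono) auto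
    also have "\<dots> = 1" by (simp add: e_def exp_add[symmetric])
    finally have "x * (1 + e) \<le> (1 - e) * (1 + x)" by (simp add: algebra_simps)
    moreover have "tanh x = (1 - e) / (1 + e)"
      by (simp add: tanh_real_altdef e_def)
    ultimately show ?thesis using e that by (simp add: divide_le_eq pos_le_divide_eq mult.commute)
  qed
  show ?thesis
    using *[of "\<bar>x\<bar>"] by (cases "x \<ge> 0") auto
qed

text \<open>Distances in d have to be measured in the variable s = tanh (d - \<delta>), where the
  singular factor 1/(s - c) lives. With x = |d - \<delta>| the left-hand side is at most min 1 (2x),
  and this is at most 4x/(1 + x) in both cases x \<le> 1 and x > 1.\<close>

lemma abs_exp_diff_le_tanh:
  assumes "0 \<le> k" "k \<le> 1" "0 \<le> d" "0 \<le> \<delta>"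
  shows "\<bar>exp (- 2 * k * d) - exp (- 2 * k * \<delta>)\<bar> \<le> 4 * \<bar>tanh (d - \<delta> :: real)\<bar>"
proof -
  let ?x = "\<bar>d - \<delta>\<bar>"
  have "\<bar>exp (- 2 * k * d) - exp (- 2 * k * \<delta>)\<bar> \<le> min 1 \<bar>2 * k * d - 2 * k * \<delta>\<bar>"
    using abs_exp_minus_diff_le[of "2 * k * d" "2 * k * \<delta>"] assms by simp
  also have "2 * k * d - 2 * k * \<delta> = 2 * (k * (d - \<delta>))" by (simp add: algebra_simps)
  also have "\<bar>2 * (k * (d - \<delta>))\<bar> = 2 * (k * ?x)" using assms by (simp add: abs_mult)
  also have "min 1 (2 * (k * ?x)) \<le> min 1 (2 * ?x)"
    using assms mult_right_mono[of k 1 ?x] by (intro min.mono) auto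
  also have "\<dots> \<le> 4 * (?x / (1 + ?x))"
  proof (cases "?x \<le> 1")
    case True
    then have "2 * ?x * (1 + ?x) \<le> 2 * ?x * 2" by (intro mult_left_mono) auto
    then have "2 * ?x \<le> 4 * (?x / (1 + ?x))" by (simp add: pos_le_divide_eq)
    then show ?thesis by linarith
  next
    case False
    then have "1 \<le> 4 * (?x / (1 + ?x))" by (simp add: pos_le_divide_eq)
    then show ?thesis by linarith
  qed
  also have "\<dots> \<le> 4 * \<bar>tanh (d - \<delta>)\<bar>"
    using abs_tanh_ge[of "d - \<delta>"] by simp
  finally show ?thesis .
qed

lemma jost_kernel_lipschitz:
  assumes k: "0 < k" "k < 1" and \<delta>: "0 \<le> \<delta>" and d: "0 \<le> d"
  shows "\<bar>2 * jost_kernel \<delta> k 0 d * (k + tanh (d - \<delta>)) - 2 * jost_kernel \<delta> k 0 \<delta> * k\<bar>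
    \<le> 30 * (1 / (2 * k * (1 - k\<^sup>2))) * \<bar>tanh (d - \<delta>)\<bar>"
proof -
  define A where "A = 1 / (2 * k * (1 - k\<^sup>2))"
  have "k\<^sup>2 < 1" using k by (simp add: abs_square_less_1)
  then have A: "A > 0" using k by (simp add: A_def)
  define s t E E0 where "s = tanh (d - \<delta>)" and "t = tanh \<delta>"
    and "E = exp (- 2 * k * d)" and "E0 = exp (- 2 * k * \<delta>)"
  have E: "0 < E" "E \<le> 1" "\<bar>E - E0\<bar> \<le> 4 * \<bar>s\<bar>"
    using abs_exp_diff_le_tanh[of k d \<delta>] k d \<delta> by (auto simp: E_def E0_def s_def)
  have s: "\<bar>s\<bar> \<le> 1" and t: "0 \<le> t" "t \<le> 1"
    using \<delta> abs_tanh_le_1[of \<delta>] by (auto simp: s_def t_def abs_tanh_le_1)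
  have J: "jost_kernel \<delta> k 0 d = A * ((k - t) * (k - s) - (k + t) * (k + s) * E)"
    "jost_kernel \<delta> k 0 \<delta> = A * ((k - t) * k - (k + t) * k * E0)"
    by (simp_all add: jost_kernel_def A_def s_def t_def E_def E0_def)
  have "2 * jost_kernel \<delta> k 0 d * (k + s) - 2 * jost_kernel \<delta> k 0 \<delta> * k
    = 2 * A * (- ((k - t) * (s * s)) - (k + t) * ((2 * k + s) * s * E + k * k * (E - E0)))"
    unfolding J by (simp add: algebra_simps)
  also have "\<bar>\<dots>\<bar> = 2 * A * \<bar>- ((k - t) * (s * s)) - (k + t) * ((2 * k + s) * s * E + k * k * (E - E0))\<bar>"
    using A by (simp add: abs_mult)
  also have "\<dots> \<le> 2 * A * (15 * \<bar>s\<bar>)"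
  proof (intro mult_left_mono)
    have "\<bar>- ((k - t) * (s * s)) - (k + t) * ((2 * k + s) * s * E + k * k * (E - E0))\<bar>
      \<le> \<bar>k - t\<bar> * (\<bar>s\<bar> * \<bar>s\<bar>) + \<bar>k + t\<bar> * (\<bar>2 * k + s\<bar> * \<bar>s\<bar> * \<bar>E\<bar> + \<bar>k\<bar> * \<bar>k\<bar> * \<bar>E - E0\<bar>)"
      unfolding abs_mult[symmetric]
      by (rule order_trans[OF abs_triangle_ineq4], rule add_mono, simp, unfold abs_mult[of "k + t"],
          intro mult_left_mono order_trans[OF abs_triangle_ineq], auto)
    also have "\<dots> \<le> 1 * (1 * \<bar>s\<bar>) + 2 * (3 * \<bar>s\<bar> * 1 + 1 * 1 * (4 * \<bar>s\<bar>))"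
      using k s t E by (intro add_mono mult_mono mult_nonneg_nonneg add_nonneg_nonneg) auto
    finally show "\<bar>- ((k - t) * (s * s)) - (k + t) * ((2 * k + s) * s * E + k * k * (E - E0))\<bar> \<le> 15 * \<bar>s\<bar>"
      by simp
  qed (use A in auto)
  finally show ?thesis by (simp add: s_def A_def)
qed

lemma set_integral_Re_Im:
  fixes f :: "real \<Rightarrow> complex"
  assumes "set_integrable lborel A f"
  shows "Re (LINT x:A|lborel. f x) = (LINT x:A|lborel. Re (f x))"
    and "Im (LINT x:A|lborel. f x) = (LINT x:A|lborel. Im (f x))"
  using integral_bounded_linear[OF bounded_linear_Re assms[unfolded set_integrable_def]]
    integral_bounded_linear[OF bounded_linear_Im assms[unfolded set_integrable_def]]
  by (simp_all add: set_lebesgue_integral_def)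

text \<open>\<open>J\<close> is the integral of \<open>(1 - s\<^sup>2)/(s - c)\<close> over the half-line, with \<open>s\<close> as new variable. As \<open>c\<close>
  tends to \<open>0\<close> from above its imaginary part tends to \<open>\<pi>\<close>: the critical layer at \<open>y = \<delta>\<close> contributes
  half a residue, and this is what moves the neutral mode off the real axis.\<close>

lemma dispersion_estimate:
  fixes \<delta> k k1 k2 :: real and c :: complex and m :: "real \<Rightarrow> complex"
  defines "\<alpha> \<equiv> 1 / (2 * k1 * (1 - k2\<^sup>2))" and "K \<equiv> 2 * arsinh (2 / Im c)"
    and "h0 \<equiv> 2 * jost_kernel \<delta> k 0 \<delta> * k"
    and "J \<equiv> Complex ((ln ((1 - Re c)\<^sup>2 + (Im c)\<^sup>2) - ln ((tanh \<delta> + Re c)\<^sup>2 + (Im c)\<^sup>2)) / 2)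
      (arctan ((1 - Re c) / Im c) + arctan ((tanh \<delta> + Re c) / Im c))"
  assumes \<delta>: "\<delta> > 0" and k: "0 < k1" "k1 \<le> k" "k \<le> k2" "k2 < 1"
    and c: "Im c > 0" "\<bar>Re c\<bar> \<le> 1"
    and m_cont: "continuous_on {0..} m" and m_le: "\<And>y. y \<ge> 0 \<Longrightarrow> norm (m y) \<le> 4"
    and m_eq: "\<And>y. y \<ge> 0 \<Longrightarrow> m y = of_real (k + tanh (y - \<delta>)) +
      (LINT d:{0..}|lborel. of_real (jost_kernel \<delta> k y d) * rayleigh_potential \<delta> c (y + d) * m (y + d))"
  obtains w where "m 0 = of_real (k - tanh \<delta>) + c * w"
    "cmod (w - of_real h0 * J) \<le> 30 * \<alpha> * (2 + cmod c * K) + 1024 * \<alpha>\<^sup>2 * (cmod c * K\<^sup>2)"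
    "\<bar>Im (w - of_real h0 * J)\<bar> \<le> 30 * \<alpha> * (Im c * K + cmod c * pi) + 1024 * \<alpha>\<^sup>2 * (cmod c * K\<^sup>2)"
proof -
  define s where "s = (\<lambda>d. tanh (- \<delta> + d))"
  define S where "S = (\<lambda>d. 1 - (s d)\<^sup>2)"
  define q where "q = (\<lambda>d. 1 / cmod (of_real (s d) - c) * S d)"
  define \<rho> where "\<rho> = (\<lambda>d. 1 / (of_real (s d) - c) * of_real (S d))"
  define N where "N = jost_kernel \<delta> k 0"
  define h where "h = (\<lambda>d. 2 * N d * (k + s d))"
  define e where "e = (\<lambda>d. m d - of_real (k + s d))"
  have k01: "0 < k" "k < 1" using k by auto
  have k2: "k\<^sup>2 \<le> k2\<^sup>2" "k2\<^sup>2 < 1" "k\<^sup>2 < 1"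
    using k by (auto simp: power_mono abs_square_less_1)
  have \<alpha>: "\<alpha> > 0" and A: "1 / (2 * k * (1 - k\<^sup>2)) \<le> \<alpha>"
    unfolding \<alpha>_def using k k2 by (auto intro!: divide_left_mono mult_mono mult_pos_pos)
  have s1: "\<bar>s d\<bar> \<le> 1" for d by (simp add: s_def abs_tanh_le_1)
  have S0: "S d > 0" for d using one_minus_tanh_square_pos[of "- \<delta> + d"] by (simp add: S_def s_def)
  have ne: "of_real (s d) - c \<noteq> 0" for d by (rule of_real_diff_ne_0[OF c(1)])
  have q0: "q d \<ge> 0" for d using S0[of d] by (simp add: q_def)
  have q: "set_integrable lborel {0..} q" "(LINT d:{0..}|lborel. q d) \<le> K"
    unfolding q_def S_def s_def K_def using integral_inverse_distance[OF c, of "- \<delta>"] by auto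
  have K0: "K \<ge> 0" using c(1) by (simp add: K_def less_imp_le)
  have norm_\<rho>: "norm (\<rho> d) = q d" for d
    using S0[of d] by (simp add: \<rho>_def q_def norm_mult norm_divide)
  have cont_s: "continuous_on T s" for T unfolding s_def by (intro continuous_intros) auto
  have cont_\<rho>: "continuous_on T \<rho>" for T
    unfolding \<rho>_def S_def by (intro continuous_intros cont_s) (use ne in auto)
  have cont_N: "continuous_on {0..} N"
    unfolding N_def using k01 by (intro continuous_on_jost_kernel continuous_intros) auto
  have cont_h: "continuous_on {0..} h" unfolding h_def by (intro continuous_intros cont_N cont_s)
  have cont_e: "continuous_on {0..} e" unfolding e_def by (intro continuous_intros m_cont cont_s)
  have N_le: "\<bar>jost_kernel \<delta> k y d\<bar> \<le> 8 * \<alpha>" if "d \<ge> 0" for y d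
    using jost_kernel_bound[OF k that] by (simp add: \<alpha>_def)
  have pot: "rayleigh_potential \<delta> c d = 2 * c * \<rho> d" for d
    by (simp add: rayleigh_potential_def \<rho>_def S_def s_def)
  \<comment> \<open>64 = 8 * 2 * 4 from the kernel bound, the factor 2 in the potential and the
    bound on \<open>m\<close>.\<close>
  have e_le: "norm (e y) \<le> 64 * \<alpha> * cmod c * K" if "y \<ge> 0" for y
  proof -
    have "e y = (LINT d:{0..}|lborel. of_real (jost_kernel \<delta> k y d) * rayleigh_potential \<delta> c (y + d) * m (y + d))"
      unfolding e_def by (subst m_eq[OF that]) (simp add: s_def)
    also have "norm \<dots> \<le> 64 * \<alpha> * cmod c * K"
    proof (rule set_integral_norm_le(2))
      note q' = integral_inverse_distance[OF c, of "y - \<delta>"]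
      let ?q = "\<lambda>d. 1 / cmod (of_real (tanh (y - \<delta> + d)) - c) * (1 - (tanh (y - \<delta> + d))\<^sup>2)"
      show "set_integrable lborel {0..} (\<lambda>d. 64 * \<alpha> * cmod c * ?q d)"
        by (intro set_integrable_mult_right q')
      show "(LINT d:{0..}|lborel. 64 * \<alpha> * cmod c * ?q d) \<le> 64 * \<alpha> * cmod c * K"
        unfolding set_integral_mult_right K_def using q'(2) \<alpha> by (intro mult_left_mono) auto
      show "continuous_on {0..} (\<lambda>d. of_real (jost_kernel \<delta> k y d) * rayleigh_potential \<delta> c (y + d) * m (y + d))"
        using k01 that
        by (intro continuous_intros continuous_on_jost_kernel continuous_on_compose2[OF m_cont]
            continuous_on_compose2[OF continuous_on_rayleigh_potential[OF c(1), of UNIV]]) auto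
      fix d :: real assume d: "0 \<le> d"
      have "norm (of_real (jost_kernel \<delta> k y d) * rayleigh_potential \<delta> c (y + d) * m (y + d))
        = \<bar>jost_kernel \<delta> k y d\<bar> * (2 * cmod c * ?q d) * norm (m (y + d))"
        unfolding norm_mult norm_of_real norm_rayleigh_potential_eq ..
      also have "\<dots> \<le> (8 * \<alpha>) * (2 * cmod c * ?q d) * 4"
        using \<alpha> d that one_minus_tanh_square_pos[of "y - \<delta> + d"]
        by (intro mult_mono N_le m_le mult_nonneg_nonneg) auto
      finally show "norm (of_real (jost_kernel \<delta> k y d) * rayleigh_potential \<delta> c (y + d) * m (y + d))
        \<le> 64 * \<alpha> * cmod c * ?q d" by simp
    qed
    finally show ?thesis .
  qed
  have h_le: "\<bar>h d - h0\<bar> \<le> 30 * \<alpha> * \<bar>s d\<bar>" if "d \<ge> 0" for d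
  proof -
    have "\<bar>h d - h0\<bar> \<le> 30 * (1 / (2 * k * (1 - k\<^sup>2))) * \<bar>s d\<bar>"
      using jost_kernel_lipschitz[OF k01 _ that, of \<delta>] \<delta> by (simp add: h_def h0_def N_def s_def)
    also have "\<dots> \<le> 30 * \<alpha> * \<bar>s d\<bar>" using A by (intro mult_right_mono mult_left_mono) auto
    finally show ?thesis .
  qed
  have s_le: "\<bar>s d\<bar> \<le> cmod (of_real (s d) - c) + cmod c" for d
    using norm_triangle_ineq[of "of_real (s d) - c" c] by simp
  have \<rho>_int: "set_integrable lborel {0..} \<rho>"
    by (rule set_integral_norm_le[OF q(1) cont_\<rho> _ q(2)]) (simp add: norm_\<rho>)
  have J: "(LINT d:{0..}|lborel. \<rho> d) = J"
  proof (rule complex_eqI)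
    have "Re (z * of_real r) = Re z * r" "Im (z * of_real r) = Im z * r" for z r by simp_all
    then have Re_\<rho>: "Re (\<rho> d) = Re (1 / (of_real (tanh (- \<delta> + d)) - c)) * (1 - (tanh (- \<delta> + d))\<^sup>2)"
      and Im_\<rho>: "Im (\<rho> d) = Im (1 / (of_real (tanh (- \<delta> + d)) - c)) * (1 - (tanh (- \<delta> + d))\<^sup>2)" for d
      unfolding \<rho>_def S_def s_def by blast+
    show "Re (LINT d:{0..}|lborel. \<rho> d) = Re J"
      unfolding set_integral_Re_Im[OF \<rho>_int] J_def Re_\<rho> integral_Re_inverse(2)[OF c(1)]
      by (simp add: power2_commute[of "- tanh \<delta>"] add.commute)
    have "arctan ((- tanh \<delta> - Re c) / Im c) = - arctan ((tanh \<delta> + Re c) / Im c)"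
      unfolding arctan_minus[symmetric] by (simp add: minus_divide_left)
    then show "Im (LINT d:{0..}|lborel. \<rho> d) = Im J"
      unfolding set_integral_Re_Im[OF \<rho>_int] J_def Im_\<rho> integral_Im_inverse(2)[OF c(1)] by simp
  qed
  define W2 where "W2 = (LINT d:{0..}|lborel. of_real (h d - h0) * \<rho> d)"
  define W3 where "W3 = (LINT d:{0..}|lborel. of_real (2 * N d) * \<rho> d * e d)"
  have cont_W2: "continuous_on {0..} (\<lambda>d. of_real (h d - h0) * \<rho> d)"
    by (intro continuous_intros cont_h cont_\<rho>)
  have cont_W3: "continuous_on {0..} (\<lambda>d. of_real (2 * N d) * \<rho> d * e d)"
    by (intro continuous_intros cont_N cont_\<rho> cont_e)
  have W2: "set_integrable lborel {0..} (\<lambda>d. of_real (h d - h0) * \<rho> d)" "norm W2 \<le> 30 * \<alpha> * (2 + cmod c * K)"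
  proof -
    have int: "set_integrable lborel {0..} (\<lambda>d. 30 * \<alpha> * (S d + cmod c * q d))"
      "(LINT d:{0..}|lborel. 30 * \<alpha> * (S d + cmod c * q d)) \<le> 30 * \<alpha> * (2 + cmod c * K)"
    proof -
      have S: "set_integrable lborel {0..} S" "(LINT d:{0..}|lborel. S d) \<le> 2"
        unfolding S_def s_def
        using set_integrable_one_minus_tanh_square[of "- \<delta>"] abs_tanh_le_1[of "- \<delta>"] by auto
      note cq = set_integrable_mult_right[OF q(1), of "cmod c"]
      show "set_integrable lborel {0..} (\<lambda>d. 30 * \<alpha> * (S d + cmod c * q d))"
        by (intro set_integrable_mult_right set_integral_add S cq)
      show "(LINT d:{0..}|lborel. 30 * \<alpha> * (S d + cmod c * q d)) \<le> 30 * \<alpha> * (2 + cmod c * K)"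
        unfolding set_integral_mult_right set_integral_add(2)[OF S(1) cq]
        using \<alpha> S(2) q(2) by (intro mult_left_mono add_mono) auto
    qed
    \<comment> \<open>The factor |s| from the Lipschitz bound is split as |s - c| + |c|. The first
      part cancels the denominator and leaves the weight S of total mass at most 2; the second is
      paid for with the logarithm \<open>K\<close>.\<close>
    have "norm (of_real (h d - h0) * \<rho> d) \<le> 30 * \<alpha> * (S d + cmod c * q d)" if "d \<ge> 0" for d
    proof -
      have "norm (of_real (h d - h0) * \<rho> d) = \<bar>h d - h0\<bar> * q d"
        unfolding norm_mult norm_\<rho> norm_of_real ..
      also have "\<dots> \<le> (30 * \<alpha> * (cmod (of_real (s d) - c) + cmod c)) * q d"
        using h_le[OF that] s_le[of d] \<alpha> q0 by (intro mult_right_mono) (auto intro: order_trans)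
      also have "cmod (of_real (s d) - c) * q d = S d" using ne[of d] by (simp add: q_def)
      then have "(30 * \<alpha> * (cmod (of_real (s d) - c) + cmod c)) * q d = 30 * \<alpha> * (S d + cmod c * q d)"
        by (simp add: algebra_simps)
      finally show ?thesis .
    qed
    from set_integral_norm_le[OF int(1) cont_W2 this int(2)]
    show "set_integrable lborel {0..} (\<lambda>d. of_real (h d - h0) * \<rho> d)" "norm W2 \<le> 30 * \<alpha> * (2 + cmod c * K)"
      unfolding W2_def by blast+
  qed
  \<comment> \<open>\<open>W2\<close> is bounded but does not tend to 0, which would spoil the sign
    of Im w; its imaginary part does tend to 0. Because h - h0 is real, only Im
    \<open>\<rho>\<close> matters. This is a Poisson kernel of mass at most \<pi>, and multiplied by
    |s - c| it becomes Im c times \<open>q\<close>.\<close>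
  have Im_W2: "\<bar>Im W2\<bar> \<le> 30 * \<alpha> * (Im c * K + cmod c * pi)"
  proof -
    define p where "p = (\<lambda>d. Im (1 / (of_real (s d) - c)) * S d)"
    have p: "set_integrable lborel {0..} p" "(LINT d:{0..}|lborel. p d) \<le> pi"
      unfolding p_def S_def s_def
      using integral_Im_inverse[OF c(1), of "- \<delta>"] arctan_ubound[of "(1 - Re c) / Im c"]
        arctan_lbound[of "(tanh (- \<delta>) - Re c) / Im c"] by auto
    have p_eq: "p d * cmod (of_real (s d) - c) = Im c * q d" for d
    proof -
      have "Im (1 / (of_real (s d) - c)) = Im c / (cmod (of_real (s d) - c))\<^sup>2"
        by (simp add: inverse_of_real_diff cmod_power2)
      then show ?thesis using ne[of d] by (simp add: p_def q_def power2_eq_square)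
    qed
    have p0: "p d \<ge> 0" for d
      using S0[of d] c(1) by (simp add: p_def inverse_of_real_diff)
    have int: "set_integrable lborel {0..} (\<lambda>d. 30 * \<alpha> * (Im c * q d + cmod c * p d))"
      "(LINT d:{0..}|lborel. 30 * \<alpha> * (Im c * q d + cmod c * p d)) \<le> 30 * \<alpha> * (Im c * K + cmod c * pi)"
    proof -
      note * = set_integrable_mult_right[OF q(1), of "Im c"] set_integrable_mult_right[OF p(1), of "cmod c"]
      show "set_integrable lborel {0..} (\<lambda>d. 30 * \<alpha> * (Im c * q d + cmod c * p d))"
        by (intro set_integrable_mult_right set_integral_add *)
      show "(LINT d:{0..}|lborel. 30 * \<alpha> * (Im c * q d + cmod c * p d)) \<le> 30 * \<alpha> * (Im c * K + cmod c * pi)"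
        unfolding set_integral_mult_right set_integral_add(2)[OF *]
        using \<alpha> p(2) q(2) c by (intro mult_left_mono add_mono) auto
    qed
    have "norm (Im (of_real (h d - h0) * \<rho> d)) \<le> 30 * \<alpha> * (Im c * q d + cmod c * p d)" if "d \<ge> 0" for d
    proof -
      have "Im (of_real x * (z * of_real r)) = x * (Im z * r)" for x z r by simp
      then have "Im (of_real (h d - h0) * \<rho> d) = (h d - h0) * p d"
        unfolding \<rho>_def p_def by blast
      then have "norm (Im (of_real (h d - h0) * \<rho> d)) = \<bar>h d - h0\<bar> * p d"
        using p0[of d] by (simp only: real_norm_def abs_mult abs_of_nonneg)
      also have "\<dots> \<le> (30 * \<alpha> * (cmod (of_real (s d) - c) + cmod c)) * p d"
        using h_le[OF that] s_le[of d] \<alpha> p0 by (intro mult_right_mono) (auto intro: order_trans)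
      also have "\<dots> = 30 * \<alpha> * (Im c * q d + cmod c * p d)"
        using p_eq[of d] by (simp add: algebra_simps)
      finally show ?thesis .
    qed
    from set_integral_norm_le(2)[OF int(1) continuous_on_Im[OF cont_W2] this int(2)]
    show ?thesis
      unfolding W2_def set_integral_Re_Im(2)[OF W2(1)] by simp
  qed
  have W3: "set_integrable lborel {0..} (\<lambda>d. of_real (2 * N d) * \<rho> d * e d)"
    "norm W3 \<le> 1024 * \<alpha>\<^sup>2 * (cmod c * K\<^sup>2)"
  proof -
    define X where "X = 64 * \<alpha> * cmod c * K"
    have X: "X \<ge> 0" using \<alpha> K0 by (simp add: X_def)
    have int: "set_integrable lborel {0..} (\<lambda>d. 16 * \<alpha> * X * q d)"
      "(LINT d:{0..}|lborel. 16 * \<alpha> * X * q d) \<le> 16 * \<alpha> * X * K"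
      unfolding set_integral_mult_right using q \<alpha> X by (auto intro!: mult_left_mono)
    have "norm (of_real (2 * N d) * \<rho> d * e d) \<le> 16 * \<alpha> * X * q d" if "d \<ge> 0" for d
    proof -
      have "norm (of_real (2 * N d) * \<rho> d * e d) = (2 * \<bar>N d\<bar>) * q d * norm (e d)"
        by (simp add: norm_mult norm_\<rho>)
      also have "\<dots> \<le> (2 * (8 * \<alpha>)) * q d * X"
        unfolding N_def X_def using N_le[OF that] e_le[OF that] q0 \<alpha> by (intro mult_mono) auto
      finally show ?thesis by (simp add: mult_ac)
    qed
    from set_integral_norm_le[OF int(1) cont_W3 this int(2)]
    have "set_integrable lborel {0..} (\<lambda>d. of_real (2 * N d) * \<rho> d * e d)" "norm W3 \<le> 16 * \<alpha> * X * K"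
      unfolding W3_def by blast+
    then show "set_integrable lborel {0..} (\<lambda>d. of_real (2 * N d) * \<rho> d * e d)"
      "norm W3 \<le> 1024 * \<alpha>\<^sup>2 * (cmod c * K\<^sup>2)"
      by (auto simp: X_def power2_eq_square mult_ac)
  qed
  define w where "w = of_real h0 * J + W2 + W3"
  have "m 0 = of_real (k - tanh \<delta>) + (LINT d:{0..}|lborel. of_real (N d) * rayleigh_potential \<delta> c d * m d)"
    using m_eq[of 0] by (simp add: N_def)
  also have "(LINT d:{0..}|lborel. of_real (N d) * rayleigh_potential \<delta> c d * m d) = c * w"
  proof -
    have pt: "of_real (N d) * rayleigh_potential \<delta> c d * m d
      = c * ((of_real h0 * \<rho> d + of_real (h d - h0) * \<rho> d) + of_real (2 * N d) * \<rho> d * e d)" for d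
      by (simp add: pot h_def e_def algebra_simps)
    note h\<rho> = set_integrable_mult_right[OF \<rho>_int, of "of_real h0"]
    show ?thesis
      unfolding pt set_integral_mult_right set_integral_add(2)[OF set_integral_add(1)[OF h\<rho> W2(1)] W3(1)]
        set_integral_add(2)[OF h\<rho> W2(1)]
      by (simp add: w_def W2_def W3_def J)
  qed
  finally show thesis
  proof (rule that)
    have eq: "w - of_real h0 * J = W2 + W3" by (simp add: w_def)
    show "cmod (w - of_real h0 * J) \<le> 30 * \<alpha> * (2 + cmod c * K) + 1024 * \<alpha>\<^sup>2 * (cmod c * K\<^sup>2)"
      unfolding eq by (intro norm_triangle_mono W2 W3)
    have "\<bar>Im W3\<bar> \<le> 1024 * \<alpha>\<^sup>2 * (cmod c * K\<^sup>2)"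
      using W3(2) abs_Im_le_cmod[of W3] by linarith
    then show "\<bar>Im (w - of_real h0 * J)\<bar> \<le> 30 * \<alpha> * (Im c * K + cmod c * pi) + 1024 * \<alpha>\<^sup>2 * (cmod c * K\<^sup>2)"
      unfolding eq using Im_W2 by simp
  qed
qed

section \<open>Sign of the leading coefficient and location of the zero\<close>

lemma abs_ln_le:
  assumes "0 < l" "l \<le> x" "x \<le> u"
  shows "\<bar>ln x\<bar> \<le> \<bar>ln l\<bar> + \<bar>ln (u :: real)\<bar>"
proof -
  have "ln l \<le> ln x" "ln x \<le> ln u" using assms by auto
  then show ?thesis by linarith
qed

text \<open>At d = \<delta> the expression reduces to -k/(1 - k^2) times ((k + \<tau>)
  e^(-2k\<delta>) - (k - \<tau>)). The upper limit on k makes the second term at most half of the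
  lower bound \<tau> e^(-2\<delta>) for the first, and the lower limit bounds the prefactor by
  \<tau>/2. This fixes the sign of Im w, hence the direction in which the mode leaves the real
  axis.\<close>

lemma jost_kernel_at_inflection:
  assumes k: "0 < k" "k < 1" and \<tau>: "\<tau> = tanh \<delta>" "0 < \<delta>" "\<tau> / 2 \<le> k" "k \<le> \<tau> + \<tau> * exp (- 2 * \<delta>) / 2"
  shows "2 * jost_kernel \<delta> k 0 \<delta> * k \<le> - (\<tau>\<^sup>2 * exp (- 2 * \<delta>) / 4)"
proof -
  let ?E = "exp (- 2 * k * \<delta>)" and ?E1 = "exp (- 2 * \<delta>)"
  have \<tau>0: "0 < \<tau>" using \<tau> by simp
  have k2: "0 < 1 - k\<^sup>2" "1 - k\<^sup>2 \<le> 1" using k by (auto simp: abs_square_less_1)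
  have "?E1 \<le> ?E" using k \<tau>(2) by simp
  then have "\<tau> * ?E1 \<le> (k + \<tau>) * ?E" using k \<tau>0 by (intro mult_mono) auto
  with \<tau>(4) have br: "\<tau> * ?E1 / 2 \<le> (k + \<tau>) * ?E - (k - \<tau>)" by linarith
  have "\<tau> / 2 \<le> k / (1 - k\<^sup>2)"
  proof -
    have "\<tau> / 2 * (1 - k\<^sup>2) \<le> k * 1" using k k2 \<tau>(3) by (intro mult_mono) auto
    then show ?thesis using k2 by (simp add: pos_le_divide_eq)
  qed
  then have "(\<tau> / 2) * (\<tau> * ?E1 / 2) \<le> k / (1 - k\<^sup>2) * ((k + \<tau>) * ?E - (k - \<tau>))"
    using br k k2 \<tau>0 by (intro mult_mono) auto
  moreover have "2 * jost_kernel \<delta> k 0 \<delta> * k = - (k / (1 - k\<^sup>2) * ((k + \<tau>) * ?E - (k - \<tau>)))"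
    using k k2 by (simp add: jost_kernel_def \<tau>(1) field_simps)
  ultimately show ?thesis by (simp add: power2_eq_square)
qed

text \<open>The constants are fixed in the order \<open>\<eta>\<close>, \<open>\<alpha>\<close>, \<open>M\<close>, \<open>b\<close>, \<open>R\<close>, \<open>\<epsilon>\<close>. In particular the bound \<open>M\<close> on
  the real part of \<open>w\<close> does not depend on \<open>R\<close>, so that \<open>R = M / b\<^sub>0\<close> is admissible.\<close>

lemma exists_unstable_jost_solution:
  assumes \<delta>: "\<delta> > 0"
  obtains k c m where "0 < k" "k < 1" "Im c > 0" "continuous_on {0..} m" "m 0 = 0"
    "\<And>y. y \<ge> 0 \<Longrightarrow> norm (m y) \<le> 4"
    "\<And>y. y \<ge> 0 \<Longrightarrow> m y = of_real (k + tanh (y - \<delta>)) +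
      (LINT d:{0..}|lborel. of_real (jost_kernel \<delta> k y d) * rayleigh_potential \<delta> c (y + d) * m (y + d))"
proof -
  define \<tau> where "\<tau> = tanh \<delta>"
  have \<tau>: "0 < \<tau>" "\<tau> < 1" using \<delta> tanh_real_bounds[of \<delta>] by (auto simp: \<tau>_def)
  \<comment> \<open>Half-width of the window around the neutral wave number. The first two terms
    keep the window inside (0, 1); the third is the condition under which \<open>h0\<close> is
    negative.\<close>
  define \<eta> where "\<eta> = min (min (\<tau> / 2) ((1 - \<tau>) / 2)) (\<tau> * exp (- 2 * \<delta>) / 2)"
  have \<eta>: "0 < \<eta>" "\<eta> \<le> \<tau> / 2" "\<eta> \<le> (1 - \<tau>) / 2" "\<eta> \<le> \<tau> * exp (- 2 * \<delta>) / 2"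
    unfolding \<eta>_def using \<tau> by (auto simp only: min_less_iff_conj min_le_iff_disj) auto
  define k1 k2 where "k1 = \<tau> - \<eta>" and "k2 = \<tau> + \<eta>"
  have k12: "0 < k1" "k1 \<le> k2" "k2 < 1" "\<tau> / 2 \<le> k1" using \<eta> \<tau> by (auto simp: k1_def k2_def)
  define \<alpha> where "\<alpha> = 1 / (2 * k1 * (1 - k2\<^sup>2))"
  have "k2\<^sup>2 < 1" using k12 by (simp add: abs_square_less_1)
  then have \<alpha>: "\<alpha> > 0" using k12 by (auto simp: \<alpha>_def)
  define b0 where "b0 = \<tau>\<^sup>2 * exp (- 2 * \<delta>) / 4"
  have b0: "b0 > 0" using \<tau> by (simp add: b0_def)
  \<comment> \<open>\<open>MJ\<close> bounds |Re J|: the two squared moduli in the logarithms stay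
    in [1/4, 4] and [\<tau>^2/4, 4]. In \<open>M\<close>, 16 \<alpha> bounds |h0|, and 90 \<alpha> +
    1 bounds the remainder once |c| K \<le> 1.\<close>
  define MJ where "MJ = \<bar>ln (1 / 4)\<bar> + \<bar>ln (\<tau>\<^sup>2 / 4)\<bar> + 2 * \<bar>ln 4\<bar>"
  define M where "M = 16 * \<alpha> * MJ + 90 * \<alpha> + 1"
  have "MJ \<ge> 0" unfolding MJ_def by (intro add_nonneg_nonneg) auto
  then have M: "M > 0" using \<alpha> unfolding M_def by (intro add_nonneg_pos add_nonneg_nonneg) auto
  \<comment> \<open>Bound for -Im w: |h0| Im J is at most 16 \<alpha> \<pi>, and \<open>b0\<close>
    absorbs the remainder, which will be at most b0 / 2.\<close>
  define b where "b = 16 * \<alpha> * pi + b0"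
  have b: "b > 0" "b0 \<le> b" using \<alpha> b0 by (auto simp: b_def intro!: add_pos_pos)
  define R where "R = M / b0"
  have R: "R > 0" using M b0 by (simp add: R_def)
  define K where "K = (\<lambda>\<epsilon> :: real. 2 * arsinh (2 / \<epsilon>))"
  have lim: "((\<lambda>\<epsilon>. \<epsilon> * K \<epsilon>) \<longlongrightarrow> 0) (at_right 0)" "((\<lambda>\<epsilon>. \<epsilon> * (K \<epsilon>)\<^sup>2) \<longlongrightarrow> 0) (at_right 0)"
    "((\<lambda>\<epsilon>. \<epsilon>) \<longlongrightarrow> 0) (at_right (0::real))"
    unfolding K_def arsinh_real_def by real_asymp+
  have small: "\<forall>\<^sub>F \<epsilon> in at_right 0. C1 * (\<epsilon> * K \<epsilon>) + C2 * (\<epsilon> * (K \<epsilon>)\<^sup>2) + C3 * \<epsilon> < C" if "0 < C" for C1 C2 C3 C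
  proof -
    have "((\<lambda>\<epsilon>. C1 * (\<epsilon> * K \<epsilon>) + C2 * (\<epsilon> * (K \<epsilon>)\<^sup>2) + C3 * \<epsilon>) \<longlongrightarrow> C1 * 0 + C2 * 0 + C3 * 0) (at_right 0)"
      by (intro tendsto_intros lim)
    then show ?thesis using that by (intro order_tendstoD) auto
  qed
  \<comment> \<open>After positivity these are: the contraction condition; two conditions keeping c
    away from the ends -\<tau> and 1 of the range of s; the imaginary remainder of w; two conditions
    for its full remainder; and the room that k has in its window. All follow because \<epsilon>
    beats both the logarithm and its square.\<close>
  have "\<forall>\<^sub>F \<epsilon> in at_right 0. 0 < \<epsilon> \<and> 16 * \<alpha> * (\<epsilon> * (R + 1)) * K \<epsilon> < 1 / 2 \<and> \<epsilon> * R < \<tau> / 2 \<and> \<epsilon> < \<tau> / 2 \<and>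
      30 * \<alpha> * (\<epsilon> * K \<epsilon> + \<epsilon> * (R + 1) * pi) + 1024 * \<alpha>\<^sup>2 * (\<epsilon> * (R + 1) * (K \<epsilon>)\<^sup>2) < b0 / 2 \<and>
      \<epsilon> * (R + 1) * K \<epsilon> < 1 \<and> 1024 * \<alpha>\<^sup>2 * (\<epsilon> * (R + 1) * (K \<epsilon>)\<^sup>2) < 1 \<and> \<epsilon> * (R + 1) * (M + b) < \<eta>"
  proof (intro eventually_conj)
    show "\<forall>\<^sub>F \<epsilon> in at_right 0. 0 < (\<epsilon> :: real)" by (rule eventually_at_right_less)
    show "\<forall>\<^sub>F \<epsilon> in at_right 0. 16 * \<alpha> * (\<epsilon> * (R + 1)) * K \<epsilon> < 1 / 2"
      using small[of "1 / 2" "16 * \<alpha> * (R + 1)" 0 0] by (simp add: mult_ac)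
    show "\<forall>\<^sub>F \<epsilon> in at_right 0. \<epsilon> * R < \<tau> / 2"
      using small[of "\<tau> / 2" 0 0 R] \<tau> by (simp add: mult_ac)
    show "\<forall>\<^sub>F \<epsilon> in at_right 0. \<epsilon> < \<tau> / 2"
      using small[of "\<tau> / 2" 0 0 1] \<tau> by simp
    show "\<forall>\<^sub>F \<epsilon> in at_right 0. 30 * \<alpha> * (\<epsilon> * K \<epsilon> + \<epsilon> * (R + 1) * pi) + 1024 * \<alpha>\<^sup>2 * (\<epsilon> * (R + 1) * (K \<epsilon>)\<^sup>2) < b0 / 2"
      using small[of "b0 / 2" "30 * \<alpha>" "1024 * \<alpha>\<^sup>2 * (R + 1)" "30 * \<alpha> * (R + 1) * pi"] b0
      by (simp add: algebra_simps)
    show "\<forall>\<^sub>F \<epsilon> in at_right 0. \<epsilon> * (R + 1) * K \<epsilon> < 1"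
      using small[of 1 "R + 1" 0 0] by (simp add: mult_ac)
    show "\<forall>\<^sub>F \<epsilon> in at_right 0. 1024 * \<alpha>\<^sup>2 * (\<epsilon> * (R + 1) * (K \<epsilon>)\<^sup>2) < 1"
      using small[of 1 0 "1024 * \<alpha>\<^sup>2 * (R + 1)" 0] by (simp add: mult_ac)
    show "\<forall>\<^sub>F \<epsilon> in at_right 0. \<epsilon> * (R + 1) * (M + b) < \<eta>"
      using small[of \<eta> 0 0 "(R + 1) * (M + b)"] \<eta> by (simp add: mult_ac)
  qed
  then obtain \<epsilon> where \<epsilon>: "0 < \<epsilon>" "16 * \<alpha> * (\<epsilon> * (R + 1)) * K \<epsilon> < 1 / 2" "\<epsilon> * R < \<tau> / 2" "\<epsilon> < \<tau> / 2"
      "30 * \<alpha> * (\<epsilon> * K \<epsilon> + \<epsilon> * (R + 1) * pi) + 1024 * \<alpha>\<^sup>2 * (\<epsilon> * (R + 1) * (K \<epsilon>)\<^sup>2) < b0 / 2"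
      "\<epsilon> * (R + 1) * K \<epsilon> < 1" "1024 * \<alpha>\<^sup>2 * (\<epsilon> * (R + 1) * (K \<epsilon>)\<^sup>2) < 1" "\<epsilon> * (R + 1) * (M + b) < \<eta>"
    using eventually_happens'[OF trivial_limit_at_right_real] by blast
  have K0: "K \<epsilon> \<ge> 0" using \<epsilon>(1) by (simp add: K_def less_imp_le)
  have "\<epsilon> * R \<le> 1" "16 * (1 / (2 * k1 * (1 - k2\<^sup>2))) * (\<epsilon> * (R + 1)) * (2 * arsinh (2 / \<epsilon>)) \<le> 1 / 2"
    using \<epsilon>(2,3) \<tau> by (auto simp: \<alpha>_def K_def)
  from jost_family[OF k12(1-3) R \<epsilon>(1) this, of \<delta>]
  obtain m :: "real \<Rightarrow> real \<Rightarrow> real \<Rightarrow> complex" where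
    m_cont: "continuous_on ({k1..k2} \<times> {-R..R} \<times> {0..}) (\<lambda>(k, r, y). m k r y)" and
    m_le: "\<And>k r y. k1 \<le> k \<Longrightarrow> k \<le> k2 \<Longrightarrow> \<bar>r\<bar> \<le> R \<Longrightarrow> y \<ge> 0 \<Longrightarrow> norm (m k r y) \<le> 4" and
    m_eq: "\<And>k r y. k1 \<le> k \<Longrightarrow> k \<le> k2 \<Longrightarrow> \<bar>r\<bar> \<le> R \<Longrightarrow> y \<ge> 0 \<Longrightarrow> m k r y = of_real (k + tanh (y - \<delta>)) +
      (LINT d:{0..}|lborel. of_real (jost_kernel \<delta> k y d) * rayleigh_potential \<delta> (Complex (\<epsilon> * r) \<epsilon>) (y + d) * m k r (y + d))"
    by blast
  have m_cont_y: "continuous_on {0..} (m k r)" if "k1 \<le> k" "k \<le> k2" "\<bar>r\<bar> \<le> R" for k r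
  proof -
    have "continuous_on {0..} (\<lambda>y. (\<lambda>(k, r, y). m k r y) (k, r, y))"
      by (rule continuous_on_compose2[OF m_cont]) (use that in \<open>auto intro!: continuous_intros\<close>)
    then show ?thesis by simp
  qed
  have disp: "\<exists>w. m k r 0 = of_real (k - \<tau>) + Complex (\<epsilon> * r) \<epsilon> * w \<and> \<bar>Re w\<bar> \<le> M \<and> - b \<le> Im w \<and> Im w \<le> - b0"
    if k: "k1 \<le> k" "k \<le> k2" and r: "\<bar>r\<bar> \<le> R" for k r
  proof -
    define c where "c = Complex (\<epsilon> * r) \<epsilon>"
    define h0 where "h0 = 2 * jost_kernel \<delta> k 0 \<delta> * k"
    define J where "J = Complex ((ln ((1 - Re c)\<^sup>2 + (Im c)\<^sup>2) - ln ((tanh \<delta> + Re c)\<^sup>2 + (Im c)\<^sup>2)) / 2)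
      (arctan ((1 - Re c) / Im c) + arctan ((tanh \<delta> + Re c) / Im c))"
    have c: "Im c = \<epsilon>" "Re c = \<epsilon> * r" by (simp_all add: c_def)
    have "\<epsilon> * \<bar>r\<bar> \<le> \<epsilon> * R" using r \<epsilon>(1) by (intro mult_left_mono) auto
    then have absr: "\<bar>\<epsilon> * r\<bar> \<le> \<epsilon> * R" using \<epsilon>(1) by (simp add: abs_mult)
    then have a: "\<bar>\<epsilon> * r\<bar> \<le> \<tau> / 2" using \<epsilon>(3) by linarith
    have c_le: "cmod c \<le> \<epsilon> * (R + 1)"
      using cmod_le[of c] absr \<epsilon>(1) unfolding c distrib_left by simp
    have cpos: "Im c > 0" "\<bar>Re c\<bar> \<le> 1" using c \<epsilon>(1) a \<tau> by auto
    obtain w where w: "m k r 0 = of_real (k - tanh \<delta>) + c * w"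
      "cmod (w - of_real h0 * J) \<le> 30 * \<alpha> * (2 + cmod c * K \<epsilon>) + 1024 * \<alpha>\<^sup>2 * (cmod c * (K \<epsilon>)\<^sup>2)"
      "\<bar>Im (w - of_real h0 * J)\<bar> \<le> 30 * \<alpha> * (\<epsilon> * K \<epsilon> + cmod c * pi) + 1024 * \<alpha>\<^sup>2 * (cmod c * (K \<epsilon>)\<^sup>2)"
      using dispersion_estimate[OF \<delta> k12(1) k k12(3) cpos m_cont_y[OF k r] m_le[OF k r] m_eq[OF k r, folded c_def]]
      unfolding J_def h0_def K_def \<alpha>_def c(1) by blast
    have cK: "cmod c * K \<epsilon> \<le> 1"
      using mult_right_mono[OF c_le K0] \<epsilon>(6) by linarith
    have cK2: "1024 * \<alpha>\<^sup>2 * (cmod c * (K \<epsilon>)\<^sup>2) \<le> 1024 * \<alpha>\<^sup>2 * (\<epsilon> * (R + 1) * (K \<epsilon>)\<^sup>2)"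
      using c_le by (intro mult_left_mono mult_right_mono) auto
    have w1: "cmod (w - of_real h0 * J) \<le> 90 * \<alpha> + 1"
    proof -
      have "30 * \<alpha> * (2 + cmod c * K \<epsilon>) \<le> 30 * \<alpha> * 3" using cK \<alpha> by (intro mult_left_mono) auto
      then show ?thesis using w(2) cK2 \<epsilon>(7) by linarith
    qed
    have w2: "\<bar>Im (w - of_real h0 * J)\<bar> \<le> b0 / 2"
    proof -
      have "30 * \<alpha> * (\<epsilon> * K \<epsilon> + cmod c * pi) \<le> 30 * \<alpha> * (\<epsilon> * K \<epsilon> + \<epsilon> * (R + 1) * pi)"
        using c_le \<alpha> by (intro mult_left_mono add_left_mono mult_right_mono) auto
      then show ?thesis using w(3) cK2 \<epsilon>(5) by linarith
    qed
    have k01: "0 < k" "k < 1" using k k12 by auto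
    have h0: "h0 \<le> - b0"
      unfolding h0_def b0_def
      by (rule jost_kernel_at_inflection[OF k01 \<tau>_def \<delta>]) (use k k12 \<eta> k2_def in auto)
    have h0': "\<bar>h0\<bar> \<le> 16 * \<alpha>"
    proof -
      have "\<bar>jost_kernel \<delta> k 0 \<delta>\<bar> * k \<le> 8 * \<alpha> * 1"
        using k01 \<delta> \<alpha> jost_kernel_bound[OF k12(1) k k12(3), of \<delta> \<delta> 0]
        by (intro mult_mono) (auto simp: \<alpha>_def)
      then show ?thesis using k01 by (simp add: h0_def abs_mult mult.commute)
    qed
    have ReJ: "\<bar>Re J\<bar> \<le> MJ"
    proof -
      have e: "\<epsilon>\<^sup>2 \<le> 1" using \<epsilon>(1,4) \<tau> by (simp add: abs_square_le_1)
      have "(1 / 2)\<^sup>2 \<le> (1 - \<epsilon> * r)\<^sup>2" "(\<tau> / 2)\<^sup>2 \<le> (\<tau> + \<epsilon> * r)\<^sup>2"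
        "(1 - \<epsilon> * r)\<^sup>2 \<le> (3 / 2)\<^sup>2" "(\<tau> + \<epsilon> * r)\<^sup>2 \<le> (3 / 2)\<^sup>2"
        by (rule power_mono; use a \<tau> in linarith)+
      then have "1 / 4 \<le> (1 - \<epsilon> * r)\<^sup>2 + \<epsilon>\<^sup>2" "(1 - \<epsilon> * r)\<^sup>2 + \<epsilon>\<^sup>2 \<le> 4"
        "\<tau>\<^sup>2 / 4 \<le> (\<tau> + \<epsilon> * r)\<^sup>2 + \<epsilon>\<^sup>2" "(\<tau> + \<epsilon> * r)\<^sup>2 + \<epsilon>\<^sup>2 \<le> 4"
        using e zero_le_power2[of \<epsilon>] unfolding power_divide by (simp_all, linarith+)
      then have "\<bar>ln ((1 - \<epsilon> * r)\<^sup>2 + \<epsilon>\<^sup>2)\<bar> \<le> \<bar>ln (1 / 4)\<bar> + \<bar>ln 4\<bar>"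
        "\<bar>ln ((\<tau> + \<epsilon> * r)\<^sup>2 + \<epsilon>\<^sup>2)\<bar> \<le> \<bar>ln (\<tau>\<^sup>2 / 4)\<bar> + \<bar>ln 4\<bar>"
        using abs_ln_le[of "1 / 4" "(1 - \<epsilon> * r)\<^sup>2 + \<epsilon>\<^sup>2" 4]
          abs_ln_le[of "\<tau>\<^sup>2 / 4" "(\<tau> + \<epsilon> * r)\<^sup>2 + \<epsilon>\<^sup>2" 4] \<tau> by (blast intro: divide_pos_pos zero_less_power zero_less_numeral zero_less_one)+
      then show ?thesis by (simp add: J_def c MJ_def \<tau>_def)
    qed
    \<comment> \<open>Both arguments are at least 1, so Im J is at least \<pi>/2 > 3/2. The surplus
      pays for the remainder: 3/2 b0 - b0/2 = b0.\<close>
    have ImJ: "3 / 2 \<le> Im J" "Im J \<le> pi"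
    proof -
      have "1 \<le> (1 - \<epsilon> * r) / \<epsilon>" "1 \<le> (\<tau> + \<epsilon> * r) / \<epsilon>"
        using \<epsilon>(1,4) a \<tau> by (auto simp: pos_le_divide_eq)
      then have "pi / 4 \<le> arctan ((1 - \<epsilon> * r) / \<epsilon>)" "pi / 4 \<le> arctan ((\<tau> + \<epsilon> * r) / \<epsilon>)"
        unfolding arctan_one[symmetric] by (simp_all only: arctan_le_iff)
      then show "3 / 2 \<le> Im J" "Im J \<le> pi"
        using pi_gt3 arctan_ubound[of "(1 - \<epsilon> * r) / \<epsilon>"] arctan_ubound[of "(\<tau> + \<epsilon> * r) / \<epsilon>"]
        by (auto simp: J_def c \<tau>_def)
    qed
    show ?thesis
    proof (intro exI[of _ w] conjI)
      show "m k r 0 = of_real (k - \<tau>) + Complex (\<epsilon> * r) \<epsilon> * w"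
        using w(1) by (simp add: c_def \<tau>_def)
      have "\<bar>h0 * Re J\<bar> \<le> 16 * \<alpha> * MJ"
        unfolding abs_mult using h0' ReJ \<alpha> by (intro mult_mono) auto
      moreover have "\<bar>Re w - h0 * Re J\<bar> \<le> 90 * \<alpha> + 1"
        using w1 abs_Re_le_cmod[of "w - of_real h0 * J"] by simp
      ultimately show "\<bar>Re w\<bar> \<le> M" unfolding M_def by linarith
      have Im: "\<bar>Im w - h0 * Im J\<bar> \<le> b0 / 2" using w2 by simp
      have "(- h0) * Im J \<le> 16 * \<alpha> * pi" using h0' ImJ \<alpha> by (intro mult_mono) auto
      then show "- b \<le> Im w" using Im b0 unfolding b_def by linarith
      have "b0 * (3 / 2) \<le> (- h0) * Im J" using h0 ImJ b0 by (intro mult_mono) auto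
      then show "Im w \<le> - b0" using Im by linarith
    qed
  qed
  define S where "S = cbox (k1, - R) (k2, R)"
  have S: "(k, r) \<in> S \<longleftrightarrow> k1 \<le> k \<and> k \<le> k2 \<and> \<bar>r\<bar> \<le> R" for k r
    by (auto simp: S_def cbox_Pair_eq)
  define F where "F = (\<lambda>(k, r). m k r 0)"
  \<comment> \<open>Fixed points of \<open>G\<close> are zeros of \<open>F\<close>. The first
    component is \<tau> up to O(\<epsilon>). In the second, Im F / \<epsilon> = r Im w + Re w with
    Im w negative, so the plus sign pulls r inwards, and division by \<open>b\<close> keeps the
    factor 1 + Im w / b between 0 and 1 - b0 / b.\<close>
  define G where "G = (\<lambda>p. (fst p - Re (F p), snd p + Im (F p) / (\<epsilon> * b)))"
  have cont_F: "continuous_on S F"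
  proof -
    have "continuous_on S (\<lambda>p. (\<lambda>(k, r, y). m k r y) (fst p, snd p, 0))"
      by (rule continuous_on_compose2[OF m_cont]) (use S in \<open>auto intro!: continuous_intros simp: abs_le_iff\<close>)
    then show ?thesis by (simp add: F_def case_prod_unfold)
  qed
  obtain p where p: "p \<in> S" "G p = p"
  proof (rule brouwer[of S G])
    show "compact S" "convex S" by (simp_all add: S_def convex_box)
    have "(\<tau>, 0) \<in> S" using S R \<eta> by (simp add: k1_def k2_def)
    then show "S \<noteq> {}" by blast
    show "continuous_on S G"
      unfolding G_def using \<epsilon>(1) b by (intro continuous_intros cont_F) auto
    show "G \<in> S \<rightarrow> S"
    proof
      fix p assume "p \<in> S"
      then obtain k r where p: "p = (k, r)" and kr: "k1 \<le> k" "k \<le> k2" "\<bar>r\<bar> \<le> R"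
        using S by (cases p) auto
      obtain w where w: "m k r 0 = of_real (k - \<tau>) + Complex (\<epsilon> * r) \<epsilon> * w" "\<bar>Re w\<bar> \<le> M" "- b \<le> Im w" "Im w \<le> - b0"
        using disp[OF kr] by blast
      have ReF: "Re (F p) = k - \<tau> + Re (Complex (\<epsilon> * r) \<epsilon> * w)"
        by (simp add: F_def p w(1))
      have ImF: "Im (F p) = \<epsilon> * (r * Im w + Re w)"
        by (simp add: F_def p w(1) algebra_simps)
      have "\<bar>Re (Complex (\<epsilon> * r) \<epsilon> * w)\<bar> \<le> \<epsilon> * (R + 1) * (M + b)"
      proof -
        have "Re (Complex (\<epsilon> * r) \<epsilon> * w) = \<epsilon> * (r * Re w - Im w)"
          by (simp add: algebra_simps)
        then have "\<bar>Re (Complex (\<epsilon> * r) \<epsilon> * w)\<bar> = \<epsilon> * \<bar>r * Re w - Im w\<bar>"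
          using \<epsilon>(1) by (simp only: abs_mult abs_of_pos)
        also have "\<dots> \<le> \<epsilon> * (R * M + b)"
        proof (intro mult_left_mono)
          have "\<bar>r * Re w\<bar> \<le> R * M" unfolding abs_mult using kr w R by (intro mult_mono) auto
          then show "\<bar>r * Re w - Im w\<bar> \<le> R * M + b" using w b0 by linarith
        qed (use \<epsilon>(1) in auto)
        also have "\<dots> \<le> \<epsilon> * ((R + 1) * (M + b))"
          using \<epsilon>(1) R M b by (intro mult_left_mono) (auto simp: algebra_simps)
        finally show ?thesis by simp
      qed
      then have 1: "k1 \<le> k - Re (F p)" "k - Re (F p) \<le> k2"
        using \<epsilon>(8) unfolding ReF k1_def k2_def by linarith+
      have "r + Im (F p) / (\<epsilon> * b) = r * (1 + Im w / b) + Re w / b"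
        using \<epsilon>(1) b by (simp add: ImF field_simps)
      also have "\<bar>\<dots>\<bar> \<le> R * (1 - b0 / b) + M / b"
      proof (rule order_trans[OF abs_triangle_ineq], rule add_mono)
        have "- 1 \<le> Im w / b" "Im w / b \<le> - (b0 / b)"
          using w(3,4) b by (auto simp: pos_le_divide_eq pos_divide_le_eq)
        then show "\<bar>r * (1 + Im w / b)\<bar> \<le> R * (1 - b0 / b)"
          unfolding abs_mult using kr R by (intro mult_mono) auto
        show "\<bar>Re w / b\<bar> \<le> M / b" using w(2) b by (simp add: divide_right_mono)
      qed
      \<comment> \<open>Equality holds because \<open>R\<close> was chosen with R b0 = M.\<close>
      also have "\<dots> = R" using b b0 by (simp add: R_def field_simps)
      finally show "G p \<in> S" using 1 by (simp add: G_def p S)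
    qed
  qed (use cont_F in auto)
  obtain k r where pk: "p = (k, r)" by (cases p)
  have kr: "k1 \<le> k" "k \<le> k2" "\<bar>r\<bar> \<le> R" using p(1) S by (auto simp: pk)
  have "Re (F p) = 0" "Im (F p) / (\<epsilon> * b) = 0" using p(2) by (auto simp: G_def pk)
  then have F0: "m k r 0 = 0" using \<epsilon>(1) b by (simp add: F_def pk complex_eq_iff)
  show thesis
    by (rule that[of k "Complex (\<epsilon> * r) \<epsilon>" "m k r"]) (use kr k12 \<epsilon>(1) F0 m_cont_y m_le m_eq in auto)
qed

text \<open>Adding \<zeta> to the profile and to the phase velocity leaves U - c and the derivatives
  of U unchanged, so the mode found for \<zeta> = 0 is used with phase velocity c + \<zeta> of the
  same imaginary part.\<close>

lemma linearly_unstable_tanh: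
  assumes \<delta>: "\<delta> > 0"
  shows "linearly_unstable (\<lambda>y. tanh (y - \<delta>) + \<zeta>)"
proof -
  obtain k c m where k: "0 < k" "k < 1" and c: "Im c > 0" and m_cont: "continuous_on {0..} m" and m0: "m 0 = 0"
    and m_le: "\<And>y. y \<ge> 0 \<Longrightarrow> norm (m y) \<le> 4"
    and m_eq: "\<And>y. y \<ge> 0 \<Longrightarrow> m y = of_real (k + tanh (y - \<delta>)) +
      (LINT d:{0..}|lborel. of_real (jost_kernel \<delta> k y d) * rayleigh_potential \<delta> c (y + d) * m (y + d))"
    using exists_unstable_jost_solution[OF \<delta>] by blast
  define \<Psi> where "\<Psi> = (\<lambda>y. of_real (exp (- k * y)) * m y)"
  obtain \<Psi>' C' where \<Psi>: "\<And>y. y > 0 \<Longrightarrow> (\<Psi> has_vector_derivative \<Psi>' y) (at y)"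
    and \<Psi>': "\<And>y. y > 0 \<Longrightarrow> (\<Psi>' has_vector_derivative
        (of_real (k\<^sup>2 - 2 * (1 - (tanh (y - \<delta>))\<^sup>2)) - rayleigh_potential \<delta> c y) * \<Psi> y) (at y)"
    and \<Psi>'_le: "\<And>y. y > 0 \<Longrightarrow> norm (\<Psi>' y) \<le> C' * exp (- k * y)"
    using jost_solution_regular[OF k c m_cont m_le m_eq] unfolding \<Psi>_def by blast
  show ?thesis
  proof (rule rayleigh_imp_linearly_unstable[of k "c + of_real \<zeta>" k _ "\<lambda>y. 1 - (tanh (y - \<delta>))\<^sup>2"
      "\<lambda>y. - 2 * tanh (y - \<delta>) * (1 - (tanh (y - \<delta>))\<^sup>2)" \<Psi> \<Psi>'
      "\<lambda>y. (of_real (k\<^sup>2 - 2 * (1 - (tanh (y - \<delta>))\<^sup>2)) - rayleigh_potential \<delta> c y) * \<Psi> y" "max 4 C'"])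
    fix y :: real assume y: "y > 0"
    show "((\<lambda>y. tanh (y - \<delta>) + \<zeta>) has_real_derivative 1 - (tanh (y - \<delta>))\<^sup>2) (at y)"
      by (auto intro!: derivative_eq_intros)
    show "((\<lambda>y. 1 - (tanh (y - \<delta>))\<^sup>2) has_real_derivative - 2 * tanh (y - \<delta>) * (1 - (tanh (y - \<delta>))\<^sup>2)) (at y)"
      by (auto intro!: derivative_eq_intros)
    show "(\<Psi> has_vector_derivative \<Psi>' y) (at y)" by (rule \<Psi>[OF y])
    show "(\<Psi>' has_vector_derivative
        (of_real (k\<^sup>2 - 2 * (1 - (tanh (y - \<delta>))\<^sup>2)) - rayleigh_potential \<delta> c y) * \<Psi> y) (at y)"
      by (rule \<Psi>'[OF y])
    show "norm (\<Psi>' y) \<le> max 4 C' * exp (- k * y)"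
      using \<Psi>'_le[OF y] by (rule order_trans) (auto intro!: mult_right_mono)
    have "norm (\<Psi> y) = exp (- k * y) * norm (m y)" by (simp add: \<Psi>_def norm_mult)
    also have "\<dots> \<le> exp (- k * y) * max 4 C'" using m_le[of y] y by (intro mult_left_mono) auto
    finally show "norm (\<Psi> y) \<le> max 4 C' * exp (- k * y)" by (simp only: mult.commute)
    have "(of_real (tanh (y - \<delta>)) - c) * rayleigh_potential \<delta> c y = 2 * c * of_real (1 - (tanh (y - \<delta>))\<^sup>2)"
      using of_real_diff_ne_0[OF c] by (simp add: rayleigh_potential_def)
    then show "(of_real (tanh (y - \<delta>) + \<zeta>) - (c + of_real \<zeta>)) *
        ((of_real (k\<^sup>2 - 2 * (1 - (tanh (y - \<delta>))\<^sup>2)) - rayleigh_potential \<delta> c y) * \<Psi> y - (of_real k)\<^sup>2 * \<Psi> y)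
        = of_real (- 2 * tanh (y - \<delta>) * (1 - (tanh (y - \<delta>))\<^sup>2)) * \<Psi> y"
      unfolding of_real_add of_real_diff of_real_mult of_real_minus of_real_power of_real_numeral of_real_1
      by algebra
  next
    show "continuous_on {0..} \<Psi>"
      unfolding \<Psi>_def by (intro continuous_intros m_cont)
    \<comment> \<open>If \<Psi> vanished for all y > 0, the Volterra equation at y = \<delta> would
      read 0 = k + tanh 0 = k, contradicting k > 0.\<close>
    show "\<exists>y>0. \<Psi> y \<noteq> 0"
    proof (rule ccontr)
      assume "\<not> ?thesis"
      then have "m y = 0" if "y > 0" for y using that by (auto simp: \<Psi>_def)
      then have "(LINT d:{0..}|lborel. of_real (jost_kernel \<delta> k \<delta> d) * rayleigh_potential \<delta> c (\<delta> + d) * m (\<delta> + d)) = 0"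
        "m \<delta> = 0"
        using \<delta> by (auto simp: set_lebesgue_integral_def indicator_def intro!: integral_eq_zero_AE)
      then show False using m_eq[of \<delta>] \<delta> k by simp
    qed
  qed (use k c m0 in \<open>auto simp: \<Psi>_def\<close>)
qed

theorem proposition4p1:
  fixes \<delta> \<zeta> :: real
  assumes "\<delta> > 0"
  shows "shear_flow (\<lambda>y. tanh (y - \<delta>) + \<zeta>) \<and> linearly_unstable (\<lambda>y. tanh (y - \<delta>) + \<zeta>)"
  using shear_flow_tanh linearly_unstable_tanh[OF assms] by blast

end
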